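(* Let $\Omega\subseteq\mathbb{R}^n$ be open. The restriction map $\mathcal{L}(\mathcal{G}(\Omega),\widetilde{\mathbb{C}})\to\mathcal{L}(\mathcal{G}_c(\Omega),\widetilde{\mathbb{C}})$, $S\mapsto S|_{\mathcal{G}_c(\Omega)}$, is injective, and $\mathcal{L}(\mathcal{G}(\Omega),\widetilde{\mathbb{C}})$ is identified with its image. A map $T\in\mathcal{L}(\mathcal{G}_c(\Omega),\widetilde{\mathbb{C}})$ belongs to $\mathcal{L}(\mathcal{G}(\Omega),\widetilde{\mathbb{C}})$ (that is, $T$ is the restriction to $\mathcal{G}_c(\Omega)$ of some element of $\mathcal{L}(\mathcal{G}(\Omega),\widetilde{\mathbb{C}})$) if and only if $\mathrm{supp}\,T$ is a compact subset of $\Omega$.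
   Context: All nets are indexed by $\varepsilon\in(0,1]$ and $O$-estimates are for $\varepsilon\to 0$. Generalized numbers: $\widetilde{\mathbb{C}}$ is the ring of nets $(z_\varepsilon)_\varepsilon\in\mathbb{C}^{(0,1]}$ with $|z_\varepsilon|=O(\varepsilon^{-N})$ for some $N\in\mathbb{N}$, modulo the nets with $|z_\varepsilon|=O(\varepsilon^q)$ for all $q\in\mathbb{N}$. For $z=[(z_\varepsilon)_\varepsilon]$, $\mathrm{v}(z)=\sup\{b\in\mathbb{R}: |z_\varepsilon|=O(\varepsilon^b)\}$ and $|z|_{\mathrm e}=e^{-\mathrm{v}(z)}$; $\widetilde{\mathbb{C}}$ carries the topology of the ultrametric $|z-z'|_{\mathrm e}$. Colombeau algebra: $\mathcal{G}(\Omega)=\mathcal{E}_M(\Omega)/\mathcal{N}(\Omega)$, where $\mathcal{E}_M(\Omega)$ is the set of nets $(u_\varepsilon)_\varepsilon\in C^\infty(\Omega)^{(0,1]}$ such that for all compact $K\subset\Omega$ and $\alpha\in\mathbb{N}^n$ there is $N\in\mathbb{N}$ with $\sup_{x\in K}|\partial^\alpha u_\varepsilon(x)|=O(\varepsilon^{-N})$, and $\mathcal{N}(\Omega)$ is the set of nets such that for all $K,\alpha$ and all $q\in\mathbb{N}$, $\sup_{x\in K}|\partial^\alpha u_\varepsilon(x)|=O(\varepsilon^{q})$. The support of $u\in\mathcal{G}(\Omega)$ is the complement in $\Omega$ of the largest open set on which $u$ restricts to $0$; $\mathcal{G}_c(\Omega)$ is the set of $u\in\mathcal{G}(\Omega)$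 with compact support, and $\mathcal{G}_K(\Omega)=\{u:\mathrm{supp}\,u\subseteq K\}$ for $K\subset\Omega$ compact. Topologies: an ultra-pseudo-seminorm on a $\widetilde{\mathbb{C}}$-module $\mathcal{M}$ is a map $\mathcal{P}:\mathcal{M}\to[0,\infty)$ with $\mathcal{P}(0)=0$, $\mathcal{P}(\lambda u)\le|\lambda|_{\mathrm e}\mathcal{P}(u)$ for $\lambda\in\widetilde{\mathbb{C}}$, equality holding if $\lambda=[(c\varepsilon^a)_\varepsilon]$ with $c\in\mathbb{C}\setminus\{0\}$, $a\in\mathbb{R}$, and $\mathcal{P}(u+v)\le\max\{\mathcal{P}(u),\mathcal{P}(v)\}$. Locally convex $\widetilde{\mathbb{C}}$-linear topologies are those determined by families of ultra-pseudo-seminorms. $\mathcal{G}(\Omega)$ carries the topology of the family $\mathcal{P}_{K,j}(u)=\exp(-\sup\{b\in\mathbb{R}:\sup_{x\in K,|\alpha|\le j}|\partial^\alpha u_\varepsilon(x)|=O(\varepsilon^b)\})$, $K\subset\Omega$ compact, $j\in\mathbb{N}$. $\mathcal{G}_K(\Omega)$ carries the topology of $\mathcal{P}_{\mathcal{G}_K(\Omega),j}(u):=\mathcal{P}_{K',j}(u)$, $j\in\mathbb{N}$, with $K'\subset\Omega$ any compact set with $K\subseteq\mathrm{int}(K')$ (the value does not depend on $K'$). $\mathcal{G}_c(\Omega)=\bigcup_n\mathcal{G}_{K_n}(\Omega)$, $(K_n)_n$ an exhausting sequence of compact subsets of $\Omega$, carries the strict inductive limit topology, i.e. the finest locally convex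 $\widetilde{\mathbb{C}}$-linear topology making all inclusions $\mathcal{G}_{K_n}(\Omega)\to\mathcal{G}_c(\Omega)$ continuous. $\mathcal{L}(\mathcal{M},\widetilde{\mathbb{C}})$ denotes the space of continuous $\widetilde{\mathbb{C}}$-linear functionals $\mathcal{M}\to\widetilde{\mathbb{C}}$. For $V\subseteq\Omega$ open and $T\in\mathcal{L}(\mathcal{G}_c(\Omega),\widetilde{\mathbb{C}})$, $T|_V$ is the restriction of $T$ to $\mathcal{G}_c(V)\subseteq\mathcal{G}_c(\Omega)$, and $\mathrm{supp}\,T$ is the complement in $\Omega$ of the largest open subset of $\Omega$ on which $T$ is $0$: $x\in\Omega\setminus\mathrm{supp}\,T$ iff there is an open neighbourhood $V\subseteq\Omega$ of $x$ with $T|_V=0$. *)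

theory Defs
  imports "HOL-Analysis.Analysis" "HOL-Library.Landau_Symbols"
begin

text \<open>
  A net indexed by \<open>(0,1]\<close> is represented by a function on \<open>real\<close>. All growth conditions only
  involve the filter \<open>at_right 0\<close>, so that the values at indices outside \<open>(0,1]\<close> are
  irrelevant and disappear in the quotients.
\<close>

definition moderate :: "(real \<Rightarrow> complex) \<Rightarrow> bool" where
  "moderate z \<longleftrightarrow>
     (\<exists>N::nat. (\<lambda>\<epsilon>. norm (z \<epsilon>)) \<in> O[at_right 0](\<lambda>\<epsilon>. \<epsilon> powr (- real N)))"

definition negligible_net :: "(real \<Rightarrow> complex) \<Rightarrow> bool" where
  "negligible_net z \<longleftrightarrow>
     (\<forall>q::nat. (\<lambda>\<epsilon>. norm (z \<epsilon>)) \<in> O[at_right 0](\<lambda>\<epsilon>. \<epsilon> powr (real q)))"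

definition gcrel :: "(real \<Rightarrow> complex) \<Rightarrow> (real \<Rightarrow> complex) \<Rightarrow> bool" where
  "gcrel z w \<longleftrightarrow> moderate z \<and> moderate w \<and> negligible_net (\<lambda>\<epsilon>. z \<epsilon> - w \<epsilon>)"

lemma powr_bigo_mono:
  assumes "a \<le> b"
  shows "(\<lambda>\<epsilon>::real. \<epsilon> powr b) \<in> O[at_right 0](\<lambda>\<epsilon>. \<epsilon> powr a)"
proof (rule landau_o.bigI[where c = 1])
  have "eventually (\<lambda>\<epsilon>::real. \<epsilon> \<in> {0<..<1}) (at_right 0)"
    by (rule eventually_at_right_real) simp
  then show "eventually (\<lambda>\<epsilon>::real. norm (\<epsilon> powr b) \<le> 1 * norm (\<epsilon> powr a)) (at_right 0)"
    by eventually_elim (use assms in \<open>auto intro!: powr_mono'\<close>)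
qed simp

lemma bigo_norm_add:
  fixes z w :: "real \<Rightarrow> complex"
  assumes "(\<lambda>\<epsilon>. norm (z \<epsilon>)) \<in> O[F](g)" "(\<lambda>\<epsilon>. norm (w \<epsilon>)) \<in> O[F](g)"
  shows "(\<lambda>\<epsilon>. norm (z \<epsilon> + w \<epsilon>)) \<in> O[F](g :: real \<Rightarrow> real)"
proof -
  have "(\<lambda>\<epsilon>. norm (z \<epsilon>) + norm (w \<epsilon>)) \<in> O[F](g)"
    using assms by (rule sum_in_bigo)
  moreover have "(\<lambda>\<epsilon>. norm (z \<epsilon> + w \<epsilon>)) \<in> O[F](\<lambda>\<epsilon>. norm (z \<epsilon>) + norm (w \<epsilon>))"
    by (rule landau_o.bigI[where c = 1]) (simp_all add: norm_triangle_ineq)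
  ultimately show ?thesis by (rule landau_o.big_trans[rotated])
qed

lemma moderate_const: "moderate (\<lambda>_. c)"
proof -
  have "(\<lambda>_::real. norm c) \<in> O[at_right 0](\<lambda>_. 1)" by simp
  also have "(\<lambda>_. 1) \<in> O[at_right 0](\<lambda>\<epsilon>::real. \<epsilon> powr (- real 0))"
    by (rule landau_o.bigI[where c = 1]) (auto simp: eventually_at_right_field intro!: exI[of _ 1])
  finally show ?thesis unfolding moderate_def by blast
qed

lemma moderate_add:
  assumes "moderate z" "moderate w"
  shows "moderate (\<lambda>\<epsilon>. z \<epsilon> + w \<epsilon>)"
proof -
  from assms obtain M N :: nat where
    M: "(\<lambda>\<epsilon>. norm (z \<epsilon>)) \<in> O[at_right 0](\<lambda>\<epsilon>. \<epsilon> powr (- real M))" and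
    N: "(\<lambda>\<epsilon>. norm (w \<epsilon>)) \<in> O[at_right 0](\<lambda>\<epsilon>. \<epsilon> powr (- real N))"
    unfolding moderate_def by blast
  let ?g = "\<lambda>\<epsilon>::real. \<epsilon> powr (- real (max M N))"
  have "(\<lambda>\<epsilon>. norm (z \<epsilon>)) \<in> O[at_right 0](?g)" "(\<lambda>\<epsilon>. norm (w \<epsilon>)) \<in> O[at_right 0](?g)"
    by (rule landau_o.big_trans[OF M powr_bigo_mono], simp,
        rule landau_o.big_trans[OF N powr_bigo_mono], simp)
  then show ?thesis unfolding moderate_def by (blast intro: bigo_norm_add)
qed

lemma moderate_uminus: "moderate z \<Longrightarrow> moderate (\<lambda>\<epsilon>. - z \<epsilon>)"
  by (simp add: moderate_def)

lemma moderate_diff: "moderate z \<Longrightarrow> moderate w \<Longrightarrow> moderate (\<lambda>\<epsilon>. z \<epsilon> - w \<epsilon>)"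
  using moderate_add[of z "\<lambda>\<epsilon>. - w \<epsilon>"] moderate_uminus[of w] by simp

lemma moderate_mult:
  assumes "moderate z" "moderate w"
  shows "moderate (\<lambda>\<epsilon>. z \<epsilon> * w \<epsilon>)"
proof -
  from assms obtain M N :: nat where
    M: "(\<lambda>\<epsilon>. norm (z \<epsilon>)) \<in> O[at_right 0](\<lambda>\<epsilon>. \<epsilon> powr (- real M))" and
    N: "(\<lambda>\<epsilon>. norm (w \<epsilon>)) \<in> O[at_right 0](\<lambda>\<epsilon>. \<epsilon> powr (- real N))"
    unfolding moderate_def by blast
  have "(\<lambda>\<epsilon>. norm (z \<epsilon> * w \<epsilon>)) \<in> O[at_right 0](\<lambda>\<epsilon>. \<epsilon> powr (- real (M + N)))"
    using landau_o.big_mult[OF M N] by (simp add: norm_mult powr_add[symmetric] add.commute)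
  then show ?thesis unfolding moderate_def by blast
qed

lemma moderate_powr: "moderate (\<lambda>\<epsilon>. c * complex_of_real (\<epsilon> powr a))"
proof (rule moderate_mult[OF moderate_const])
  have "(\<lambda>\<epsilon>::real. \<epsilon> powr a) \<in> O[at_right 0](\<lambda>\<epsilon>. \<epsilon> powr (- real (nat \<lceil>- a\<rceil>)))"
    by (rule powr_bigo_mono) linarith
  then show "moderate (\<lambda>\<epsilon>. complex_of_real (\<epsilon> powr a))"
    unfolding moderate_def by (intro exI[of _ "nat \<lceil>- a\<rceil>"]) simp
qed

lemma negligible_net_zero: "negligible_net (\<lambda>_. 0)"
  by (simp add: negligible_net_def)

lemma negligible_net_add:
  "negligible_net z \<Longrightarrow> negligible_net w \<Longrightarrow> negligible_net (\<lambda>\<epsilon>. z \<epsilon> + w \<epsilon>)"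
  unfolding negligible_net_def by (blast intro: bigo_norm_add)

lemma negligible_net_uminus: "negligible_net z \<Longrightarrow> negligible_net (\<lambda>\<epsilon>. - z \<epsilon>)"
  by (simp add: negligible_net_def)

lemma negligible_net_powr:
  assumes "negligible_net z"
  shows "(\<lambda>\<epsilon>. norm (z \<epsilon>)) \<in> O[at_right 0](\<lambda>\<epsilon>. \<epsilon> powr b)"
proof -
  have "(\<lambda>\<epsilon>. norm (z \<epsilon>)) \<in> O[at_right 0](\<lambda>\<epsilon>. \<epsilon> powr (real (nat \<lceil>b\<rceil>)))"
    using assms unfolding negligible_net_def by blast
  also have "(\<lambda>\<epsilon>::real. \<epsilon> powr (real (nat \<lceil>b\<rceil>))) \<in> O[at_right 0](\<lambda>\<epsilon>. \<epsilon> powr b)"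
    by (rule powr_bigo_mono) linarith
  finally show ?thesis .
qed

lemma negligible_net_mult:
  assumes "moderate z" "negligible_net w"
  shows "negligible_net (\<lambda>\<epsilon>. z \<epsilon> * w \<epsilon>)"
  unfolding negligible_net_def
proof
  fix q :: nat
  from assms(1) obtain N :: nat where
    N: "(\<lambda>\<epsilon>. norm (z \<epsilon>)) \<in> O[at_right 0](\<lambda>\<epsilon>. \<epsilon> powr (- real N))"
    unfolding moderate_def by blast
  show "(\<lambda>\<epsilon>. norm (z \<epsilon> * w \<epsilon>)) \<in> O[at_right 0](\<lambda>\<epsilon>. \<epsilon> powr (real q))"
    using landau_o.big_mult[OF N negligible_net_powr[OF assms(2), of "real (N + q)"]]
    by (simp add: norm_mult powr_add[symmetric])
qed

lemma gcrel_refl: "moderate z \<Longrightarrow> gcrel z z"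
  by (simp add: gcrel_def negligible_net_zero)

lemma gcrel_moderate: "gcrel z z \<Longrightarrow> moderate z"
  by (simp add: gcrel_def)

lemma gcrel_eqI:
  assumes "moderate z" "\<And>\<epsilon>. z \<epsilon> = w \<epsilon>"
  shows "gcrel z w"
proof -
  have "z = w" using assms(2) by blast
  with assms(1) show ?thesis by (simp add: gcrel_refl)
qed

lemma part_equivp_gcrel: "part_equivp gcrel"
proof (rule part_equivpI)
  show "\<exists>z. gcrel z z"
    using gcrel_refl[OF moderate_const] by blast
  show "symp gcrel"
  proof (rule sympI)
    fix z w assume "gcrel z w"
    then show "gcrel w z"
      using negligible_net_uminus[of "\<lambda>\<epsilon>. z \<epsilon> - w \<epsilon>"] by (simp add: gcrel_def)
  qed
  show "transp gcrel"
  proof (rule transpI)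
    fix z w y assume "gcrel z w" "gcrel w y"
    then show "gcrel z y"
      using negligible_net_add[of "\<lambda>\<epsilon>. z \<epsilon> - w \<epsilon>" "\<lambda>\<epsilon>. w \<epsilon> - y \<epsilon>"] by (simp add: gcrel_def)
  qed
qed

quotient_type gcomplex = "real \<Rightarrow> complex" / partial: gcrel
  by (rule part_equivp_gcrel)

instantiation gcomplex :: comm_ring_1
begin

lift_definition zero_gcomplex :: gcomplex is "\<lambda>_. 0"
  by (rule gcrel_refl[OF moderate_const])

lift_definition one_gcomplex :: gcomplex is "\<lambda>_. 1"
  by (rule gcrel_refl[OF moderate_const])

lift_definition plus_gcomplex :: "gcomplex \<Rightarrow> gcomplex \<Rightarrow> gcomplex" is "\<lambda>z w \<epsilon>. z \<epsilon> + w \<epsilon>"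
proof -
  fix z z' w w' assume "gcrel z z'" "gcrel w w'"
  then show "gcrel (\<lambda>\<epsilon>. z \<epsilon> + w \<epsilon>) (\<lambda>\<epsilon>. z' \<epsilon> + w' \<epsilon>)"
    using negligible_net_add[of "\<lambda>\<epsilon>. z \<epsilon> - z' \<epsilon>" "\<lambda>\<epsilon>. w \<epsilon> - w' \<epsilon>"]
    by (simp add: gcrel_def moderate_add algebra_simps)
qed

lift_definition uminus_gcomplex :: "gcomplex \<Rightarrow> gcomplex" is "\<lambda>z \<epsilon>. - z \<epsilon>"
proof -
  fix z z' assume "gcrel z z'"
  then show "gcrel (\<lambda>\<epsilon>. - z \<epsilon>) (\<lambda>\<epsilon>. - z' \<epsilon>)"
    using negligible_net_uminus[of "\<lambda>\<epsilon>. z \<epsilon> - z' \<epsilon>"]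
    by (simp add: gcrel_def moderate_uminus)
qed

lift_definition minus_gcomplex :: "gcomplex \<Rightarrow> gcomplex \<Rightarrow> gcomplex" is "\<lambda>z w \<epsilon>. z \<epsilon> - w \<epsilon>"
proof -
  fix z z' w w' assume "gcrel z z'" "gcrel w w'"
  then show "gcrel (\<lambda>\<epsilon>. z \<epsilon> - w \<epsilon>) (\<lambda>\<epsilon>. z' \<epsilon> - w' \<epsilon>)"
    using negligible_net_add[of "\<lambda>\<epsilon>. z \<epsilon> - z' \<epsilon>" "\<lambda>\<epsilon>. - (w \<epsilon> - w' \<epsilon>)"]
      negligible_net_uminus[of "\<lambda>\<epsilon>. w \<epsilon> - w' \<epsilon>"]
    by (simp add: gcrel_def moderate_diff algebra_simps)
qed

lift_definition times_gcomplex :: "gcomplex \<Rightarrow> gcomplex \<Rightarrow> gcomplex" is "\<lambda>z w \<epsilon>. z \<epsilon> * w \<epsilon>"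
proof -
  fix z z' w w' assume a: "gcrel z z'" "gcrel w w'"
  have "negligible_net (\<lambda>\<epsilon>. z \<epsilon> * (w \<epsilon> - w' \<epsilon>) + w' \<epsilon> * (z \<epsilon> - z' \<epsilon>))"
    using a by (intro negligible_net_add negligible_net_mult) (auto simp: gcrel_def)
  moreover have "(\<lambda>\<epsilon>. z \<epsilon> * (w \<epsilon> - w' \<epsilon>) + w' \<epsilon> * (z \<epsilon> - z' \<epsilon>)) = (\<lambda>\<epsilon>. z \<epsilon> * w \<epsilon> - z' \<epsilon> * w' \<epsilon>)"
    by (auto simp: algebra_simps)
  ultimately show "gcrel (\<lambda>\<epsilon>. z \<epsilon> * w \<epsilon>) (\<lambda>\<epsilon>. z' \<epsilon> * w' \<epsilon>)"
    using a by (simp add: gcrel_def moderate_mult)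
qed

instance
proof
  have "\<not> negligible_net (\<lambda>_. 1)"
  proof
    assume "negligible_net (\<lambda>_. 1)"
    then have "(\<lambda>_::real. 1::real) \<in> O[at_right 0](\<lambda>\<epsilon>. \<epsilon> powr 1)"
      using negligible_net_powr[of "\<lambda>_. 1" 1] by simp
    then obtain c where c: "c > 0" "eventually (\<lambda>\<epsilon>::real. 1 \<le> c * \<bar>\<epsilon> powr 1\<bar>) (at_right 0)"
      by (auto elim!: landau_o.bigE)
    have "eventually (\<lambda>\<epsilon>::real. \<epsilon> \<in> {0<..<1 / c}) (at_right 0)"
      by (rule eventually_at_right_real) (use c in simp)
    with c(2) have "eventually (\<lambda>\<epsilon>::real. False) (at_right 0)"
      by eventually_elim (use c(1) in \<open>auto simp: field_simps\<close>)
    then show False by simp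
  qed
  then show "(0::gcomplex) \<noteq> 1"
    by transfer (use negligible_net_uminus[of "\<lambda>_. - 1"] in \<open>auto simp: gcrel_def\<close>)
qed (transfer; rule gcrel_eqI;
      (intro moderate_add moderate_mult moderate_uminus moderate_diff moderate_const)?;
      (erule gcrel_moderate)?; simp add: algebra_simps)+

end

lift_definition gcpow :: "complex \<Rightarrow> real \<Rightarrow> gcomplex" is "\<lambda>c a \<epsilon>. c * complex_of_real (\<epsilon> powr a)"
  by (rule gcrel_refl[OF moderate_powr])

text \<open>The valuation takes the value \<open>\<infinity>\<close> exactly at \<open>0\<close>, whence the type \<open>ereal\<close>.\<close>

lift_definition valuation :: "gcomplex \<Rightarrow> ereal" is
  "\<lambda>z. Sup (ereal ` {b. (\<lambda>\<epsilon>. norm (z \<epsilon>)) \<in> O[at_right 0](\<lambda>\<epsilon>. \<epsilon> powr b)})"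
proof -
  fix z w assume "gcrel z w"
  then have "negligible_net (\<lambda>\<epsilon>. z \<epsilon> - w \<epsilon>)" "negligible_net (\<lambda>\<epsilon>. w \<epsilon> - z \<epsilon>)"
    using negligible_net_uminus[of "\<lambda>\<epsilon>. z \<epsilon> - w \<epsilon>"] by (auto simp: gcrel_def)
  note d = this[THEN negligible_net_powr]
  have "(\<lambda>\<epsilon>. norm (z \<epsilon>)) \<in> O[at_right 0](\<lambda>\<epsilon>. \<epsilon> powr b) \<longleftrightarrow>
        (\<lambda>\<epsilon>. norm (w \<epsilon>)) \<in> O[at_right 0](\<lambda>\<epsilon>. \<epsilon> powr b)" for b
    using bigo_norm_add[OF _ d(1)[of b], of w] bigo_norm_add[OF _ d(2)[of b], of z] by auto
  then show "Sup (ereal ` {b. (\<lambda>\<epsilon>. norm (z \<epsilon>)) \<in> O[at_right 0](\<lambda>\<epsilon>. \<epsilon> powr b)}) =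
        Sup (ereal ` {b. (\<lambda>\<epsilon>. norm (w \<epsilon>)) \<in> O[at_right 0](\<lambda>\<epsilon>. \<epsilon> powr b)})"
    by simp
qed

text \<open>
  \<open>exp_neg v = e\<^sup>-\<^sup>v\<close> with \<open>e\<^sup>-\<^sup>\<infinity> = 0\<close>. The value at \<open>-\<infinity>\<close> is junk; the valuation of a moderate
  net is never \<open>-\<infinity>\<close>.
\<close>

definition exp_neg :: "ereal \<Rightarrow> real" where
  "exp_neg v = (if v = \<infinity> then 0 else exp (- real_of_ereal v))"

definition gnorm :: "gcomplex \<Rightarrow> real" where
  "gnorm z = exp_neg (valuation z)"

lemma exp_neg_antimono:
  assumes "v \<noteq> -\<infinity>" "v \<le> w"
  shows "exp_neg w \<le> exp_neg v"
  using assms by (cases v; cases w) (auto simp: exp_neg_def)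

lemma valuation_not_MInf: "valuation z \<noteq> -\<infinity>"
proof (transfer)
  fix z assume "gcrel z z"
  then obtain N :: nat where
    "(\<lambda>\<epsilon>. norm (z \<epsilon>)) \<in> O[at_right 0](\<lambda>\<epsilon>. \<epsilon> powr (- real N))"
    by (auto simp: gcrel_def moderate_def)
  then have "ereal (- real N) \<le> Sup (ereal ` {b. (\<lambda>\<epsilon>. norm (z \<epsilon>)) \<in> O[at_right 0](\<lambda>\<epsilon>. \<epsilon> powr b)})"
    by (intro Sup_upper) auto
  then show "Sup (ereal ` {b. (\<lambda>\<epsilon>. norm (z \<epsilon>)) \<in> O[at_right 0](\<lambda>\<epsilon>. \<epsilon> powr b)}) \<noteq> -\<infinity>"
    by auto
qed

lemma valuation_add: "min (valuation z) (valuation w) \<le> valuation (z + w)"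
proof (transfer)
  fix z w :: "real \<Rightarrow> complex"
  let ?S = "\<lambda>z. {b. (\<lambda>\<epsilon>. norm (z \<epsilon>)) \<in> O[at_right 0](\<lambda>\<epsilon>. \<epsilon> powr b)}"
  let ?v = "\<lambda>z. Sup (ereal ` ?S z)"
  show "min (?v z) (?v w) \<le> ?v (\<lambda>\<epsilon>. z \<epsilon> + w \<epsilon>)"
  proof (rule dense_le)
    fix y assume "y < min (?v z) (?v w)"
    then obtain a b where ab: "a \<in> ?S z" "b \<in> ?S w" "y < ereal a" "y < ereal b"
      by (auto simp: less_Sup_iff)
    have "min a b \<in> ?S z"
      using landau_o.big_trans[OF _ powr_bigo_mono[of "min a b" a]] ab(1) by simp
    moreover have "min a b \<in> ?S w"
      using landau_o.big_trans[OF _ powr_bigo_mono[of "min a b" b]] ab(2) by simp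
    ultimately have "min a b \<in> ?S (\<lambda>\<epsilon>. z \<epsilon> + w \<epsilon>)"
      by (simp add: bigo_norm_add)
    then have "ereal (min a b) \<le> ?v (\<lambda>\<epsilon>. z \<epsilon> + w \<epsilon>)"
      by (intro Sup_upper imageI)
    moreover have "y \<le> ereal (min a b)"
      using ab(3,4) by (simp add: min_def less_imp_le)
    ultimately show "y \<le> ?v (\<lambda>\<epsilon>. z \<epsilon> + w \<epsilon>)" by (rule order.trans[rotated])
  qed
qed

lemma valuation_uminus: "valuation (- z) = valuation z"
  by transfer simp

lemma valuation_eq_PInf_iff: "valuation z = \<infinity> \<longleftrightarrow> z = 0"
proof (transfer)
  fix z assume z: "gcrel z z"
  let ?S = "{b. (\<lambda>\<epsilon>. norm (z \<epsilon>)) \<in> O[at_right 0](\<lambda>\<epsilon>. \<epsilon> powr b)}"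
  have "Sup (ereal ` ?S) = \<infinity> \<longleftrightarrow> negligible_net z"
  proof
    assume *: "Sup (ereal ` ?S) = \<infinity>"
    show "negligible_net z"
      unfolding negligible_net_def
    proof
      fix q :: nat
      have "ereal (real q) < Sup (ereal ` ?S)" using * by simp
      then obtain b where "b \<in> ?S" "real q < b" by (auto simp: less_Sup_iff)
      then show "(\<lambda>\<epsilon>. norm (z \<epsilon>)) \<in> O[at_right 0](\<lambda>\<epsilon>. \<epsilon> powr (real q))"
        by (auto intro: landau_o.big_trans[OF _ powr_bigo_mono])
    qed
  next
    assume "negligible_net z"
    then have "?S = UNIV" by (simp add: negligible_net_powr)
    then have "ereal r \<le> Sup (ereal ` ?S)" for r
      by (intro Sup_upper) auto
    then show "Sup (ereal ` ?S) = \<infinity>"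
      by (rule ereal_top)
  qed
  with z show "Sup (ereal ` ?S) = \<infinity> \<longleftrightarrow> gcrel z (\<lambda>_. 0)"
    by (simp add: gcrel_def moderate_const)
qed

lemma gnorm_nonneg: "gnorm z \<ge> 0"
  by (simp add: gnorm_def exp_neg_def)

lemma gnorm_eq_0_iff: "gnorm z = 0 \<longleftrightarrow> z = 0"
  by (simp add: gnorm_def exp_neg_def valuation_eq_PInf_iff)

lemma gnorm_uminus: "gnorm (- z) = gnorm z"
  by (simp add: gnorm_def valuation_uminus)

lemma gnorm_add: "gnorm (z + w) \<le> max (gnorm z) (gnorm w)"
proof -
  have "gnorm (z + w) \<le> exp_neg (min (valuation z) (valuation w))"
    unfolding gnorm_def
    by (rule exp_neg_antimono[OF _ valuation_add]) (simp add: min_def valuation_not_MInf)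
  also have "\<dots> \<le> max (gnorm z) (gnorm w)"
    by (auto simp: gnorm_def min_def)
  finally show ?thesis .
qed

instantiation gcomplex :: metric_space
begin

definition dist_gcomplex :: "gcomplex \<Rightarrow> gcomplex \<Rightarrow> real" where
  "dist_gcomplex z w = gnorm (z - w)"

definition uniformity_gcomplex :: "(gcomplex \<times> gcomplex) filter" where
  "uniformity_gcomplex = (INF e\<in>{0<..}. principal {(x, y). dist x y < e})"

definition open_gcomplex :: "gcomplex set \<Rightarrow> bool" where
  "open_gcomplex U \<longleftrightarrow> (\<forall>x\<in>U. eventually (\<lambda>(x', y). x' = x \<longrightarrow> y \<in> U) uniformity)"

instance
proof
  fix x y z :: gcomplex
  show "dist x y = 0 \<longleftrightarrow> x = y"
    by (simp add: dist_gcomplex_def gnorm_eq_0_iff)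
  have "dist x y \<le> max (gnorm (x - z)) (gnorm (z - y))"
    using gnorm_add[of "x - z" "z - y"] by (simp add: dist_gcomplex_def)
  moreover have "gnorm (z - y) = dist y z"
    using gnorm_uminus[of "y - z"] by (simp add: dist_gcomplex_def)
  moreover have "max (gnorm (x - z)) (dist y z) \<le> gnorm (x - z) + dist y z"
    using gnorm_nonneg[of "x - z"] gnorm_nonneg[of "y - z"] by (simp add: dist_gcomplex_def)
  ultimately show "dist x y \<le> dist x z + dist y z"
    unfolding dist_gcomplex_def by linarith
qed (simp_all add: uniformity_gcomplex_def open_gcomplex_def)

end

definition partial_deriv :: "'n::finite \<Rightarrow> (real^'n \<Rightarrow> complex) \<Rightarrow> real^'n \<Rightarrow> complex" where
  "partial_deriv i f x = frechet_derivative f (at x) (axis i 1)"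

definition iter_partial :: "'n::finite list \<Rightarrow> (real^'n \<Rightarrow> complex) \<Rightarrow> real^'n \<Rightarrow> complex" where
  "iter_partial w f = foldr partial_deriv w f"

text \<open>Only used for open \<open>\<Omega>\<close>, where \<open>differentiable_on\<close> is differentiability at every point.\<close>

definition smooth_on :: "(real^'n::finite) set \<Rightarrow> (real^'n \<Rightarrow> complex) \<Rightarrow> bool" where
  "smooth_on \<Omega> f \<longleftrightarrow> (\<forall>w. iter_partial w f differentiable_on \<Omega>)"

text \<open>
  \<open>\<partial>\<^sup>\<alpha>\<close> for a multi-index \<open>\<alpha>\<close>: differentiate \<open>\<alpha> i\<close> times in direction \<open>i\<close>, in some chosen order.
  The order is irrelevant for smooth functions on open sets.
\<close>

definition multi_partial :: "('n::finite \<Rightarrow> nat) \<Rightarrow> (real^'n \<Rightarrow> complex) \<Rightarrow> real^'n \<Rightarrow> complex" where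
  "multi_partial \<alpha> f = iter_partial (SOME w. \<forall>i. count_list w i = \<alpha> i) f"

text \<open>
  All suprema below are suprema of non-negative quantities, taken in \<open>[0,\<infinity>)\<close>; inserting \<open>0\<close> fixes
  the supremum over an empty set.
\<close>

definition supnorm :: "'a set \<Rightarrow> ('a \<Rightarrow> complex) \<Rightarrow> real" where
  "supnorm K f = Sup (insert 0 {norm (f x) | x. x \<in> K})"

definition supnorm_upto :: "(real^'n::finite) set \<Rightarrow> nat \<Rightarrow> (real^'n \<Rightarrow> complex) \<Rightarrow> real" where
  "supnorm_upto K j f =
     Sup (insert 0 {norm (multi_partial \<alpha> f x) | x \<alpha>. x \<in> K \<and> (\<Sum>i\<in>UNIV. \<alpha> i) \<le> j})"

type_synonym 'n net = "real \<Rightarrow> real^'n \<Rightarrow> complex"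

definition EM :: "(real^'n::finite) set \<Rightarrow> 'n net set" where
  "EM \<Omega> = {u. (\<forall>\<epsilon>\<in>{0<..1}. smooth_on \<Omega> (u \<epsilon>)) \<and>
     (\<forall>K \<alpha>. compact K \<and> K \<subseteq> \<Omega> \<longrightarrow>
        (\<exists>N::nat. (\<lambda>\<epsilon>. supnorm K (multi_partial \<alpha> (u \<epsilon>))) \<in> O[at_right 0](\<lambda>\<epsilon>. \<epsilon> powr (- real N))))}"

definition Neg :: "(real^'n::finite) set \<Rightarrow> 'n net set" where
  "Neg \<Omega> = {u. (\<forall>\<epsilon>\<in>{0<..1}. smooth_on \<Omega> (u \<epsilon>)) \<and>
     (\<forall>K \<alpha>. compact K \<and> K \<subseteq> \<Omega> \<longrightarrow>
        (\<forall>q::nat. (\<lambda>\<epsilon>. supnorm K (multi_partial \<alpha> (u \<epsilon>))) \<in> O[at_right 0](\<lambda>\<epsilon>. \<epsilon> powr (real q))))}"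

definition Grel :: "(real^'n::finite) set \<Rightarrow> ('n net \<times> 'n net) set" where
  "Grel \<Omega> = {(u, v). u \<in> EM \<Omega> \<and> v \<in> EM \<Omega> \<and> (\<lambda>\<epsilon> x. u \<epsilon> x - v \<epsilon> x) \<in> Neg \<Omega>}"

definition Gclass :: "(real^'n::finite) set \<Rightarrow> 'n net \<Rightarrow> 'n net set" where
  "Gclass \<Omega> u = Grel \<Omega> `` {u}"

definition G :: "(real^'n::finite) set \<Rightarrow> 'n net set set" where
  "G \<Omega> = EM \<Omega> // Grel \<Omega>"

text \<open>
  The operations on classes are unions over all representatives, as in
  \<^theory>\<open>HOL.Equiv_Relations\<close>; all members of these unions coincide.
\<close>

definition Gzero :: "(real^'n::finite) set \<Rightarrow> 'n net set" where
  "Gzero \<Omega> = Gclass \<Omega> (\<lambda>\<epsilon> x. 0)"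

definition Gadd :: "(real^'n::finite) set \<Rightarrow> 'n net set \<Rightarrow> 'n net set \<Rightarrow> 'n net set" where
  "Gadd \<Omega> u v = (\<Union>f\<in>u. \<Union>g\<in>v. Gclass \<Omega> (\<lambda>\<epsilon> x. f \<epsilon> x + g \<epsilon> x))"

definition Gdiff :: "(real^'n::finite) set \<Rightarrow> 'n net set \<Rightarrow> 'n net set \<Rightarrow> 'n net set" where
  "Gdiff \<Omega> u v = (\<Union>f\<in>u. \<Union>g\<in>v. Gclass \<Omega> (\<lambda>\<epsilon> x. f \<epsilon> x - g \<epsilon> x))"

definition Gscale :: "(real^'n::finite) set \<Rightarrow> gcomplex \<Rightarrow> 'n net set \<Rightarrow> 'n net set" where
  "Gscale \<Omega> c u = (\<Union>f\<in>u. Gclass \<Omega> (\<lambda>\<epsilon> x. rep_gcomplex c \<epsilon> * f \<epsilon> x))"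

definition Grestrict :: "(real^'n::finite) set \<Rightarrow> 'n net set \<Rightarrow> 'n net set" where
  "Grestrict V u = (\<Union>f\<in>u. Gclass V f)"

definition Gsupp :: "(real^'n::finite) set \<Rightarrow> 'n net set \<Rightarrow> (real^'n) set" where
  "Gsupp \<Omega> u = \<Omega> - \<Union>{V. open V \<and> V \<subseteq> \<Omega> \<and> Grestrict V u = Gzero V}"

definition Gc :: "(real^'n::finite) set \<Rightarrow> 'n net set set" where
  "Gc \<Omega> = {u \<in> G \<Omega>. compact (Gsupp \<Omega> u)}"

definition GK :: "(real^'n::finite) set \<Rightarrow> (real^'n) set \<Rightarrow> 'n net set set" where
  "GK \<Omega> K = {u \<in> G \<Omega>. Gsupp \<Omega> u \<subseteq> K}"

text \<open>
  In the following, \<open>M\<close> is one of the submodules \<open>G \<Omega>\<close>, \<open>Gc \<Omega>\<close>, \<open>GK \<Omega> K\<close> of \<open>G \<Omega>\<close>.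
\<close>

definition ultra_pseudo_seminorm ::
    "(real^'n::finite) set \<Rightarrow> 'n net set set \<Rightarrow> ('n net set \<Rightarrow> real) \<Rightarrow> bool" where
  "ultra_pseudo_seminorm \<Omega> M P \<longleftrightarrow>
     (\<forall>u\<in>M. P u \<ge> 0) \<and> P (Gzero \<Omega>) = 0 \<and>
     (\<forall>c. \<forall>u\<in>M. P (Gscale \<Omega> c u) \<le> gnorm c * P u) \<and>
     (\<forall>c a. \<forall>u\<in>M. c \<noteq> 0 \<longrightarrow> P (Gscale \<Omega> (gcpow c a) u) = gnorm (gcpow c a) * P u) \<and>
     (\<forall>u\<in>M. \<forall>v\<in>M. P (Gadd \<Omega> u v) \<le> max (P u) (P v))"

definition seminorm_topology ::
    "(real^'n::finite) set \<Rightarrow> 'n net set set \<Rightarrow> ('n net set \<Rightarrow> real) set \<Rightarrow> 'n net set topology" where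
  "seminorm_topology \<Omega> M Ps =
     topology_generated_by (insert M {{v \<in> M. P (Gdiff \<Omega> v u) < r} | P u r. P \<in> Ps \<and> u \<in> M \<and> r > 0})"

definition locally_convex_topology ::
    "(real^'n::finite) set \<Rightarrow> 'n net set set \<Rightarrow> 'n net set topology \<Rightarrow> bool" where
  "locally_convex_topology \<Omega> M X \<longleftrightarrow>
     (\<exists>Ps. (\<forall>P\<in>Ps. ultra_pseudo_seminorm \<Omega> M P) \<and> X = seminorm_topology \<Omega> M Ps)"

text \<open>The value does not depend on the representative if \<open>K\<close> is a compact subset of \<open>\<Omega>\<close>.\<close>

definition Gseminorm :: "(real^'n::finite) set \<Rightarrow> nat \<Rightarrow> 'n net set \<Rightarrow> real" where
  "Gseminorm K j u = (let f = (SOME f. f \<in> u) in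
     exp_neg (Sup (ereal ` {b. (\<lambda>\<epsilon>. supnorm_upto K j (f \<epsilon>)) \<in> O[at_right 0](\<lambda>\<epsilon>. \<epsilon> powr b)})))"

definition G_topology :: "(real^'n::finite) set \<Rightarrow> 'n net set topology" where
  "G_topology \<Omega> = seminorm_topology \<Omega> (G \<Omega>) {Gseminorm K j | K j. compact K \<and> K \<subseteq> \<Omega>}"

definition GK_seminorm ::
    "(real^'n::finite) set \<Rightarrow> (real^'n) set \<Rightarrow> nat \<Rightarrow> 'n net set \<Rightarrow> real" where
  "GK_seminorm \<Omega> K j u =
     Gseminorm (SOME K'. compact K' \<and> K' \<subseteq> \<Omega> \<and> K \<subseteq> interior K') j u"

definition GK_topology :: "(real^'n::finite) set \<Rightarrow> (real^'n) set \<Rightarrow> 'n net set topology" where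
  "GK_topology \<Omega> K = seminorm_topology \<Omega> (GK \<Omega> K) (range (GK_seminorm \<Omega> K))"

definition exhausting :: "(real^'n::finite) set \<Rightarrow> (nat \<Rightarrow> (real^'n) set) \<Rightarrow> bool" where
  "exhausting \<Omega> K \<longleftrightarrow>
     (\<forall>n. compact (K n)) \<and> (\<forall>n. K n \<subseteq> interior (K (Suc n))) \<and> (\<Union>n. K n) = \<Omega>"

lemma exhausting_exists:
  assumes "open \<Omega>"
  shows "\<exists>K. exhausting \<Omega> K"
  using open_Union_compact_subsets[OF assms] unfolding exhausting_def by metis

text \<open>
  The strict inductive limit topology is the supremum of all locally convex topologies making
  the inclusions continuous. This supremum is itself such a topology, see below.
\<close>

definition Gc_admissible ::
    "(real^'n::finite) set \<Rightarrow> (nat \<Rightarrow> (real^'n) set) \<Rightarrow> 'n net set topology \<Rightarrow> bool" where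
  "Gc_admissible \<Omega> K X \<longleftrightarrow> locally_convex_topology \<Omega> (Gc \<Omega>) X \<and>
     (\<forall>n. continuous_map (GK_topology \<Omega> (K n)) X (\<lambda>u. u))"

definition Gc_topology ::
    "(real^'n::finite) set \<Rightarrow> (nat \<Rightarrow> (real^'n) set) \<Rightarrow> 'n net set topology" where
  "Gc_topology \<Omega> K = topology_generated_by (\<Union>{{U. openin X U} | X. Gc_admissible \<Omega> K X})"

lemma topspace_seminorm_topology: "topspace (seminorm_topology \<Omega> M Ps) = M"
  by (auto simp: seminorm_topology_def)

lemma generate_topology_on_mono:
  assumes "generate_topology_on S U" "\<And>V. V \<in> S \<Longrightarrow> generate_topology_on T V"
  shows "generate_topology_on T U"
  using assms(1) by induction (auto intro: assms(2) generate_topology_on.intros)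

lemma compact_Gsupp:
  assumes "Gsupp \<Omega> u \<subseteq> K" "compact K" "K \<subseteq> \<Omega>"
  shows "compact (Gsupp \<Omega> u)"
proof -
  define W where "W = \<Union>{V. open V \<and> V \<subseteq> \<Omega> \<and> Grestrict V u = Gzero V}"
  have "open W" unfolding W_def by blast
  with assms(2) have "compact (K - W)" by (rule compact_diff)
  moreover have "Gsupp \<Omega> u = K - W"
    using assms unfolding Gsupp_def W_def by blast
  ultimately show ?thesis by simp
qed

theorem Gc_topology_finest:
  assumes "exhausting \<Omega> K"
  shows "Gc_admissible \<Omega> K (Gc_topology \<Omega> K)"
    and "Gc_admissible \<Omega> K X \<Longrightarrow> openin X U \<Longrightarrow> openin (Gc_topology \<Omega> K) U"
proof -
  show "openin (Gc_topology \<Omega> K) U" if "Gc_admissible \<Omega> K X" "openin X U" for X U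
    unfolding Gc_topology_def by (rule topology_generated_by_Basis) (use that in blast)
  define Ps where "Ps = \<Union>{Q. (\<forall>P\<in>Q. ultra_pseudo_seminorm \<Omega> (Gc \<Omega>) P) \<and>
      Gc_admissible \<Omega> K (seminorm_topology \<Omega> (Gc \<Omega>) Q)}"
  have sub: "GK \<Omega> (K n) \<subseteq> Gc \<Omega>" for n
    using assms compact_Gsupp[of \<Omega> _ "K n"] unfolding GK_def Gc_def exhausting_def by blast
  have triv: "Gc_admissible \<Omega> K (seminorm_topology \<Omega> (Gc \<Omega>) {})"
  proof -
    have "continuous_map (GK_topology \<Omega> (K n)) (seminorm_topology \<Omega> (Gc \<Omega>) {}) (\<lambda>u. u)" for n
    proof -
      have eq: "seminorm_topology \<Omega> (Gc \<Omega>) {} = topology_generated_by {Gc \<Omega>}"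
        by (simp add: seminorm_topology_def)
      have top: "topspace (GK_topology \<Omega> (K n)) = GK \<Omega> (K n)"
        by (simp add: GK_topology_def topspace_seminorm_topology)
      have "(\<lambda>u. u) -` Gc \<Omega> \<inter> GK \<Omega> (K n) = topspace (GK_topology \<Omega> (K n))"
        using sub[of n] unfolding top by blast
      then have "openin (GK_topology \<Omega> (K n)) ((\<lambda>u. u) -` Gc \<Omega> \<inter> GK \<Omega> (K n))"
        by (metis openin_topspace)
      then show ?thesis
        unfolding eq continuous_on_generated_topo_iff top using sub[of n] by auto
    qed
    moreover have "locally_convex_topology \<Omega> (Gc \<Omega>) (seminorm_topology \<Omega> (Gc \<Omega>) {})"
      unfolding locally_convex_topology_def by blast
    ultimately show ?thesis unfolding Gc_admissible_def by blast
  qed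
  have eq: "Gc_topology \<Omega> K = seminorm_topology \<Omega> (Gc \<Omega>) Ps"
  proof (rule topology_eq[THEN iffD2], intro allI iffI)
    fix U
    assume "openin (Gc_topology \<Omega> K) U"
    then have "generate_topology_on (\<Union>{{U. openin X U} | X. Gc_admissible \<Omega> K X}) U"
      unfolding Gc_topology_def by (rule openin_topology_generated_by)
    then show "openin (seminorm_topology \<Omega> (Gc \<Omega>) Ps) U"
      unfolding seminorm_topology_def openin_topology_generated_by_iff
    proof (rule generate_topology_on_mono)
      fix V assume "V \<in> \<Union>{{U. openin X U} | X. Gc_admissible \<Omega> K X}"
      then obtain X where X: "Gc_admissible \<Omega> K X" "openin X V" by blast
      then obtain Q where Q: "\<forall>P\<in>Q. ultra_pseudo_seminorm \<Omega> (Gc \<Omega>) P"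
          "X = seminorm_topology \<Omega> (Gc \<Omega>) Q"
        unfolding Gc_admissible_def locally_convex_topology_def by blast
      with X have "Q \<subseteq> Ps" unfolding Ps_def by blast
      from X(2) Q(2) have
        "generate_topology_on (insert (Gc \<Omega>)
           {{v \<in> Gc \<Omega>. P (Gdiff \<Omega> v u) < r} | P u r. P \<in> Q \<and> u \<in> Gc \<Omega> \<and> r > 0}) V"
        unfolding seminorm_topology_def by (simp add: openin_topology_generated_by_iff)
      then show "generate_topology_on (insert (Gc \<Omega>)
           {{v \<in> Gc \<Omega>. P (Gdiff \<Omega> v u) < r} | P u r. P \<in> Ps \<and> u \<in> Gc \<Omega> \<and> r > 0}) V"
        by (rule generate_topology_on_mono)
           (use \<open>Q \<subseteq> Ps\<close> in \<open>blast intro: generate_topology_on.Basis\<close>)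
    qed
  next
    fix U
    assume "openin (seminorm_topology \<Omega> (Gc \<Omega>) Ps) U"
    then have "generate_topology_on (insert (Gc \<Omega>)
           {{v \<in> Gc \<Omega>. P (Gdiff \<Omega> v u) < r} | P u r. P \<in> Ps \<and> u \<in> Gc \<Omega> \<and> r > 0}) U"
      unfolding seminorm_topology_def by (rule openin_topology_generated_by)
    then show "openin (Gc_topology \<Omega> K) U"
      unfolding Gc_topology_def openin_topology_generated_by_iff
    proof (rule generate_topology_on_mono)
      fix V
      assume "V \<in> insert (Gc \<Omega>)
           {{v \<in> Gc \<Omega>. P (Gdiff \<Omega> v u) < r} | P u r. P \<in> Ps \<and> u \<in> Gc \<Omega> \<and> r > 0}"
      then have "\<exists>X. Gc_admissible \<Omega> K X \<and> openin X V"
      proof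
        assume "V = Gc \<Omega>"
        then show ?thesis
          using triv openin_topspace[of "seminorm_topology \<Omega> (Gc \<Omega>) {}"]
          by (auto simp: topspace_seminorm_topology)
      next
        assume "V \<in> {{v \<in> Gc \<Omega>. P (Gdiff \<Omega> v u) < r} | P u r. P \<in> Ps \<and> u \<in> Gc \<Omega> \<and> r > 0}"
        then obtain P u r where V: "V = {v \<in> Gc \<Omega>. P (Gdiff \<Omega> v u) < r}"
          and P: "P \<in> Ps" "u \<in> Gc \<Omega>" "r > 0" by blast
        from P(1) obtain Q where Q: "P \<in> Q" "Gc_admissible \<Omega> K (seminorm_topology \<Omega> (Gc \<Omega>) Q)"
          unfolding Ps_def by blast
        have "openin (seminorm_topology \<Omega> (Gc \<Omega>) Q) V"
          unfolding seminorm_topology_def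
          by (rule topology_generated_by_Basis) (use V P Q in blast)
        with Q(2) show ?thesis by blast
      qed
      then show "generate_topology_on (\<Union>{{U. openin X U} | X. Gc_admissible \<Omega> K X}) V"
        by (blast intro: generate_topology_on.Basis)
    qed
  qed
  have "continuous_map (GK_topology \<Omega> (K n)) (Gc_topology \<Omega> K) (\<lambda>u. u)" for n
    unfolding Gc_topology_def continuous_on_generated_topo_iff
  proof (intro conjI allI impI)
    fix V assume "V \<in> \<Union>{{U. openin X U} | X. Gc_admissible \<Omega> K X}"
    then obtain X where X: "Gc_admissible \<Omega> K X" "openin X V" by blast
    then have "continuous_map (GK_topology \<Omega> (K n)) X (\<lambda>u. u)"
      unfolding Gc_admissible_def by blast
    with X(2) show "openin (GK_topology \<Omega> (K n)) ((\<lambda>u. u) -` V \<inter> topspace (GK_topology \<Omega> (K n)))"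
      by (simp add: continuous_map_alt)
  next
    have "(\<lambda>u. u) ` topspace (GK_topology \<Omega> (K n)) \<subseteq> Gc \<Omega>"
      using sub[of n] by (simp add: GK_topology_def topspace_seminorm_topology)
    also have "Gc \<Omega> \<subseteq> \<Union>(\<Union>{{U. openin X U} | X. Gc_admissible \<Omega> K X})"
      using triv openin_topspace[of "seminorm_topology \<Omega> (Gc \<Omega>) {}"]
      unfolding topspace_seminorm_topology by blast
    finally show "(\<lambda>u. u) ` topspace (GK_topology \<Omega> (K n)) \<subseteq>
        \<Union>(\<Union>{{U. openin X U} | X. Gc_admissible \<Omega> K X})" .
  qed
  moreover have "\<forall>P\<in>Ps. ultra_pseudo_seminorm \<Omega> (Gc \<Omega>) P"
    unfolding Ps_def by blast
  ultimately show "Gc_admissible \<Omega> K (Gc_topology \<Omega> K)"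
    unfolding Gc_admissible_def locally_convex_topology_def using eq by blast
qed

text \<open>
  Functionals on \<open>M\<close> are \<^const>\<open>extensional\<close>, so that equality of functionals is equality on \<open>M\<close>.
\<close>

definition cont_functionals ::
    "(real^'n::finite) set \<Rightarrow> 'n net set set \<Rightarrow> 'n net set topology \<Rightarrow> ('n net set \<Rightarrow> gcomplex) set" where
  "cont_functionals \<Omega> M X = {T \<in> extensional M.
     (\<forall>u\<in>M. \<forall>v\<in>M. T (Gadd \<Omega> u v) = T u + T v) \<and>
     (\<forall>c. \<forall>u\<in>M. T (Gscale \<Omega> c u) = c * T u) \<and>
     continuous_map X euclidean T}"

definition dual_G :: "(real^'n::finite) set \<Rightarrow> ('n net set \<Rightarrow> gcomplex) set" where
  "dual_G \<Omega> = cont_functionals \<Omega> (G \<Omega>) (G_topology \<Omega>)"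

definition dual_Gc ::
    "(real^'n::finite) set \<Rightarrow> (nat \<Rightarrow> (real^'n) set) \<Rightarrow> ('n net set \<Rightarrow> gcomplex) set" where
  "dual_Gc \<Omega> K = cont_functionals \<Omega> (Gc \<Omega>) (Gc_topology \<Omega> K)"

text \<open>
  \<open>Gc V\<close> viewed inside \<open>Gc \<Omega>\<close> (extension by zero): the elements whose support lies in \<open>V\<close>.
\<close>

definition Gc_sub :: "(real^'n::finite) set \<Rightarrow> (real^'n) set \<Rightarrow> 'n net set set" where
  "Gc_sub \<Omega> V = {u \<in> Gc \<Omega>. Gsupp \<Omega> u \<subseteq> V}"

definition functional_supp ::
    "(real^'n::finite) set \<Rightarrow> ('n net set \<Rightarrow> gcomplex) \<Rightarrow> (real^'n) set" where
  "functional_supp \<Omega> T = \<Omega> - \<Union>{V. open V \<and> V \<subseteq> \<Omega> \<and> (\<forall>u\<in>Gc_sub \<Omega> V. T u = 0)}"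

end

theory Submission
  imports Defs
begin

text \<open>
  A continuous functional \<open>S\<close> on \<open>G \<Omega>\<close> is bounded on a ball of a single seminorm, living on a
  compact set \<open>L\<close>. An element that vanishes near \<open>L\<close> stays in this ball under all scalings, so \<open>S\<close>
  maps it to \<open>0\<close>. If \<open>\<psi>\<close> is a cutoff function equal to \<open>1\<close> near \<open>L\<close>, then \<open>S u = S (\<psi> u)\<close>; hence \<open>S\<close> is
  determined by its restriction to \<open>Gc \<Omega>\<close>, whose support is contained in \<open>L\<close>. The restriction is
  continuous because \<open>gnorm \<circ> S\<close> is itself one of the ultra-pseudo-seminorms allowed in the
  inductive limit. Conversely, if \<open>supp T\<close> is compact and \<open>\<psi> = 1\<close> near it, then \<open>u \<mapsto> T (\<psi> u)\<close> is a
  continuous functional on \<open>G \<Omega>\<close>, and it extends \<open>T\<close> since \<open>u - \<psi> u\<close> has support disjoint from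
  \<open>supp T\<close>, which by a smooth decomposition along a finite cover forces \<open>T (u - \<psi> u) = 0\<close>.
\<close>

text \<open>The seminorms in the definitions use multi-indices whose order of differentiation is
  picked by \<open>SOME\<close>, whereas the product rule acts on words of directions. Passing
  between the two requires the symmetry of mixed derivatives, and this is why so much elementary
  calculus precedes the functional analysis. Smoothness of products, reciprocals and cutoff
  functions all comes from one coinduction principle for \<open>smooth_on\<close>. A ball of a
  single seminorm is available because the seminorms of \<open>G \<Omega>\<close> are directed. It
  forces \<open>S\<close> to vanish because a nonzero generalized number leaves the unit ball under
  some scaling \<open>gcpow 1 a\<close>: this scaling multiplies the norm by at least
  \<open>exp (- a)\<close>. \<open>Gc_topology\<close> is a supremum of admissible topologies.
  Continuity of a functional on \<open>Gc \<Omega>\<close> therefore follows once a single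
  admissible topology makes it continuous. In the other direction, multiplication by a cutoff
  function lands in one fixed \<open>GK \<Omega> (K n)\<close>, so only the inclusion of this one
  step into the limit enters.\<close>

section \<open>Smooth functions\<close>

lemma iter_partial_Nil [simp]: "iter_partial [] f = f"
  and iter_partial_Cons: "iter_partial (i # w) f = partial_deriv i (iter_partial w f)"
  and iter_partial_append: "iter_partial (v @ w) f = iter_partial v (iter_partial w f)"
  by (simp_all add: iter_partial_def)

lemma partial_deriv_eqI:
  assumes "(f has_derivative f') (at x)"
  shows "partial_deriv i f x = f' (axis i 1)"
  using frechet_derivative_at[OF assms] by (simp add: partial_deriv_def)

text \<open>\<open>frechet_derivative\<close> is a choice from the predicate
  \<open>has_derivative\<close>. Both functions satisfy this predicate for the same maps, so the
  choices agree even where no derivative exists.\<close>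

lemma partial_deriv_cong:
  assumes "open \<Omega>" "\<And>x. x \<in> \<Omega> \<Longrightarrow> f x = g x" "x \<in> \<Omega>"
  shows "partial_deriv i f x = partial_deriv i g x"
proof -
  have "(f has_derivative f') (at x) \<longleftrightarrow> (g has_derivative f') (at x)" for f'
    using has_derivative_transform_within_open[of f f' x UNIV \<Omega> g]
      has_derivative_transform_within_open[of g f' x UNIV \<Omega> f] assms by auto
  then show ?thesis by (simp add: partial_deriv_def frechet_derivative_def)
qed

lemma iter_partial_cong:
  assumes "open \<Omega>" "\<And>x. x \<in> \<Omega> \<Longrightarrow> f x = g x" "x \<in> \<Omega>"
  shows "iter_partial w f x = iter_partial w g x"
  using assms(3)
proof (induction w arbitrary: x)
  case (Cons i w)
  then show ?case
    unfolding iter_partial_Cons by (intro partial_deriv_cong[OF assms(1)]) auto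
qed (simp add: assms(2))

lemma differentiable_on_cong:
  assumes "\<And>x. x \<in> S \<Longrightarrow> f x = g x"
  shows "f differentiable_on S \<longleftrightarrow> g differentiable_on S"
proof -
  have "g differentiable_on S" if "f differentiable_on S" "\<And>x. x \<in> S \<Longrightarrow> f x = g x" for f g :: "'a \<Rightarrow> 'b"
    unfolding differentiable_on_def
  proof
    fix x assume x: "x \<in> S"
    with that(1) obtain D where "(f has_derivative D) (at x within S)"
      unfolding differentiable_on_def differentiable_def by blast
    then show "g differentiable at x within S"
      using has_derivative_transform[OF x, of g f D] that(2) unfolding differentiable_def by auto
  qed
  from this[of f g] this[of g f] assms show ?thesis by auto
qed

lemma smooth_on_cong:
  assumes "open \<Omega>" "\<And>x. x \<in> \<Omega> \<Longrightarrow> f x = g x"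
  shows "smooth_on \<Omega> f \<longleftrightarrow> smooth_on \<Omega> g"
  unfolding smooth_on_def
proof (rule all_cong1)
  fix w
  show "(iter_partial w f differentiable_on \<Omega>) = (iter_partial w g differentiable_on \<Omega>)"
    by (rule differentiable_on_cong) (rule iter_partial_cong[OF assms])
qed

lemma smooth_on_subset: "smooth_on \<Omega> f \<Longrightarrow> V \<subseteq> \<Omega> \<Longrightarrow> smooth_on V f"
  unfolding smooth_on_def by (auto intro: differentiable_on_subset)

lemma smooth_on_iter_partial: "smooth_on \<Omega> f \<Longrightarrow> smooth_on \<Omega> (iter_partial w f)"
  unfolding smooth_on_def iter_partial_append[symmetric] by simp

lemma smooth_on_partial_deriv: "smooth_on \<Omega> f \<Longrightarrow> smooth_on \<Omega> (partial_deriv i f)"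
  using smooth_on_iter_partial[of \<Omega> f "[i]"] by (simp add: iter_partial_Cons)

lemma smooth_on_differentiable:
  "smooth_on \<Omega> f \<Longrightarrow> open \<Omega> \<Longrightarrow> x \<in> \<Omega> \<Longrightarrow> iter_partial w f differentiable at x"
  unfolding smooth_on_def by (simp add: differentiable_on_eq_differentiable_at)

lemma smooth_on_differentiable': "smooth_on \<Omega> f \<Longrightarrow> open \<Omega> \<Longrightarrow> x \<in> \<Omega> \<Longrightarrow> f differentiable at x"
  using smooth_on_differentiable[of \<Omega> f x "[]"] by simp

lemma smooth_on_continuous: "smooth_on \<Omega> f \<Longrightarrow> continuous_on \<Omega> (iter_partial w f)"
  unfolding smooth_on_def by (blast intro: differentiable_imp_continuous_on)

section \<open>Rules for partial derivatives and closure of smooth functions under algebraic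
  operations\<close>

lemma partial_deriv_add:
  assumes "f differentiable at x" "g differentiable at x"
  shows "partial_deriv i (\<lambda>x. f x + g x) x = partial_deriv i f x + partial_deriv i g x"
proof -
  from assms obtain f' g' where "(f has_derivative f') (at x)" "(g has_derivative g') (at x)"
    unfolding differentiable_def by blast
  from this[THEN partial_deriv_eqI] has_derivative_add[OF this, THEN partial_deriv_eqI]
  show ?thesis by simp
qed

lemma partial_deriv_mult:
  assumes "f differentiable at x" "g differentiable at x"
  shows "partial_deriv i (\<lambda>x. f x * g x) x = partial_deriv i f x * g x + f x * partial_deriv i g x"
proof -
  from assms obtain f' g' where "(f has_derivative f') (at x)" "(g has_derivative g') (at x)"
    unfolding differentiable_def by blast
  from this[THEN partial_deriv_eqI] has_derivative_mult[OF this, THEN partial_deriv_eqI]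
  show ?thesis by simp
qed

lemma partial_deriv_const: "partial_deriv i (\<lambda>x. c) x = 0"
  by (rule partial_deriv_eqI[OF has_derivative_const])

text \<open>Additivity along \<open>w\<close> uses differentiability only along words shorter than
  \<open>w\<close>. This weak form is all that the induction in \<open>smooth_on_coinduct\<close>
  can supply, since smoothness is not yet known there.\<close>

lemma iter_partial_add_aux:
  assumes "open \<Omega>" "x \<in> \<Omega>"
    and "\<And>v. length v < length w \<Longrightarrow> iter_partial v f differentiable_on \<Omega>"
    and "\<And>v. length v < length w \<Longrightarrow> iter_partial v g differentiable_on \<Omega>"
  shows "iter_partial w (\<lambda>x. f x + g x) x = iter_partial w f x + iter_partial w g x"
  using assms(2-)
proof (induction w arbitrary: x)
  case (Cons i w)
  have "iter_partial (i # w) (\<lambda>x. f x + g x) x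
      = partial_deriv i (\<lambda>x. iter_partial w f x + iter_partial w g x) x"
    unfolding iter_partial_Cons
    by (rule partial_deriv_cong[OF assms(1) Cons.IH Cons.prems(1)]) (simp_all add: Cons.prems)
  also have "\<dots> = partial_deriv i (iter_partial w f) x + partial_deriv i (iter_partial w g) x"
  proof (rule partial_deriv_add)
    show "iter_partial w f differentiable at x" "iter_partial w g differentiable at x"
      using Cons.prems(2,3)[of w] Cons.prems(1) assms(1)
      by (simp_all add: differentiable_on_eq_differentiable_at)
  qed
  finally show ?case by (simp add: iter_partial_Cons)
qed simp

text \<open>Induction on the length of the word: the innermost derivative of a member of
  \<open>A\<close> is again built from members of \<open>A\<close>, and the remaining word is
  shorter. Two summands are allowed because the product rule produces two, so \<open>A\<close> need
  not be closed under addition.\<close>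

lemma smooth_on_coinduct:
  assumes "open \<Omega>" "f \<in> A"
    and diff: "\<And>f. f \<in> A \<Longrightarrow> f differentiable_on \<Omega>"
    and step: "\<And>f i. f \<in> A \<Longrightarrow> \<exists>g\<in>A. \<exists>h\<in>A. \<forall>x\<in>\<Omega>. partial_deriv i f x = g x + h x"
  shows "smooth_on \<Omega> f"
proof -
  have "\<forall>f\<in>A. \<forall>w. length w \<le> n \<longrightarrow> iter_partial w f differentiable_on \<Omega>" for n
  proof (induction n)
    case 0
    then show ?case by (simp add: diff)
  next
    case (Suc n)
    show ?case
    proof (intro ballI allI impI)
      fix f w assume f: "f \<in> A" and w: "length (w :: 'a list) \<le> Suc n"
      show "iter_partial w f differentiable_on \<Omega>"
      proof (cases w rule: rev_cases)
        case Nil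
        then show ?thesis by (simp add: diff f)
      next
        case (snoc v i)
        from step[OF f] obtain g h where gh: "g \<in> A" "h \<in> A"
          "\<And>x. x \<in> \<Omega> \<Longrightarrow> partial_deriv i f x = g x + h x" by blast
        have "iter_partial w f x = iter_partial v g x + iter_partial v h x" if x: "x \<in> \<Omega>" for x
        proof -
          have "iter_partial w f x = iter_partial v (\<lambda>x. g x + h x) x"
            using iter_partial_cong[OF assms(1) gh(3) x]
            by (simp add: snoc iter_partial_append iter_partial_Cons)
          also have "\<dots> = iter_partial v g x + iter_partial v h x"
            by (rule iter_partial_add_aux[OF assms(1) x]) (use Suc gh snoc w in auto)
          finally show ?thesis .
        qed
        moreover have "(\<lambda>x. iter_partial v g x + iter_partial v h x) differentiable_on \<Omega>"
          by (rule differentiable_on_add) (use Suc gh snoc w in auto)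
        ultimately show ?thesis
          using differentiable_on_cong[of \<Omega> "iter_partial w f"] by simp
      qed
    qed
  qed
  then show ?thesis using assms(2) unfolding smooth_on_def by blast
qed

lemma smooth_on_imp_differentiable_on: "smooth_on \<Omega> f \<Longrightarrow> f differentiable_on \<Omega>"
  using iter_partial_Nil[of f] unfolding smooth_on_def by metis

lemma smooth_on_const:
  assumes "open \<Omega>" shows "smooth_on \<Omega> (\<lambda>x. c)"
  by (rule smooth_on_coinduct[OF assms, where A = "range (\<lambda>c x. c)"])
    (auto simp: partial_deriv_const intro: exI[of _ 0])

lemma iter_partial_add:
  assumes "open \<Omega>" "x \<in> \<Omega>" "smooth_on \<Omega> f" "smooth_on \<Omega> g"
  shows "iter_partial w (\<lambda>x. f x + g x) x = iter_partial w f x + iter_partial w g x"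
  by (rule iter_partial_add_aux[OF assms(1,2)]) (use assms(3,4) in \<open>auto simp: smooth_on_def\<close>)

lemma smooth_on_add:
  assumes "open \<Omega>" "smooth_on \<Omega> f" "smooth_on \<Omega> g"
  shows "smooth_on \<Omega> (\<lambda>x. f x + g x)"
  unfolding smooth_on_def
proof
  fix w
  have "(\<lambda>x. iter_partial w f x + iter_partial w g x) differentiable_on \<Omega>"
    using assms(2,3) unfolding smooth_on_def by (simp add: differentiable_on_add)
  then show "iter_partial w (\<lambda>x. f x + g x) differentiable_on \<Omega>"
    using differentiable_on_cong[of \<Omega> "iter_partial w (\<lambda>x. f x + g x)"] iter_partial_add[OF assms(1) _ assms(2,3)]
    by simp
qed

lemma smooth_on_mult:
  assumes "open \<Omega>" "smooth_on \<Omega> f" "smooth_on \<Omega> g"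
  shows "smooth_on \<Omega> (\<lambda>x. f x * g x)"
proof -
  \<comment> \<open>Products of arbitrary smooth functions: the product rule turns one of them into
    a sum of two.\<close>
  define A where "A = {\<lambda>x. f x * g x | f g. smooth_on \<Omega> f \<and> smooth_on \<Omega> g}"
  have AI: "(\<lambda>x. f x * g x) \<in> A" if "smooth_on \<Omega> f" "smooth_on \<Omega> g" for f g
    using that unfolding A_def by blast
  show ?thesis
  proof (rule smooth_on_coinduct[OF assms(1) AI[OF assms(2,3)]])
    fix p assume "p \<in> A"
    then obtain f g where p: "p = (\<lambda>x. f x * g x)" and fg: "smooth_on \<Omega> f" "smooth_on \<Omega> g"
      unfolding A_def by blast
    show "p differentiable_on \<Omega>"
      unfolding p by (intro differentiable_on_mult smooth_on_imp_differentiable_on fg)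
    fix i
    have "partial_deriv i p x = partial_deriv i f x * g x + f x * partial_deriv i g x" if "x \<in> \<Omega>" for x
      unfolding p
      by (rule partial_deriv_mult) (rule smooth_on_differentiable'[OF _ assms(1) that], rule fg)+
    with AI[OF smooth_on_partial_deriv[OF fg(1)] fg(2)] AI[OF fg(1) smooth_on_partial_deriv[OF fg(2)]]
    show "\<exists>q\<in>A. \<exists>r\<in>A. \<forall>x\<in>\<Omega>. partial_deriv i p x = q x + r x"
      by (intro bexI ballI) auto
  qed
qed

lemma iter_partial_cmult:
  assumes "open \<Omega>" "x \<in> \<Omega>" "smooth_on \<Omega> f"
  shows "iter_partial w (\<lambda>x. c * f x) x = c * iter_partial w f x"
  using assms(2)
proof (induction w arbitrary: x)
  case (Cons i w)
  have "iter_partial (i # w) (\<lambda>x. c * f x) x = partial_deriv i (\<lambda>x. c * iter_partial w f x) x"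
    unfolding iter_partial_Cons by (rule partial_deriv_cong[OF assms(1) Cons.IH Cons.prems])
  also have "\<dots> = c * partial_deriv i (iter_partial w f) x"
    using smooth_on_differentiable[OF assms(3,1) Cons.prems]
    by (simp add: partial_deriv_mult partial_deriv_const)
  finally show ?case by (simp add: iter_partial_Cons)
qed simp

lemma smooth_on_diff:
  assumes "open \<Omega>" "smooth_on \<Omega> f" "smooth_on \<Omega> g"
  shows "smooth_on \<Omega> (\<lambda>x. f x - g x)"
  using smooth_on_add[OF assms(1,2) smooth_on_mult[OF assms(1) smooth_on_const[OF assms(1), of "-1"] assms(3)]]
  by simp

lemma iter_partial_zero: "iter_partial w (\<lambda>x. 0) = (\<lambda>x. 0)"
  by (induction w) (auto simp: iter_partial_Cons partial_deriv_const)

lemma smooth_on_inverse: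
  assumes "open \<Omega>" "smooth_on \<Omega> f" "\<And>x. x \<in> \<Omega> \<Longrightarrow> f x \<noteq> 0"
  shows "smooth_on \<Omega> (\<lambda>x. inverse (f x))"
proof -
  \<comment> \<open>All powers of the reciprocal are needed, since differentiating raises the
    exponent by one; the numerator absorbs the derivative of \<open>f\<close> and the factor
    \<open>k\<close>.\<close>
  define A where "A = {\<lambda>x. g x * inverse (f x) ^ k | g k. smooth_on \<Omega> g}"
  have AI: "(\<lambda>x. g x * inverse (f x) ^ k) \<in> A" if "smooth_on \<Omega> g" for g k
    using that unfolding A_def by blast
  have "(\<lambda>x. inverse (f x)) \<in> A"
    using AI[OF smooth_on_const[OF assms(1), of 1], of 1] by simp
  then show ?thesis
  proof (rule smooth_on_coinduct[OF assms(1)])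
    fix p assume "p \<in> A"
    then obtain g k where p: "p = (\<lambda>x. g x * inverse (f x) ^ k)" and g: "smooth_on \<Omega> g"
      unfolding A_def by blast
    have d: "(p has_derivative (\<lambda>h. g' h * inverse (f x) ^ k
        - of_nat k * g x * f' h * inverse (f x) ^ (k + 1))) (at x)"
      if f': "(f has_derivative f') (at x)" and g': "(g has_derivative g') (at x)" and "x \<in> \<Omega>" for x f' g'
    proof -
      have "((\<lambda>x. inverse (f x)) has_derivative (\<lambda>h. - (inverse (f x) * f' h * inverse (f x)))) (at x)"
        using Deriv.has_derivative_inverse[OF assms(3)[OF that(3)] f'] .
      from has_derivative_mult[OF g' has_derivative_power[OF this, of k]]
      show ?thesis unfolding p
        by (rule has_derivative_eq_rhs) (cases k; simp add: fun_eq_iff algebra_simps)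
    qed
    have d': "(p has_derivative (\<lambda>h. g' h * inverse (f x) ^ k
        - of_nat k * g x * f' h * inverse (f x) ^ (k + 1))) (at x) \<and>
        partial_deriv i p x = partial_deriv i g x * inverse (f x) ^ k
        + (of_nat k * - g x * partial_deriv i f x) * inverse (f x) ^ (k + 1)"
      if f': "(f has_derivative f') (at x)" and g': "(g has_derivative g') (at x)" and "x \<in> \<Omega>" for x f' g' i
      using d[OF that] partial_deriv_eqI[OF d[OF that], of i] partial_deriv_eqI[OF f', of i]
        partial_deriv_eqI[OF g', of i] by simp
    have ex: "\<exists>f' g'. (f has_derivative f') (at x) \<and> (g has_derivative g') (at x)" if "x \<in> \<Omega>" for x
      using smooth_on_differentiable'[OF assms(2,1) that] smooth_on_differentiable'[OF g assms(1) that]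
      unfolding differentiable_def by simp
    show "p differentiable_on \<Omega>"
      unfolding differentiable_on_eq_differentiable_at[OF assms(1)]
      using d ex unfolding differentiable_def by meson
    fix i
    have 1: "\<forall>x\<in>\<Omega>. partial_deriv i p x = partial_deriv i g x * inverse (f x) ^ k
        + (of_nat k * - g x * partial_deriv i f x) * inverse (f x) ^ (k + 1)"
      using d' ex by meson
    have "smooth_on \<Omega> (\<lambda>x. of_nat k * - g x * partial_deriv i f x)"
      using smooth_on_mult[OF assms(1) smooth_on_mult[OF assms(1) smooth_on_const[OF assms(1), of "- of_nat k"] g]
          smooth_on_partial_deriv[OF assms(2)]] by simp
    from AI[OF this, of "k + 1"] AI[OF smooth_on_partial_deriv[OF g], of i k] 1
    show "\<exists>q\<in>A. \<exists>r\<in>A. \<forall>x\<in>\<Omega>. partial_deriv i p x = q x + r x"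
      by (intro bexI)
  qed
qed

section \<open>Symmetry of mixed partial derivatives\<close>

text \<open>
  The mean value inequality in direction \<open>i\<close> compares the second difference of \<open>f\<close> with
  \<open>t\<^sup>2 \<partial>\<^sub>j \<partial>\<^sub>i f\<close>. The second difference is symmetric in \<open>i\<close> and \<open>j\<close>.
\<close>

lemma second_difference_approx:
  fixes f :: "real^'n::finite \<Rightarrow> complex"
  assumes \<Omega>: "open \<Omega>" "x \<in> \<Omega>" and f: "\<And>y. y \<in> \<Omega> \<Longrightarrow> f differentiable at y"
    and g: "partial_deriv i f differentiable at x" and "e > 0"
  shows "\<exists>d>0. \<forall>t. 0 < t \<and> t < d \<longrightarrow>
    norm (f (x + t *\<^sub>R axis i 1 + t *\<^sub>R axis j 1) - f (x + t *\<^sub>R axis i 1) - f (x + t *\<^sub>R axis j 1) + f x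
      - t^2 *\<^sub>R partial_deriv j (partial_deriv i f) x) \<le> e * t^2"
proof -
  let ?g = "partial_deriv i f" and ?ei = "axis i (1::real) :: real^'n" and ?ej = "axis j (1::real) :: real^'n"
  obtain D where D: "(?g has_derivative D) (at x)"
    using g unfolding differentiable_def by blast
  then interpret D: bounded_linear D by (rule has_derivative_bounded_linear)
  \<comment> \<open>The linearization of \<open>?g\<close> is used once at distance at most
    \<open>2 * t\<close> and once at distance at most \<open>t\<close> from \<open>x\<close>; with a
    third of \<open>e\<close> the two errors add up to \<open>e * t\<close>.\<close>
  have "e / 3 > 0" using \<open>e > 0\<close> by simp
  then obtain \<delta> where \<delta>: "\<delta> > 0" "\<And>y. norm (y - x) < \<delta> \<Longrightarrow> norm (?g y - ?g x - D (y - x)) \<le> e / 3 * norm (y - x)"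
    using D unfolding has_derivative_at_alt by blast
  obtain \<rho> where \<rho>: "\<rho> > 0" "ball x \<rho> \<subseteq> \<Omega>"
    using \<Omega> open_contains_ball by blast
  \<comment> \<open>Halved because the points that occur may lie at distance \<open>2 * t\<close>
    from \<open>x\<close>, which must stay below both radii.\<close>
  define d where "d = min \<delta> \<rho> / 2"
  have "norm (f (x + t *\<^sub>R ?ei + t *\<^sub>R ?ej) - f (x + t *\<^sub>R ?ei) - f (x + t *\<^sub>R ?ej) + f x
      - t^2 *\<^sub>R partial_deriv j ?g x) \<le> e * t^2" if t: "0 < t" "t < d" for t
  proof -
    \<comment> \<open>With the linear term subtracted, \<open>?\<phi> t - ?\<phi> 0\<close> is the
      second difference minus \<open>t^2\<close> times the mixed derivative. Its derivative in
      \<open>s\<close> is a difference of two linearization errors of \<open>?g\<close> at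
      \<open>x\<close>, so it is small uniformly in \<open>s\<close>.\<close>
    let ?\<phi> = "\<lambda>s. f (x + s *\<^sub>R ?ei + t *\<^sub>R ?ej) - f (x + s *\<^sub>R ?ei) - s *\<^sub>R (t *\<^sub>R D ?ej)"
    let ?\<phi>' = "\<lambda>s. ?g (x + s *\<^sub>R ?ei + t *\<^sub>R ?ej) - ?g (x + s *\<^sub>R ?ei) - t *\<^sub>R D ?ej"
    have n2: "norm (s *\<^sub>R ?ei + t *\<^sub>R ?ej) \<le> 2 * t" if "s \<in> {0..t}" for s
      using norm_triangle_ineq[of "s *\<^sub>R ?ei" "t *\<^sub>R ?ej"] that t by simp
    have n1: "norm (s *\<^sub>R ?ei) \<le> t" if "s \<in> {0..t}" for s
      using that t by simp
    have in\<Omega>: "x + v \<in> \<Omega>" "norm v < \<delta>" if "norm v \<le> 2 * t" for v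
      using that t \<rho>(2) by (auto simp: d_def dist_norm intro!: subsetD[OF \<rho>(2)])
    have der: "((\<lambda>s. f (x + s *\<^sub>R ?ei + c)) has_derivative (\<lambda>h. h *\<^sub>R ?g (x + s *\<^sub>R ?ei + c))) (at s within {0..t})"
      if mem: "x + s *\<^sub>R ?ei + c \<in> \<Omega>" for s c
    proof -
      obtain f' where f': "(f has_derivative f') (at (x + s *\<^sub>R ?ei + c))"
        using f[OF mem] unfolding differentiable_def by blast
      then interpret f': bounded_linear f' by (rule has_derivative_bounded_linear)
      have "((\<lambda>s. x + s *\<^sub>R ?ei + c) has_derivative (\<lambda>h. h *\<^sub>R ?ei)) (at s within {0..t})"
        by (auto intro!: derivative_eq_intros)
      from has_derivative_compose[OF this f'] show ?thesis
        using partial_deriv_eqI[OF f', of i] by (simp add: f'.scaleR)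
    qed
    have "norm (?\<phi> t - ?\<phi> 0) \<le> (e * t) * norm (t - 0)"
    proof (rule differentiable_bound[where S = "{0..t}" and f' = "\<lambda>s h. h *\<^sub>R ?\<phi>' s"])
      fix s assume s: "s \<in> {0..t}"
      have i1: "x + s *\<^sub>R ?ei + t *\<^sub>R ?ej \<in> \<Omega>" using in\<Omega>(1)[OF n2[OF s]] by (simp add: add.assoc)
      have i2: "x + s *\<^sub>R ?ei + 0 \<in> \<Omega>" using in\<Omega>(1)[of "s *\<^sub>R ?ei"] n1[OF s] t by simp
      have d3: "((\<lambda>s. s *\<^sub>R (t *\<^sub>R D ?ej)) has_derivative (\<lambda>h. h *\<^sub>R (t *\<^sub>R D ?ej))) (at s within {0..t})"
        by (rule has_derivative_scaleR_left[OF has_derivative_ident])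
      show "(?\<phi> has_derivative (\<lambda>h. h *\<^sub>R ?\<phi>' s)) (at s within {0..t})"
        using has_derivative_diff[OF has_derivative_diff[OF der[OF i1] der[OF i2]] d3]
        by (simp add: scaleR_diff_right)
      have "norm (?g (x + (s *\<^sub>R ?ei + t *\<^sub>R ?ej)) - ?g x - D (s *\<^sub>R ?ei + t *\<^sub>R ?ej)) \<le> e / 3 * (2 * t)"
        using order.trans[OF \<delta>(2)[of "x + (s *\<^sub>R ?ei + t *\<^sub>R ?ej)"] mult_left_mono[of _ _ "e / 3"]]
          in\<Omega>(2)[OF n2[OF s]] n2[OF s] \<open>e > 0\<close> by simp
      moreover have "norm (?g (x + s *\<^sub>R ?ei) - ?g x - D (s *\<^sub>R ?ei)) \<le> e / 3 * t"
        using order.trans[OF \<delta>(2)[of "x + s *\<^sub>R ?ei"] mult_left_mono[of _ _ "e / 3"]]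
          in\<Omega>(2)[of "s *\<^sub>R ?ei"] n1[OF s] t \<open>e > 0\<close> by simp
      moreover have "?\<phi>' s = (?g (x + (s *\<^sub>R ?ei + t *\<^sub>R ?ej)) - ?g x - D (s *\<^sub>R ?ei + t *\<^sub>R ?ej))
          - (?g (x + s *\<^sub>R ?ei) - ?g x - D (s *\<^sub>R ?ei))"
        by (simp add: D.add D.scaleR add.assoc)
      moreover have "norm (a - b) \<le> e * t" if "norm a \<le> e / 3 * (2 * t)" "norm b \<le> e / 3 * t" for a b :: complex
        using norm_triangle_ineq4[of a b] that by (simp add: field_simps)
      ultimately have B: "norm (?\<phi>' s) \<le> e * t"
        by (simp only:)
      show "onorm (\<lambda>h. h *\<^sub>R ?\<phi>' s) \<le> e * t"
        by (rule onorm_le) (use mult_left_mono[OF B abs_ge_zero] in \<open>simp add: mult.commute\<close>)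
    qed (use t in auto)
    moreover have "?\<phi> t - ?\<phi> 0 = f (x + t *\<^sub>R ?ei + t *\<^sub>R ?ej) - f (x + t *\<^sub>R ?ei) - f (x + t *\<^sub>R ?ej) + f x
      - t^2 *\<^sub>R partial_deriv j ?g x"
      using partial_deriv_eqI[OF D, of j] by (simp add: power2_eq_square)
    moreover have "(e * t) * norm (t - 0) = e * t^2"
      using t by (simp add: power2_eq_square)
    ultimately show ?thesis by (simp only:)
  qed
  then show ?thesis
    using \<delta>(1) \<rho>(1) by (intro exI[of _ d]) (auto simp: d_def)
qed

lemma partial_deriv_commute:
  assumes \<Omega>: "open \<Omega>" "x \<in> \<Omega>" and f: "smooth_on \<Omega> f"
  shows "partial_deriv i (partial_deriv j f) x = partial_deriv j (partial_deriv i f) x"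
proof -
  let ?A = "partial_deriv i (partial_deriv j f) x" and ?B = "partial_deriv j (partial_deriv i f) x"
  have "norm (?A - ?B) \<le> e" if "e > 0" for e
  proof -
    let ?\<Delta> = "\<lambda>i j t. f (x + t *\<^sub>R axis i 1 + t *\<^sub>R axis j 1) - f (x + t *\<^sub>R axis i 1) - f (x + t *\<^sub>R axis j 1) + f x"
    \<comment> \<open>Half of \<open>e\<close> for each order of differentiation; after division by
      \<open>t^2\<close> the two errors sum to \<open>e\<close>.\<close>
    have "e / 2 > 0" using that by simp
    note * = second_difference_approx[OF \<Omega> smooth_on_differentiable'[OF f \<Omega>(1)]
        smooth_on_differentiable'[OF smooth_on_partial_deriv[OF f] \<Omega>] this]
    obtain d1 where d1: "d1 > 0" "\<And>t. 0 < t \<Longrightarrow> t < d1 \<Longrightarrow> norm (?\<Delta> i j t - t^2 *\<^sub>R ?B) \<le> e / 2 * t^2"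
      using *[of i j] by blast
    obtain d2 where d2: "d2 > 0" "\<And>t. 0 < t \<Longrightarrow> t < d2 \<Longrightarrow> norm (?\<Delta> j i t - t^2 *\<^sub>R ?A) \<le> e / 2 * t^2"
      using *[of j i] by blast
    define t where "t = min d1 d2 / 2"
    have t: "0 < t" "t < d1" "t < d2" using d1(1) d2(1) by (auto simp: t_def)
    have "?\<Delta> i j t - t^2 *\<^sub>R ?B - (?\<Delta> j i t - t^2 *\<^sub>R ?A) = t^2 *\<^sub>R (?A - ?B)"
      by (simp add: scaleR_diff_right algebra_simps)
    then have "t^2 * norm (?A - ?B) \<le> e / 2 * t^2 + e / 2 * t^2"
      using norm_triangle_ineq4[of "?\<Delta> i j t - t^2 *\<^sub>R ?B" "?\<Delta> j i t - t^2 *\<^sub>R ?A"] d1(2)[OF t(1,2)] d2(2)[OF t(1,3)]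
      by simp
    then have "t^2 * norm (?A - ?B) \<le> t^2 * e" by (simp add: algebra_simps)
    then show ?thesis using t(1) by simp
  qed
  then have "norm (?A - ?B) \<le> 0" by (rule field_le_epsilon[of _ 0, simplified])
  then show ?thesis by simp
qed

lemma iter_partial_move_front:
  assumes "open \<Omega>" "smooth_on \<Omega> f" "x \<in> \<Omega>"
  shows "iter_partial (a @ i # b) f x = iter_partial (i # a @ b) f x"
  using assms(3)
proof (induction a arbitrary: x)
  case (Cons j a)
  have "iter_partial ((j # a) @ i # b) f x = partial_deriv j (iter_partial (i # a @ b) f) x"
    using partial_deriv_cong[OF assms(1) Cons.IH Cons.prems] by (simp add: iter_partial_Cons)
  also have "\<dots> = partial_deriv i (partial_deriv j (iter_partial (a @ b) f)) x"
    unfolding iter_partial_Cons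
    by (rule partial_deriv_commute[OF assms(1) Cons.prems smooth_on_iter_partial[OF assms(2)]])
  finally show ?case by (simp add: iter_partial_Cons)
qed simp

text \<open>The first letter of \<open>v\<close> occurs somewhere in \<open>w\<close> and is moved
  to its front by swaps of neighbouring letters; the rest follows by induction. This makes the order
  hidden in \<open>multi_partial\<close> irrelevant.\<close>

lemma iter_partial_perm:
  assumes "open \<Omega>" "smooth_on \<Omega> f" "x \<in> \<Omega>" "\<And>i. count_list v i = count_list w i"
  shows "iter_partial v f x = iter_partial w f x"
  using assms(3,4)
proof (induction v arbitrary: w x)
  case Nil
  then have "i \<notin> set w" for i by (simp add: count_list_0_iff[symmetric])
  then have "w = []" by (cases w) auto
  then show ?case by simp
next
  case (Cons i v)
  have "count_list w i \<noteq> 0" using Cons.prems(2)[of i] by simp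
  then obtain a b where w: "w = a @ i # b"
    by (metis count_notin split_list)
  have "count_list v k = count_list (a @ b) k" for k
    using Cons.prems(2)[of k] by (simp add: w split: if_splits)
  then have "iter_partial (i # v) f x = iter_partial (i # a @ b) f x"
    unfolding iter_partial_Cons
    by (intro partial_deriv_cong[OF assms(1) _ Cons.prems(1)] Cons.IH)
  then show ?case
    unfolding w iter_partial_move_front[OF assms(1,2) Cons.prems(1)] .
qed

section \<open>Cutoff functions\<close>

text \<open>The recurrence comes from the chain rule: with \<open>s = 1/t\<close>, the derivative of
  \<open>p(s) * exp(-s)\<close> with respect to \<open>t\<close> is
  \<open>s^2 * (p(s) - p'(s)) * exp(-s)\<close>.\<close>

primrec flat_poly :: "nat \<Rightarrow> real poly" where
  "flat_poly 0 = 1"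
| "flat_poly (Suc k) = [:0, 0, 1:] * (flat_poly k - pderiv (flat_poly k))"

text \<open>The \<open>k\<close>-th derivative of the function that is \<open>exp (-1/t)\<close> for \<open>t > 0\<close> and \<open>0\<close> otherwise.\<close>

definition flat :: "nat \<Rightarrow> real \<Rightarrow> real" where
  "flat k t = (if t > 0 then poly (flat_poly k) (1 / t) * exp (- (1 / t)) else 0)"

lemma poly_times_exp_tendsto_0: "((\<lambda>s::real. poly p s * exp (- s)) \<longlongrightarrow> 0) at_top"
proof -
  have "((\<lambda>s::real. \<Sum>i\<le>degree p. coeff p i * (s ^ i / exp s)) \<longlongrightarrow> (\<Sum>i\<le>degree p. coeff p i * 0)) at_top"
    by (intro tendsto_sum tendsto_mult tendsto_const tendsto_power_div_exp_0)
  moreover have "(\<Sum>i\<le>degree p. coeff p i * (s ^ i / exp s)) = poly p s * exp (- s)" for s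
    by (simp add: poly_altdef sum_distrib_right exp_minus divide_inverse mult.assoc)
  ultimately show ?thesis by simp
qed

lemma DERIV_flat: "(flat k has_real_derivative flat (Suc k) t) (at t)"
proof -
  consider "t > 0" | "t < 0" | "t = 0" by linarith
  then show ?thesis
  proof cases
    case 1
    have "((\<lambda>t. poly (flat_poly k) (1 / t) * exp (- (1 / t))) has_real_derivative flat (Suc k) t) (at t)"
      using 1 by (auto intro!: derivative_eq_intros poly_DERIV[THEN DERIV_chain2]
          simp: flat_def field_simps power2_eq_square)
    then show ?thesis
      by (rule has_field_derivative_transform_within_open[where S = "{0<..}"]) (use 1 in \<open>auto simp: flat_def\<close>)
  next
    case 2
    have "((\<lambda>t. 0) has_real_derivative flat (Suc k) t) (at t)"
      using 2 by (simp add: flat_def)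
    then show ?thesis
      by (rule has_field_derivative_transform_within_open[where S = "{..<0}"]) (use 2 in \<open>auto simp: flat_def\<close>)
  next
    case 3
    \<comment> \<open>The difference quotient at \<open>0\<close> divides by \<open>h\<close>, which
      is multiplication by \<open>s = 1/h\<close>. The factor \<open>[:0, 1:]\<close> records this,
      leaving a polynomial times \<open>exp (- s)\<close>.\<close>
    have "((\<lambda>s. poly ([:0, 1:] * flat_poly k) s * exp (- s)) \<longlongrightarrow> 0) at_top"
      by (rule poly_times_exp_tendsto_0)
    then have "((\<lambda>h. poly ([:0, 1:] * flat_poly k) (inverse h) * exp (- inverse h)) \<longlongrightarrow> 0) (at_right 0)"
      by (simp add: filterlim_at_top_to_right)
    moreover have "eventually (\<lambda>h. poly ([:0, 1:] * flat_poly k) (inverse h) * exp (- inverse h)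
        = (flat k (0 + h) - flat k 0) / h) (at_right 0)"
      unfolding eventually_at_right_field
      by (intro exI[of _ 1]) (auto simp: flat_def field_simps)
    ultimately have R: "((\<lambda>h. (flat k (0 + h) - flat k 0) / h) \<longlongrightarrow> 0) (at_right 0)"
      by (rule Lim_transform_eventually)
    have "eventually (\<lambda>h. 0 = (flat k (0 + h) - flat k 0) / h) (at_left 0)"
      unfolding eventually_at_left_field
      by (intro exI[of _ "-1"]) (auto simp: flat_def)
    then have "((\<lambda>h. (flat k (0 + h) - flat k 0) / h) \<longlongrightarrow> 0) (at_left 0)"
      by (rule Lim_transform_eventually[OF tendsto_const])
    with R have "((\<lambda>h. (flat k (0 + h) - flat k 0) / h) \<longlongrightarrow> 0) (at 0)"
      by (simp add: filterlim_split_at)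
    then show ?thesis
      using 3 by (simp add: DERIV_def flat_def)
  qed
qed

lemma smooth_on_coord: "smooth_on UNIV (\<lambda>y::real^'n::finite. complex_of_real (y $ i))"
proof (rule smooth_on_coinduct[where A = "insert (\<lambda>y. complex_of_real (y $ i)) (range (\<lambda>c y. c))"])
  fix f :: "real^'n \<Rightarrow> complex" and j
  assume f: "f \<in> insert (\<lambda>y. complex_of_real (y $ i)) (range (\<lambda>c y. c))"
  have d: "((\<lambda>y::real^'n. complex_of_real (y $ i)) has_derivative (\<lambda>h. complex_of_real (h $ i))) (at y)" for y
    by (intro bounded_linear_imp_has_derivative bounded_linear_compose[OF bounded_linear_of_real]
        bounded_linear_vec_nth)
  from f show "f differentiable_on UNIV"
    using d unfolding differentiable_on_def differentiable_def by (auto intro: has_derivative_const)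
  from f obtain c where "\<forall>y. partial_deriv j f y = c"
    using partial_deriv_eqI[OF d] by (auto simp: partial_deriv_const)
  then show "\<exists>g\<in>insert (\<lambda>y. complex_of_real (y $ i)) (range (\<lambda>c y. c)).
      \<exists>h\<in>insert (\<lambda>y. complex_of_real (y $ i)) (range (\<lambda>c y. c)). \<forall>x\<in>UNIV. partial_deriv j f x = g x + h x"
    by (intro bexI[of _ "\<lambda>y. c"] bexI[of _ "\<lambda>y. 0"]) auto
qed auto

text \<open>Differentiating \<open>flat k\<close> of the quadratic gives \<open>flat (Suc k)\<close>
  times a linear function of \<open>y\<close>, which joins the smooth factor \<open>p\<close>; hence
  the class \<open>A\<close> below. The parameters \<open>\<alpha>\<close> and
  \<open>\<beta>\<close> cover both a function living inside a ball and one living outside a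
  ball.\<close>

lemma smooth_on_flat_sqdist:
  fixes x :: "real^'n::finite"
  shows "smooth_on UNIV (\<lambda>y. complex_of_real (flat 0 (\<alpha> + \<beta> * ((y - x) \<bullet> (y - x)))))"
proof -
  let ?q = "\<lambda>y. \<alpha> + \<beta> * ((y - x) \<bullet> (y - x))"
  define A where "A = {\<lambda>y. p y * complex_of_real (flat k (?q y)) | p k. smooth_on UNIV p}"
  have AI: "(\<lambda>y. p y * complex_of_real (flat k (?q y))) \<in> A" if "smooth_on UNIV p" for p k
    using that unfolding A_def by blast
  have "(\<lambda>y. complex_of_real (flat 0 (?q y))) \<in> A"
    using AI[OF smooth_on_const[OF open_UNIV, of 1], of 0] by simp
  then show ?thesis
  proof (rule smooth_on_coinduct[OF open_UNIV])
    fix f assume "f \<in> A"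
    then obtain p k where f: "f = (\<lambda>y. p y * complex_of_real (flat k (?q y)))" and p: "smooth_on UNIV p"
      unfolding A_def by blast
    have d: "((\<lambda>y. complex_of_real (flat k (?q y))) has_derivative
        (\<lambda>h. complex_of_real (flat (Suc k) (?q y) * (\<beta> * (2 * ((y - x) \<bullet> h)))))) (at y)" for y
    proof (rule has_derivative_of_real)
      have "(?q has_derivative (\<lambda>h. \<beta> * (2 * ((y - x) \<bullet> h)))) (at y)"
        by (auto intro!: derivative_eq_intros simp: fun_eq_iff inner_commute algebra_simps)
      from has_derivative_compose[OF this DERIV_flat[unfolded has_field_derivative_def]]
      show "((\<lambda>y. flat k (?q y)) has_derivative (\<lambda>h. flat (Suc k) (?q y) * (\<beta> * (2 * ((y - x) \<bullet> h))))) (at y)" .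
    qed
    then have fd: "(\<lambda>y. complex_of_real (flat k (?q y))) differentiable at y" for y
      unfolding differentiable_def by blast
    note pd = smooth_on_differentiable'[OF p open_UNIV UNIV_I]
    show "f differentiable_on UNIV"
      unfolding f differentiable_on_def using differentiable_mult[OF pd fd] by simp
    fix i
    let ?p = "\<lambda>y. p y * (complex_of_real (2 * \<beta>) * (complex_of_real (y $ i) - complex_of_real (x $ i)))"
    have "partial_deriv i f y = partial_deriv i p y * complex_of_real (flat k (?q y))
        + ?p y * complex_of_real (flat (Suc k) (?q y))" for y
      unfolding f partial_deriv_mult[OF pd fd] partial_deriv_eqI[OF d, of i]
      by (simp add: inner_axis)
    moreover have "smooth_on UNIV ?p"
      by (intro smooth_on_mult smooth_on_diff smooth_on_const smooth_on_coord p) simp_all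
    ultimately show "\<exists>g\<in>A. \<exists>h\<in>A. \<forall>y\<in>UNIV. partial_deriv i f y = g y + h y"
      using AI[OF smooth_on_partial_deriv[OF p]] AI[of ?p] by (intro bexI) auto
  qed
qed

lemma flat_0_pos_iff: "flat 0 t > 0 \<longleftrightarrow> t > 0"
  and flat_0_nonneg: "flat 0 t \<ge> 0"
  and flat_0_nonpos: "t \<le> 0 \<Longrightarrow> flat 0 t = 0"
  by (auto simp: flat_def)

text \<open>The quotient \<open>a / (a + b)\<close>, where \<open>a\<close> is positive exactly on
  the open ball of radius \<open>r\<close> and \<open>b\<close> exactly outside the closed ball of
  radius \<open>r / 2\<close>. As these two regions cover the space, the denominator never
  vanishes.\<close>

lemma smooth_cutoff_ball:
  fixes x :: "real^'n::finite"
  assumes "0 < r"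
  obtains \<psi> where "smooth_on UNIV \<psi>" "\<And>y. y \<in> ball x (r / 2) \<Longrightarrow> \<psi> y = 1" "\<And>y. y \<notin> cball x r \<Longrightarrow> \<psi> y = 0"
proof -
  let ?q = "\<lambda>y. (y - x) \<bullet> (y - x)"
  define a where "a = (\<lambda>y. flat 0 (r^2 + (-1) * ?q y))"
  define b where "b = (\<lambda>y. flat 0 (- ((r / 2)^2) + 1 * ?q y))"
  define \<psi> where "\<psi> = (\<lambda>y. complex_of_real (a y) * inverse (complex_of_real (a y) + complex_of_real (b y)))"
  have pos: "a y + b y > 0" for y
  proof -
    have "(r / 2)^2 < r^2" using assms by (simp add: power2_eq_square)
    then have "a y > 0 \<or> b y > 0" unfolding a_def b_def flat_0_pos_iff by linarith
    moreover have "a y \<ge> 0" "b y \<ge> 0" unfolding a_def b_def by (rule flat_0_nonneg)+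
    ultimately show ?thesis by linarith
  qed
  then have nz: "complex_of_real (a y) + complex_of_real (b y) \<noteq> 0" for y
    by (metis of_real_add of_real_eq_0_iff less_irrefl)
  show thesis
  proof
    show "smooth_on UNIV \<psi>"
      unfolding \<psi>_def
      by (intro smooth_on_mult smooth_on_inverse smooth_on_add open_UNIV nz)
        (auto simp only: a_def b_def intro: smooth_on_flat_sqdist)
    show "\<psi> y = 1" if "y \<in> ball x (r / 2)" for y
    proof -
      have "norm (y - x) \<le> r / 2" using that by (simp add: dist_norm norm_minus_commute)
      then have "?q y \<le> (r / 2)^2"
        by (simp add: power2_norm_eq_inner[symmetric] power_mono del: power_divide)
      then have "b y = 0" unfolding b_def by (intro flat_0_nonpos) simp
      with nz[of y] show ?thesis by (simp add: \<psi>_def)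
    qed
    show "\<psi> y = 0" if "y \<notin> cball x r" for y
    proof -
      have "r \<le> norm (y - x)" using that by (simp add: dist_norm norm_minus_commute)
      then have "r^2 \<le> ?q y"
        using assms by (simp add: power2_norm_eq_inner[symmetric] power_mono)
      then have "a y = 0" unfolding a_def by (intro flat_0_nonpos) simp
      then show ?thesis by (simp add: \<psi>_def)
    qed
  qed
qed

text \<open>Having a cutoff function is inherited by finite unions, and finitely many small balls
  cover \<open>H\<close>. Their union serves as \<open>W\<close>.\<close>

lemma smooth_cutoff:
  fixes H :: "(real^'n::finite) set"
  assumes "compact H" "open V" "H \<subseteq> V"
  obtains \<psi> W C where "smooth_on UNIV \<psi>" "open W" "H \<subseteq> W" "\<And>y. y \<in> W \<Longrightarrow> \<psi> y = 1"
    "compact C" "C \<subseteq> V" "\<And>y. y \<notin> C \<Longrightarrow> \<psi> y = 0"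
proof -
  define good where "good U \<longleftrightarrow> (\<exists>\<psi> C. smooth_on UNIV \<psi> \<and> (\<forall>y\<in>U. \<psi> y = 1) \<and> compact C \<and> C \<subseteq> V \<and>
      (\<forall>y. y \<notin> C \<longrightarrow> \<psi> y = 0))" for U
  have "H \<subseteq> \<Union>{U. open U \<and> good U}"
  proof
    fix x assume "x \<in> H"
    then obtain r where r: "r > 0" "cball x r \<subseteq> V"
      using assms(2,3) open_contains_cball by blast
    obtain \<psi> where "smooth_on UNIV \<psi>" "\<And>y. y \<in> ball x (r / 2) \<Longrightarrow> \<psi> y = 1" "\<And>y. y \<notin> cball x r \<Longrightarrow> \<psi> y = 0"
      by (rule smooth_cutoff_ball[OF r(1), of x]) (rule that)
    with r(2) have "good (ball x (r / 2))"
      unfolding good_def by (intro exI[of _ \<psi>] exI[of _ "cball x r"]) auto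
    then show "x \<in> \<Union>{U. open U \<and> good U}"
      using r(1) by (intro UnionI[of "ball x (r / 2)"]) auto
  qed
  then obtain F where F: "F \<subseteq> {U. open U \<and> good U}" "finite F" "H \<subseteq> \<Union>F"
    by (rule compactE[OF assms(1)]) (simp, rule that)
  have "good (\<Union>F)"
    using F(2,1)
  proof (induction F)
    case empty
    then show ?case
      unfolding good_def using smooth_on_const[OF open_UNIV, of 0] by (intro exI[of _ "\<lambda>_. 0"] exI[of _ "{}"]) auto
  next
    case (insert U F)
    then have "good U" by simp
    then obtain \<psi> C where 1: "smooth_on UNIV \<psi>" "\<forall>y\<in>U. \<psi> y = 1" "compact C" "C \<subseteq> V" "\<forall>y. y \<notin> C \<longrightarrow> \<psi> y = 0"
      unfolding good_def by blast
    from insert have "good (\<Union>F)" by simp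
    then obtain \<theta> D where 2: "smooth_on UNIV \<theta>" "\<forall>y\<in>\<Union>F. \<theta> y = 1" "compact D" "D \<subseteq> V" "\<forall>y. y \<notin> D \<longrightarrow> \<theta> y = 0"
      unfolding good_def by blast
    \<comment> \<open>This is \<open>1 - (1 - \<psi>) * (1 - \<theta>)\<close>: it equals
      \<open>1\<close> where one of the two functions does, and \<open>0\<close> where both
      vanish.\<close>
    have "smooth_on UNIV (\<lambda>y. \<psi> y + \<theta> y - \<psi> y * \<theta> y)"
      by (intro smooth_on_add smooth_on_diff smooth_on_mult open_UNIV 1 2)
    with 1 2 show ?case
      unfolding good_def by (intro exI[of _ "\<lambda>y. \<psi> y + \<theta> y - \<psi> y * \<theta> y"] exI[of _ "C \<union> D"]) auto
  qed
  then obtain \<psi> C where *: "smooth_on UNIV \<psi>" "\<forall>y\<in>\<Union>F. \<psi> y = 1" "compact C" "C \<subseteq> V" "\<forall>y. y \<notin> C \<longrightarrow> \<psi> y = 0"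
    unfolding good_def by blast
  have "open (\<Union>F)" using F(1) by blast
  then show thesis by (rule that[OF *(1) _ F(3) _ *(3,4)]) (use *(2,5) in blast)+
qed

section \<open>Growth of nets of functions\<close>

text \<open>A uniform estimate without suprema, so that it can be manipulated pointwise and makes
  sense for unbounded functions. \<open>Sup_bigo_iff\<close> connects it with the suprema of the
  definitions.\<close>

definition ubound :: "'a set \<Rightarrow> real \<Rightarrow> (real \<Rightarrow> 'a \<Rightarrow> complex) \<Rightarrow> bool" where
  "ubound L b g \<longleftrightarrow> (\<exists>C. \<forall>\<^sub>F \<epsilon> in at_right 0. \<forall>x\<in>L. norm (g \<epsilon> x) \<le> C * \<epsilon> powr b)"

lemma eventually_at_right_0_1: "\<forall>\<^sub>F \<epsilon>::real in at_right 0. \<epsilon> \<in> {0<..1}"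
  unfolding eventually_at_right_field by (intro exI[of _ 1]) auto

lemma ubound_ev:
  assumes "ubound L b g" and "\<forall>\<^sub>F \<epsilon> in at_right 0. \<forall>x\<in>L. h \<epsilon> x = g \<epsilon> x"
  shows "ubound L b h"
proof -
  obtain C where "\<forall>\<^sub>F \<epsilon> in at_right 0. \<forall>x\<in>L. norm (g \<epsilon> x) \<le> C * \<epsilon> powr b"
    using assms(1) unfolding ubound_def by blast
  with assms(2) have "\<forall>\<^sub>F \<epsilon> in at_right 0. \<forall>x\<in>L. norm (h \<epsilon> x) \<le> C * \<epsilon> powr b"
    by eventually_elim simp
  then show ?thesis unfolding ubound_def by blast
qed

lemma ubound_cong:
  assumes "ubound L b g" and "\<And>\<epsilon> x. \<epsilon> \<in> {0<..1} \<Longrightarrow> x \<in> L \<Longrightarrow> h \<epsilon> x = g \<epsilon> x"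
  shows "ubound L b h"
  by (rule ubound_ev[OF assms(1)]) (use eventually_at_right_0_1 in eventually_elim, simp add: assms(2))

lemma ubound_zero: "ubound L b (\<lambda>\<epsilon> x. 0)"
  unfolding ubound_def by (intro exI[of _ 0]) simp

lemma ubound_subset: "ubound L b g \<Longrightarrow> M \<subseteq> L \<Longrightarrow> ubound M b g"
  unfolding ubound_def by (elim exE, rule exI, erule eventually_mono) blast

lemma ubound_Un:
  assumes "ubound L b g" "ubound M b g"
  shows "ubound (L \<union> M) b g"
proof -
  obtain C where C: "\<forall>\<^sub>F \<epsilon> in at_right 0. \<forall>x\<in>L. norm (g \<epsilon> x) \<le> C * \<epsilon> powr b"
    using assms(1) unfolding ubound_def by blast
  obtain D where D: "\<forall>\<^sub>F \<epsilon> in at_right 0. \<forall>x\<in>M. norm (g \<epsilon> x) \<le> D * \<epsilon> powr b"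
    using assms(2) unfolding ubound_def by blast
  have "\<forall>\<^sub>F \<epsilon> in at_right 0. \<forall>x\<in>L \<union> M. norm (g \<epsilon> x) \<le> max C D * \<epsilon> powr b"
    using C D
  proof eventually_elim
    case (elim \<epsilon>)
    have "C * \<epsilon> powr b \<le> max C D * \<epsilon> powr b" "D * \<epsilon> powr b \<le> max C D * \<epsilon> powr b"
      by (auto intro: mult_right_mono)
    with elim show ?case by fastforce
  qed
  then show ?thesis unfolding ubound_def by blast
qed

lemma ubound_Union:
  assumes "finite F" "\<And>U. U \<in> F \<Longrightarrow> ubound U b g"
  shows "ubound (\<Union>F) b g"
  using assms
proof (induction F)
  case empty
  then show ?case unfolding ubound_def by simp
qed (simp add: ubound_Un)

lemma ubound_mono:
  assumes "ubound L b g" "a \<le> b"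
  shows "ubound L a g"
proof -
  obtain C where C: "\<forall>\<^sub>F \<epsilon> in at_right 0. \<forall>x\<in>L. norm (g \<epsilon> x) \<le> C * \<epsilon> powr b"
    using assms(1) unfolding ubound_def by blast
  have "\<forall>\<^sub>F \<epsilon> in at_right 0. \<forall>x\<in>L. norm (g \<epsilon> x) \<le> \<bar>C\<bar> * \<epsilon> powr a"
    using C eventually_at_right_0_1
  proof eventually_elim
    case (elim \<epsilon>)
    have "C * \<epsilon> powr b \<le> \<bar>C\<bar> * \<epsilon> powr a"
      using elim(2) assms(2) by (intro mult_mono powr_mono') auto
    with elim show ?case by fastforce
  qed
  then show ?thesis unfolding ubound_def by blast
qed

lemma ubound_add:
  assumes "ubound L b g" "ubound L b h"
  shows "ubound L b (\<lambda>\<epsilon> x. g \<epsilon> x + h \<epsilon> x)"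
proof -
  obtain C where C: "\<forall>\<^sub>F \<epsilon> in at_right 0. \<forall>x\<in>L. norm (g \<epsilon> x) \<le> C * \<epsilon> powr b"
    using assms(1) unfolding ubound_def by blast
  obtain D where D: "\<forall>\<^sub>F \<epsilon> in at_right 0. \<forall>x\<in>L. norm (h \<epsilon> x) \<le> D * \<epsilon> powr b"
    using assms(2) unfolding ubound_def by blast
  have "\<forall>\<^sub>F \<epsilon> in at_right 0. \<forall>x\<in>L. norm (g \<epsilon> x + h \<epsilon> x) \<le> (C + D) * \<epsilon> powr b"
    using C D by eventually_elim (auto simp: distrib_right intro: norm_triangle_le add_mono)
  then show ?thesis unfolding ubound_def by blast
qed

lemma ubound_mult_net:
  assumes "(\<lambda>\<epsilon>. norm (z \<epsilon>)) \<in> O[at_right 0](\<lambda>\<epsilon>. \<epsilon> powr a)" "ubound L b g"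
  shows "ubound L (a + b) (\<lambda>\<epsilon> x. z \<epsilon> * g \<epsilon> x)"
proof -
  obtain C where C: "\<forall>\<^sub>F \<epsilon> in at_right 0. \<forall>x\<in>L. norm (g \<epsilon> x) \<le> C * \<epsilon> powr b"
    using assms(2) unfolding ubound_def by blast
  obtain D where D: "D > 0" "\<forall>\<^sub>F \<epsilon> in at_right 0. norm (norm (z \<epsilon>)) \<le> D * norm (\<epsilon> powr a)"
    using assms(1) by (elim landau_o.bigE)
  have "\<forall>\<^sub>F \<epsilon> in at_right 0. \<forall>x\<in>L. norm (z \<epsilon> * g \<epsilon> x) \<le> (D * C) * \<epsilon> powr (a + b)"
    using C D(2)
  proof eventually_elim
    case (elim \<epsilon>)
    have "norm (z \<epsilon> * g \<epsilon> x) \<le> (D * \<epsilon> powr a) * (C * \<epsilon> powr b)" if "x \<in> L" for x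
      unfolding norm_mult using elim that D(1) by (intro mult_mono) auto
    then show ?case by (simp add: powr_add mult_ac)
  qed
  then show ?thesis unfolding ubound_def by blast
qed

lemma ubound_mult_bounded:
  assumes "ubound L b g" "\<And>x. x \<in> L \<Longrightarrow> norm (c x) \<le> B"
  shows "ubound L b (\<lambda>\<epsilon> x. c x * g \<epsilon> x)"
proof -
  obtain C where C: "\<forall>\<^sub>F \<epsilon> in at_right 0. \<forall>x\<in>L. norm (g \<epsilon> x) \<le> C * \<epsilon> powr b"
    using assms(1) unfolding ubound_def by blast
  have "\<forall>\<^sub>F \<epsilon> in at_right 0. \<forall>x\<in>L. norm (c x * g \<epsilon> x) \<le> (\<bar>B\<bar> * C) * \<epsilon> powr b"
    using C
  proof eventually_elim
    case (elim \<epsilon>)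
    have "norm (c x * g \<epsilon> x) \<le> \<bar>B\<bar> * (C * \<epsilon> powr b)" if "x \<in> L" for x
      unfolding norm_mult using elim that assms(2)[OF that] by (intro mult_mono) auto
    then show ?case by (simp add: mult.assoc)
  qed
  then show ?thesis unfolding ubound_def by blast
qed

lemma ubound_finite:
  assumes "finite I" "\<And>i. i \<in> I \<Longrightarrow> ubound L b (g i)"
  shows "\<exists>C. \<forall>\<^sub>F \<epsilon> in at_right 0. \<forall>i\<in>I. \<forall>x\<in>L. norm (g i \<epsilon> x) \<le> C * \<epsilon> powr b"
proof -
  have "\<exists>C. \<forall>i\<in>I. \<forall>\<^sub>F \<epsilon> in at_right 0. \<forall>x\<in>L. norm (g i \<epsilon> x) \<le> C i * \<epsilon> powr b"
    using assms(2) unfolding ubound_def by (rule bchoice[OF ballI])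
  then obtain C where "\<forall>i\<in>I. \<forall>\<^sub>F \<epsilon> in at_right 0. \<forall>x\<in>L. norm (g i \<epsilon> x) \<le> C i * \<epsilon> powr b" ..
  then have "\<forall>\<^sub>F \<epsilon> in at_right 0. \<forall>i\<in>I. \<forall>x\<in>L. norm (g i \<epsilon> x) \<le> C i * \<epsilon> powr b"
    by (rule eventually_ball_finite[OF assms(1)])
  then have "\<forall>\<^sub>F \<epsilon> in at_right 0. \<forall>i\<in>I. \<forall>x\<in>L. norm (g i \<epsilon> x) \<le> (\<Sum>i\<in>I. \<bar>C i\<bar>) * \<epsilon> powr b"
  proof eventually_elim
    case (elim \<epsilon>)
    have "C i * \<epsilon> powr b \<le> (\<Sum>i\<in>I. \<bar>C i\<bar>) * \<epsilon> powr b" if "i \<in> I" for i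
      using order.trans[OF abs_ge_self member_le_sum[of i I "\<lambda>i. \<bar>C i\<bar>"]] that assms(1)
      by (intro mult_right_mono) auto
    with elim show ?case by (meson order.trans)
  qed
  then show ?thesis ..
qed

text \<open>Boundedness puts every element below the real \<open>Sup\<close>, and the inserted
  \<open>0\<close> makes the \<open>Sup\<close> nonnegative, so the norm in the
  \<open>O\<close>-estimate is harmless.\<close>

lemma Sup_bigo_iff:
  fixes A :: "real \<Rightarrow> real set"
  assumes "\<And>\<epsilon>. \<epsilon> \<in> {0<..1} \<Longrightarrow> bdd_above (A \<epsilon>)"
  shows "(\<lambda>\<epsilon>. Sup (insert 0 (A \<epsilon>))) \<in> O[at_right 0](\<lambda>\<epsilon>. \<epsilon> powr b)
    \<longleftrightarrow> (\<exists>C. \<forall>\<^sub>F \<epsilon> in at_right 0. \<forall>a\<in>A \<epsilon>. a \<le> C * \<epsilon> powr b)"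
proof
  assume "(\<lambda>\<epsilon>. Sup (insert 0 (A \<epsilon>))) \<in> O[at_right 0](\<lambda>\<epsilon>. \<epsilon> powr b)"
  then obtain C where "\<forall>\<^sub>F \<epsilon> in at_right 0. norm (Sup (insert 0 (A \<epsilon>))) \<le> C * norm (\<epsilon> powr b)"
    by (elim landau_o.bigE)
  then have "\<forall>\<^sub>F \<epsilon> in at_right 0. \<forall>a\<in>A \<epsilon>. a \<le> C * \<epsilon> powr b"
    using eventually_at_right_0_1
  proof eventually_elim
    case (elim \<epsilon>)
    have "a \<le> Sup (insert 0 (A \<epsilon>))" if "a \<in> A \<epsilon>" for a
      using that assms[OF elim(2)] by (intro cSup_upper) auto
    with elim(1) show ?case by fastforce
  qed
  then show "\<exists>C. \<forall>\<^sub>F \<epsilon> in at_right 0. \<forall>a\<in>A \<epsilon>. a \<le> C * \<epsilon> powr b" ..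
next
  assume "\<exists>C. \<forall>\<^sub>F \<epsilon> in at_right 0. \<forall>a\<in>A \<epsilon>. a \<le> C * \<epsilon> powr b"
  then obtain C where C: "\<forall>\<^sub>F \<epsilon> in at_right 0. \<forall>a\<in>A \<epsilon>. a \<le> C * \<epsilon> powr b" ..
  show "(\<lambda>\<epsilon>. Sup (insert 0 (A \<epsilon>))) \<in> O[at_right 0](\<lambda>\<epsilon>. \<epsilon> powr b)"
  proof (rule bigoI[where c = "\<bar>C\<bar>"])
    show "\<forall>\<^sub>F \<epsilon> in at_right 0. norm (Sup (insert 0 (A \<epsilon>))) \<le> \<bar>C\<bar> * norm (\<epsilon> powr b)"
      using C eventually_at_right_0_1
    proof eventually_elim
      case (elim \<epsilon>)
      have "C * \<epsilon> powr b \<le> \<bar>C\<bar> * \<epsilon> powr b" by (intro mult_right_mono) auto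
      then have "Sup (insert 0 (A \<epsilon>)) \<le> \<bar>C\<bar> * \<epsilon> powr b"
        using elim(1) by (intro cSup_least) fastforce+
      moreover have "0 \<le> Sup (insert 0 (A \<epsilon>))"
        using assms[OF elim(2)] by (intro cSup_upper) auto
      ultimately show ?case by simp
    qed
  qed
qed

section \<open>Multi-indices versus words of directions\<close>

lemma ex_word: "\<exists>w. \<forall>i::'n::finite. count_list w i = \<alpha> i"
proof -
  obtain w where w: "mset w = (\<Sum>i\<in>UNIV. replicate_mset (\<alpha> i) i)"
    using ex_mset by blast
  have "count_list w i = count (mset w) i" for i
    by (induction w) auto
  then have "count_list w i = \<alpha> i" for i
    by (simp add: w count_sum if_distrib cong: if_cong)
  then show ?thesis by blast
qed

lemma multi_partial_eq_iter_partial: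
  fixes \<alpha> :: "'n::finite \<Rightarrow> nat"
  obtains w where "multi_partial \<alpha> = iter_partial w" "count_list w = \<alpha>" "length w = (\<Sum>i\<in>UNIV. \<alpha> i)"
proof -
  define w where "w = (SOME w. \<forall>i. count_list w i = \<alpha> i)"
  have "\<forall>i. count_list w i = \<alpha> i" unfolding w_def by (rule someI_ex[OF ex_word])
  then have "count_list w = \<alpha>" by blast
  moreover have "length w = (\<Sum>i\<in>UNIV. count_list w i)"
    by (rule sum_count_set[symmetric]) auto
  moreover have "multi_partial \<alpha> = iter_partial w" by (rule ext) (simp add: multi_partial_def w_def)
  ultimately show ?thesis using that by metis
qed

lemma iter_partial_eq_multi_partial:
  assumes "open \<Omega>" "smooth_on \<Omega> f" "x \<in> \<Omega>"
  shows "iter_partial w f x = multi_partial (count_list w) f x"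
proof -
  obtain v where v: "multi_partial (count_list w) = iter_partial v" "count_list v = count_list w"
    using multi_partial_eq_iter_partial by blast
  show ?thesis unfolding v(1) by (rule iter_partial_perm[OF assms]) (simp add: v(2))
qed

text \<open>
  Words instead of multi-indices: by \<open>iter_partial_eq_multi_partial\<close> this makes no difference, and
  the product rule preserves such bounds.
\<close>

definition net_bound :: "(real^'n::finite) set \<Rightarrow> nat \<Rightarrow> real \<Rightarrow> 'n net \<Rightarrow> bool" where
  "net_bound L j b f \<longleftrightarrow> (\<forall>w. length w \<le> j \<longrightarrow> ubound L b (\<lambda>\<epsilon>. iter_partial w (f \<epsilon>)))"

definition smooth_net :: "(real^'n::finite) set \<Rightarrow> 'n net \<Rightarrow> bool" where
  "smooth_net \<Omega> f \<longleftrightarrow> (\<forall>\<epsilon>\<in>{0<..1}. smooth_on \<Omega> (f \<epsilon>))"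

lemma smooth_netD: "smooth_net \<Omega> f \<Longrightarrow> \<epsilon> \<in> {0<..1} \<Longrightarrow> smooth_on \<Omega> (f \<epsilon>)"
  by (simp add: smooth_net_def)

lemma bdd_above_iter_partial:
  assumes "compact L" "L \<subseteq> \<Omega>" "smooth_on \<Omega> f"
  shows "bdd_above {norm (iter_partial w f x) | x. x \<in> L}"
proof -
  have "continuous_on L (\<lambda>x. norm (iter_partial w f x))"
    using smooth_on_continuous[OF assms(3)] assms(2) continuous_on_subset continuous_on_norm by blast
  then have "bounded ((\<lambda>x. norm (iter_partial w f x)) ` L)"
    using assms(1) compact_continuous_image compact_imp_bounded by blast
  then show ?thesis
    by (simp add: bounded_imp_bdd_above Setcompr_eq_image)
qed

lemma finite_words: "finite {w :: 'n::finite list. length w \<le> j}"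
  using finite_lists_length_le[of "UNIV :: 'n set" j] by simp

lemma ubound_iff_supnorm:
  assumes "compact L" "L \<subseteq> \<Omega>" "smooth_net \<Omega> f"
  shows "(\<lambda>\<epsilon>. supnorm L (iter_partial w (f \<epsilon>))) \<in> O[at_right 0](\<lambda>\<epsilon>. \<epsilon> powr b)
    \<longleftrightarrow> ubound L b (\<lambda>\<epsilon>. iter_partial w (f \<epsilon>))"
proof -
  have "(\<lambda>\<epsilon>. supnorm L (iter_partial w (f \<epsilon>))) \<in> O[at_right 0](\<lambda>\<epsilon>. \<epsilon> powr b)
    \<longleftrightarrow> (\<exists>C. \<forall>\<^sub>F \<epsilon> in at_right 0. \<forall>a\<in>{norm (iter_partial w (f \<epsilon>) x) | x. x \<in> L}. a \<le> C * \<epsilon> powr b)"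
    unfolding supnorm_def
    by (rule Sup_bigo_iff) (rule bdd_above_iter_partial[OF assms(1,2) smooth_netD[OF assms(3)]])
  also have "\<dots> \<longleftrightarrow> ubound L b (\<lambda>\<epsilon>. iter_partial w (f \<epsilon>))"
    unfolding ubound_def by (simp add: Setcompr_eq_image)
  finally show ?thesis .
qed

text \<open>A multi-index of order at most \<open>j\<close> is evaluated along some word of length
  at most \<open>j\<close>; conversely a word may be replaced by its letter count, by symmetry of
  the derivatives. Since there are finitely many such words, their constants merge into one.\<close>

lemma net_bound_iff_supnorm_upto:
  fixes \<Omega> :: "(real^'n::finite) set"
  assumes "open \<Omega>" "compact L" "L \<subseteq> \<Omega>" "smooth_net \<Omega> f"
  shows "(\<lambda>\<epsilon>. supnorm_upto L j (f \<epsilon>)) \<in> O[at_right 0](\<lambda>\<epsilon>. \<epsilon> powr b) \<longleftrightarrow> net_bound L j b f"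
proof -
  define S where "S = (\<lambda>\<epsilon>. {norm (multi_partial \<alpha> (f \<epsilon>) x) | x \<alpha>. x \<in> L \<and> (\<Sum>i\<in>UNIV. \<alpha> i) \<le> j})"
  have sub: "S \<epsilon> \<subseteq> (\<Union>w\<in>{w. length w \<le> j}. {norm (iter_partial w (f \<epsilon>) x) | x. x \<in> L})" for \<epsilon>
  proof
    fix a assume "a \<in> S \<epsilon>"
    then obtain x \<alpha> where a: "a = norm (multi_partial \<alpha> (f \<epsilon>) x)" "x \<in> L" "(\<Sum>i\<in>UNIV. \<alpha> i) \<le> j"
      unfolding S_def by blast
    obtain w where "multi_partial \<alpha> = iter_partial w" "length w = (\<Sum>i\<in>UNIV. \<alpha> i)"
      using multi_partial_eq_iter_partial by blast
    with a show "a \<in> (\<Union>w\<in>{w. length w \<le> j}. {norm (iter_partial w (f \<epsilon>) x) | x. x \<in> L})" by (intro UN_I[of w]) auto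
  qed
  have "bdd_above (S \<epsilon>)" if "\<epsilon> \<in> {0<..1}" for \<epsilon>
    by (rule bdd_above_mono[OF _ sub])
      (simp add: bdd_above_UN[OF finite_words] bdd_above_iter_partial[OF assms(2,3) smooth_netD[OF assms(4) that]])
  then have "(\<lambda>\<epsilon>. supnorm_upto L j (f \<epsilon>)) \<in> O[at_right 0](\<lambda>\<epsilon>. \<epsilon> powr b)
      \<longleftrightarrow> (\<exists>C. \<forall>\<^sub>F \<epsilon> in at_right 0. \<forall>a\<in>S \<epsilon>. a \<le> C * \<epsilon> powr b)"
    using Sup_bigo_iff[of S b] by (simp add: supnorm_upto_def S_def)
  also have "\<dots> \<longleftrightarrow> net_bound L j b f"
  proof
    assume "\<exists>C. \<forall>\<^sub>F \<epsilon> in at_right 0. \<forall>a\<in>S \<epsilon>. a \<le> C * \<epsilon> powr b"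
    then obtain C where C: "\<forall>\<^sub>F \<epsilon> in at_right 0. \<forall>a\<in>S \<epsilon>. a \<le> C * \<epsilon> powr b" ..
    show "net_bound L j b f"
      unfolding net_bound_def ubound_def
    proof (intro allI impI exI)
      fix w :: "'n list" assume w: "length w \<le> j"
      show "\<forall>\<^sub>F \<epsilon> in at_right 0. \<forall>x\<in>L. norm (iter_partial w (f \<epsilon>) x) \<le> C * \<epsilon> powr b"
        using C eventually_at_right_0_1
      proof eventually_elim
        case (elim \<epsilon>)
        have "norm (iter_partial w (f \<epsilon>) x) \<in> S \<epsilon>" if "x \<in> L" for x
        proof -
          have "(\<Sum>i\<in>UNIV. count_list w i) \<le> j" using w sum_count_set[of w UNIV] by simp
          moreover have "iter_partial w (f \<epsilon>) x = multi_partial (count_list w) (f \<epsilon>) x"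
            using iter_partial_eq_multi_partial[OF assms(1) smooth_netD[OF assms(4) elim(2)]] that assms(3) by blast
          ultimately show ?thesis unfolding S_def using that by auto
        qed
        with elim(1) show ?case by blast
      qed
    qed
  next
    assume "net_bound L j b f"
    then have "\<exists>C. \<forall>\<^sub>F \<epsilon> in at_right 0. \<forall>w\<in>{w. length w \<le> j}. \<forall>x\<in>L. norm (iter_partial w (f \<epsilon>) x) \<le> C * \<epsilon> powr b"
      by (intro ubound_finite[OF finite_words]) (simp add: net_bound_def)
    then obtain C where
      C: "\<forall>\<^sub>F \<epsilon> in at_right 0. \<forall>w\<in>{w. length w \<le> j}. \<forall>x\<in>L. norm (iter_partial w (f \<epsilon>) x) \<le> C * \<epsilon> powr b" ..
    have "\<forall>\<^sub>F \<epsilon> in at_right 0. \<forall>a\<in>S \<epsilon>. a \<le> C * \<epsilon> powr b"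
      using C by eventually_elim (use sub in fastforce)
    then show "\<exists>C. \<forall>\<^sub>F \<epsilon> in at_right 0. \<forall>a\<in>S \<epsilon>. a \<le> C * \<epsilon> powr b" ..
  qed
  finally show ?thesis .
qed

text \<open>Real exponents are more convenient than natural ones and cost nothing: an exponent may
  be rounded down because \<open>\<epsilon>\<close> is at most \<open>1\<close>. Words replace
  multi-indices by \<open>iter_partial_eq_multi_partial\<close>.\<close>

lemma EM_iff:
  fixes \<Omega> :: "(real^'n::finite) set"
  assumes "open \<Omega>"
  shows "f \<in> EM \<Omega> \<longleftrightarrow> smooth_net \<Omega> f \<and>
    (\<forall>L w. compact L \<and> L \<subseteq> \<Omega> \<longrightarrow> (\<exists>b. ubound L b (\<lambda>\<epsilon>. iter_partial w (f \<epsilon>))))"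
proof -
  have "(\<exists>N::nat. (\<lambda>\<epsilon>. supnorm L (iter_partial w (f \<epsilon>))) \<in> O[at_right 0](\<lambda>\<epsilon>. \<epsilon> powr (- real N)))
      \<longleftrightarrow> (\<exists>b. ubound L b (\<lambda>\<epsilon>. iter_partial w (f \<epsilon>)))"
    if "smooth_net \<Omega> f" "compact L" "L \<subseteq> \<Omega>" for L w
  proof -
    have "\<exists>N::nat. ubound L (- real N) (\<lambda>\<epsilon>. iter_partial w (f \<epsilon>))" if "ubound L b (\<lambda>\<epsilon>. iter_partial w (f \<epsilon>))" for b
      by (rule exI[of _ "nat \<lceil>- b\<rceil>"], rule ubound_mono[OF that]) linarith
    then show ?thesis unfolding ubound_iff_supnorm[OF that(2,3,1)] by blast
  qed
  note * = this
  show ?thesis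
  proof
    assume f: "f \<in> EM \<Omega>"
    then have s: "smooth_net \<Omega> f" unfolding EM_def smooth_net_def by blast
    moreover have "\<exists>b. ubound L b (\<lambda>\<epsilon>. iter_partial w (f \<epsilon>))" if L: "compact L" "L \<subseteq> \<Omega>" for L w
    proof -
      obtain N :: nat where "(\<lambda>\<epsilon>. supnorm L (multi_partial (count_list w) (f \<epsilon>))) \<in> O[at_right 0](\<lambda>\<epsilon>. \<epsilon> powr (- real N))"
        using f L unfolding EM_def by blast
      moreover obtain v where v: "multi_partial (count_list w) = iter_partial v"
        using multi_partial_eq_iter_partial by blast
      ultimately have "ubound L (- real N) (\<lambda>\<epsilon>. iter_partial v (f \<epsilon>))"
        using ubound_iff_supnorm[OF L s] by simp
      then have "ubound L (- real N) (\<lambda>\<epsilon>. iter_partial w (f \<epsilon>))"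
        by (rule ubound_cong) (use iter_partial_eq_multi_partial[OF assms smooth_netD[OF s]] v L in auto)
      then show ?thesis ..
    qed
    ultimately show "smooth_net \<Omega> f \<and>
        (\<forall>L w. compact L \<and> L \<subseteq> \<Omega> \<longrightarrow> (\<exists>b. ubound L b (\<lambda>\<epsilon>. iter_partial w (f \<epsilon>))))" by simp
  next
    assume a: "smooth_net \<Omega> f \<and>
        (\<forall>L w. compact L \<and> L \<subseteq> \<Omega> \<longrightarrow> (\<exists>b. ubound L b (\<lambda>\<epsilon>. iter_partial w (f \<epsilon>))))"
    have "\<exists>N::nat. (\<lambda>\<epsilon>. supnorm L (multi_partial \<alpha> (f \<epsilon>))) \<in> O[at_right 0](\<lambda>\<epsilon>. \<epsilon> powr (- real N))"
      if L: "compact L" "L \<subseteq> \<Omega>" for L \<alpha>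
    proof -
      obtain v where v: "multi_partial \<alpha> = iter_partial v"
        using multi_partial_eq_iter_partial by blast
      show ?thesis unfolding v using *[of L v] a L by simp
    qed
    with a show "f \<in> EM \<Omega>" unfolding EM_def smooth_net_def by simp
  qed
qed

lemma Neg_iff:
  fixes \<Omega> :: "(real^'n::finite) set"
  assumes "open \<Omega>"
  shows "f \<in> Neg \<Omega> \<longleftrightarrow> smooth_net \<Omega> f \<and>
    (\<forall>L w b. compact L \<and> L \<subseteq> \<Omega> \<longrightarrow> ubound L b (\<lambda>\<epsilon>. iter_partial w (f \<epsilon>)))"
proof
  assume f: "f \<in> Neg \<Omega>"
  then have s: "smooth_net \<Omega> f" unfolding Neg_def smooth_net_def by blast
  moreover have "ubound L b (\<lambda>\<epsilon>. iter_partial w (f \<epsilon>))" if L: "compact L" "L \<subseteq> \<Omega>" for L w b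
  proof -
    obtain v where v: "multi_partial (count_list w) = iter_partial v"
      using multi_partial_eq_iter_partial by blast
    have "(\<lambda>\<epsilon>. supnorm L (multi_partial (count_list w) (f \<epsilon>))) \<in> O[at_right 0](\<lambda>\<epsilon>. \<epsilon> powr (real (nat \<lceil>b\<rceil>)))"
      using f L unfolding Neg_def by blast
    then have "ubound L (real (nat \<lceil>b\<rceil>)) (\<lambda>\<epsilon>. iter_partial v (f \<epsilon>))"
      using ubound_iff_supnorm[OF L s] v by simp
    then have "ubound L (real (nat \<lceil>b\<rceil>)) (\<lambda>\<epsilon>. iter_partial w (f \<epsilon>))"
      by (rule ubound_cong) (use iter_partial_eq_multi_partial[OF assms smooth_netD[OF s]] v L in auto)
    then show ?thesis by (rule ubound_mono) linarith
  qed
  ultimately show "smooth_net \<Omega> f \<and>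
      (\<forall>L w b. compact L \<and> L \<subseteq> \<Omega> \<longrightarrow> ubound L b (\<lambda>\<epsilon>. iter_partial w (f \<epsilon>)))" by simp
next
  assume a: "smooth_net \<Omega> f \<and>
      (\<forall>L w b. compact L \<and> L \<subseteq> \<Omega> \<longrightarrow> ubound L b (\<lambda>\<epsilon>. iter_partial w (f \<epsilon>)))"
  have "(\<lambda>\<epsilon>. supnorm L (multi_partial \<alpha> (f \<epsilon>))) \<in> O[at_right 0](\<lambda>\<epsilon>. \<epsilon> powr (real q))"
    if L: "compact L" "L \<subseteq> \<Omega>" for L \<alpha> q
  proof -
    obtain v where v: "multi_partial \<alpha> = iter_partial v"
      using multi_partial_eq_iter_partial by blast
    show ?thesis unfolding v using ubound_iff_supnorm[OF L] a L by simp
  qed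
  with a show "f \<in> Neg \<Omega>" unfolding Neg_def smooth_net_def by simp
qed

section \<open>Stability of the bounds under sums, multiples and products\<close>

lemma smooth_net_iff: "open \<Omega> \<Longrightarrow> smooth_net \<Omega> f \<longleftrightarrow>
    (\<forall>\<epsilon>\<in>{0<..1}. \<forall>w. \<forall>x\<in>\<Omega>. iter_partial w (f \<epsilon>) differentiable at x)"
  by (simp add: smooth_net_def smooth_on_def differentiable_on_eq_differentiable_at)

lemma smooth_net_add: "open \<Omega> \<Longrightarrow> smooth_net \<Omega> f \<Longrightarrow> smooth_net \<Omega> g \<Longrightarrow> smooth_net \<Omega> (\<lambda>\<epsilon> x. f \<epsilon> x + g \<epsilon> x)"
  and smooth_net_diff: "open \<Omega> \<Longrightarrow> smooth_net \<Omega> f \<Longrightarrow> smooth_net \<Omega> g \<Longrightarrow> smooth_net \<Omega> (\<lambda>\<epsilon> x. f \<epsilon> x - g \<epsilon> x)"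
  and smooth_net_cmult: "open \<Omega> \<Longrightarrow> smooth_net \<Omega> f \<Longrightarrow> smooth_net \<Omega> (\<lambda>\<epsilon> x. z \<epsilon> * f \<epsilon> x)"
  and smooth_net_mult: "open \<Omega> \<Longrightarrow> smooth_on \<Omega> \<psi> \<Longrightarrow> smooth_net \<Omega> f \<Longrightarrow> smooth_net \<Omega> (\<lambda>\<epsilon> x. \<psi> x * f \<epsilon> x)"
  by (simp_all add: smooth_net_def smooth_on_add smooth_on_diff smooth_on_mult smooth_on_const)

lemma smooth_net_subset: "smooth_net \<Omega> f \<Longrightarrow> V \<subseteq> \<Omega> \<Longrightarrow> smooth_net V f"
  unfolding smooth_net_def by (auto intro: smooth_on_subset)

lemma ubound_iter_partial_add:
  assumes "open \<Omega>" "L \<subseteq> \<Omega>" "smooth_net \<Omega> f" "smooth_net \<Omega> g"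
    and "ubound L b (\<lambda>\<epsilon>. iter_partial w (f \<epsilon>))" "ubound L b (\<lambda>\<epsilon>. iter_partial w (g \<epsilon>))"
  shows "ubound L b (\<lambda>\<epsilon>. iter_partial w (\<lambda>x. f \<epsilon> x + g \<epsilon> x))"
  by (rule ubound_cong[OF ubound_add[OF assms(5,6)]])
    (rule iter_partial_add[OF assms(1) subsetD[OF assms(2)] smooth_netD[OF assms(3)] smooth_netD[OF assms(4)]])

lemma ubound_iter_partial_cmult:
  assumes "open \<Omega>" "L \<subseteq> \<Omega>" "smooth_net \<Omega> f"
    and "ubound L b (\<lambda>\<epsilon>. iter_partial w (f \<epsilon>))" "(\<lambda>\<epsilon>. norm (z \<epsilon>)) \<in> O[at_right 0](\<lambda>\<epsilon>. \<epsilon> powr a)"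
  shows "ubound L (a + b) (\<lambda>\<epsilon>. iter_partial w (\<lambda>x. z \<epsilon> * f \<epsilon> x))"
  by (rule ubound_cong[OF ubound_mult_net[OF assms(5,4)]])
    (rule iter_partial_cmult[OF assms(1) subsetD[OF assms(2)] smooth_netD[OF assms(3)]])

lemma bounded_on_compact_smooth:
  assumes "smooth_on \<Omega> \<psi>" "compact L" "L \<subseteq> \<Omega>"
  obtains B where "\<And>x. x \<in> L \<Longrightarrow> norm (\<psi> x) \<le> B"
proof -
  have "continuous_on L \<psi>"
    using continuous_on_subset[OF smooth_on_continuous[OF assms(1), of "[]"] assms(3)] by simp
  then have "bounded (\<psi> ` L)"
    using assms(2) compact_continuous_image compact_imp_bounded by blast
  then show ?thesis using that unfolding bounded_iff by blast
qed

text \<open>Splitting off the innermost derivative avoids the expansion of the iterated product rule.\<close>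

lemma ubound_iter_partial_mult:
  assumes \<Omega>: "open \<Omega>" and L: "compact L" "L \<subseteq> \<Omega>"
    and "smooth_on \<Omega> \<psi>" "smooth_net \<Omega> f"
    and "\<And>v. length v \<le> length w \<Longrightarrow> ubound L b (\<lambda>\<epsilon>. iter_partial v (f \<epsilon>))"
  shows "ubound L b (\<lambda>\<epsilon>. iter_partial w (\<lambda>x. \<psi> x * f \<epsilon> x))"
  using assms(4-)
\<comment> \<open>Both factors must be arbitrary: the product rule leaves two products, each with
  one factor differentiated, and the shorter word is applied to both.\<close>
proof (induction w arbitrary: \<psi> f rule: rev_induct)
  case Nil
  obtain B where "\<And>x. x \<in> L \<Longrightarrow> norm (\<psi> x) \<le> B"
    using bounded_on_compact_smooth[OF Nil(1) L] by blast
  then show ?case using ubound_mult_bounded[of L b f \<psi> B] Nil(3)[of "[]"] by simp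
next
  case (snoc i w)
  note sd = smooth_on_partial_deriv
  let ?f' = "\<lambda>\<epsilon>. partial_deriv i (f \<epsilon>)"
  have f': "smooth_net \<Omega> ?f'" using snoc.prems(2) by (simp add: smooth_net_def sd)
  have eq: "iter_partial (v @ [i]) g = iter_partial v (partial_deriv i g)" for v g
    by (simp add: iter_partial_append iter_partial_Cons)
  have 1: "ubound L b (\<lambda>\<epsilon>. iter_partial w (\<lambda>x. partial_deriv i \<psi> x * f \<epsilon> x))"
    by (rule snoc.IH[OF sd[OF snoc.prems(1)] snoc.prems(2)]) (rule snoc.prems(3), simp)
  have 2: "ubound L b (\<lambda>\<epsilon>. iter_partial w (\<lambda>x. \<psi> x * ?f' \<epsilon> x))"
  proof (rule snoc.IH[OF snoc.prems(1) f'])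
    fix v assume "length (v :: 'a list) \<le> length w"
    then show "ubound L b (\<lambda>\<epsilon>. iter_partial v (?f' \<epsilon>))"
      using snoc.prems(3)[of "v @ [i]"] by (simp add: eq)
  qed
  have "ubound L b (\<lambda>\<epsilon>. iter_partial w (\<lambda>x. partial_deriv i \<psi> x * f \<epsilon> x + \<psi> x * ?f' \<epsilon> x))"
    by (rule ubound_iter_partial_add[OF \<Omega> L(2) _ _ 1 2])
      (intro smooth_net_mult[OF \<Omega>] sd snoc.prems(1,2) f')+
  then show ?case
  proof (rule ubound_cong)
    fix \<epsilon> :: real and x assume \<epsilon>: "\<epsilon> \<in> {0<..1}" and x: "x \<in> L"
    have "partial_deriv i (\<lambda>x. \<psi> x * f \<epsilon> x) y = partial_deriv i \<psi> y * f \<epsilon> y + \<psi> y * ?f' \<epsilon> y" if "y \<in> \<Omega>" for y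
      by (rule partial_deriv_mult) (rule smooth_on_differentiable'[OF _ \<Omega> that], rule snoc.prems(1) smooth_netD[OF snoc.prems(2) \<epsilon>])+
    then show "iter_partial (w @ [i]) (\<lambda>x. \<psi> x * f \<epsilon> x) x
        = iter_partial w (\<lambda>x. partial_deriv i \<psi> x * f \<epsilon> x + \<psi> x * ?f' \<epsilon> x) x"
      unfolding eq using L(2) x by (intro iter_partial_cong[OF \<Omega>]) auto
  qed
qed

lemma net_boundD: "net_bound L j b f \<Longrightarrow> length w \<le> j \<Longrightarrow> ubound L b (\<lambda>\<epsilon>. iter_partial w (f \<epsilon>))"
  by (simp add: net_bound_def)

lemma net_bound_mono: "net_bound L j b f \<Longrightarrow> a \<le> b \<Longrightarrow> net_bound L j a f"
  unfolding net_bound_def by (intro allI impI) (rule ubound_mono, auto)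

lemma net_bound_subset: "net_bound L j b f \<Longrightarrow> M \<subseteq> L \<Longrightarrow> i \<le> j \<Longrightarrow> net_bound M i b f"
  unfolding net_bound_def by (intro allI impI) (rule ubound_subset, auto)

lemma net_bound_Un: "net_bound L j b f \<Longrightarrow> net_bound M j b f \<Longrightarrow> net_bound (L \<union> M) j b f"
  unfolding net_bound_def by (simp add: ubound_Un)

lemma net_bound_add:
  assumes "open \<Omega>" "L \<subseteq> \<Omega>" "smooth_net \<Omega> f" "smooth_net \<Omega> g" "net_bound L j b f" "net_bound L j b g"
  shows "net_bound L j b (\<lambda>\<epsilon> x. f \<epsilon> x + g \<epsilon> x)"
  using assms(5,6) unfolding net_bound_def by (simp add: ubound_iter_partial_add[OF assms(1-4)])

lemma net_bound_mult:
  assumes "open \<Omega>" "compact L" "L \<subseteq> \<Omega>" "smooth_on \<Omega> \<psi>" "smooth_net \<Omega> f" "net_bound L j b f"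
  shows "net_bound L j b (\<lambda>\<epsilon> x. \<psi> x * f \<epsilon> x)"
  unfolding net_bound_def
proof (intro allI impI)
  fix w :: "'a list" assume "length w \<le> j"
  then show "ubound L b (\<lambda>\<epsilon>. iter_partial w (\<lambda>x. \<psi> x * f \<epsilon> x))"
    by (intro ubound_iter_partial_mult[OF assms(1-5)] net_boundD[OF assms(6)]) simp
qed

lemma net_bound_vanishing:
  assumes "open W" "L \<subseteq> W" "\<And>\<epsilon> x. \<epsilon> \<in> {0<..1} \<Longrightarrow> x \<in> W \<Longrightarrow> f \<epsilon> x = 0"
  shows "net_bound L j b f"
  unfolding net_bound_def
proof (intro allI impI)
  fix w :: "'a list"
  show "ubound L b (\<lambda>\<epsilon>. iter_partial w (f \<epsilon>))"
  proof (rule ubound_cong[OF ubound_zero])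
    fix \<epsilon> :: real and x assume "\<epsilon> \<in> {0<..1}" "x \<in> L"
    then have "iter_partial w (f \<epsilon>) x = iter_partial w (\<lambda>x. 0) x"
      using assms by (intro iter_partial_cong[OF assms(1)]) auto
    then show "iter_partial w (f \<epsilon>) x = 0" by (simp add: iter_partial_zero)
  qed
qed

lemma EM_smooth: "f \<in> EM \<Omega> \<Longrightarrow> smooth_net \<Omega> f"
  and Neg_smooth: "f \<in> Neg \<Omega> \<Longrightarrow> smooth_net \<Omega> f"
  by (auto simp: EM_def Neg_def smooth_net_def)

lemma Neg_iff_net_bound:
  assumes "open \<Omega>"
  shows "f \<in> Neg \<Omega> \<longleftrightarrow> smooth_net \<Omega> f \<and> (\<forall>L j b. compact L \<and> L \<subseteq> \<Omega> \<longrightarrow> net_bound L j b f)"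
proof
  assume "f \<in> Neg \<Omega>"
  then show "smooth_net \<Omega> f \<and> (\<forall>L j b. compact L \<and> L \<subseteq> \<Omega> \<longrightarrow> net_bound L j b f)"
    unfolding Neg_iff[OF assms] net_bound_def by simp
next
  assume a: "smooth_net \<Omega> f \<and> (\<forall>L j b. compact L \<and> L \<subseteq> \<Omega> \<longrightarrow> net_bound L j b f)"
  then have "ubound L b (\<lambda>\<epsilon>. iter_partial w (f \<epsilon>))" if "compact L \<and> L \<subseteq> \<Omega>" for L w b
    by (intro net_boundD[OF _ order.refl]) (simp add: that)
  with a show "f \<in> Neg \<Omega>" unfolding Neg_iff[OF assms] by simp
qed

lemma EM_net_bound:
  fixes f :: "'n::finite net"
  assumes "open \<Omega>" "f \<in> EM \<Omega>" "compact L" "L \<subseteq> \<Omega>"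
  shows "\<exists>b. net_bound L j b f"
proof -
  have "\<exists>b. \<forall>w\<in>W. ubound L b (\<lambda>\<epsilon>. iter_partial w (f \<epsilon>))" if "finite W" for W
    using that
  proof (induction W)
    case (insert w W)
    then obtain b where b: "\<forall>w\<in>W. ubound L b (\<lambda>\<epsilon>. iter_partial w (f \<epsilon>))" by blast
    obtain a where a: "ubound L a (\<lambda>\<epsilon>. iter_partial w (f \<epsilon>))"
      using EM_iff[OF assms(1)] assms(2-) by blast
    have "ubound L (min a b) (\<lambda>\<epsilon>. iter_partial v (f \<epsilon>))" if "v \<in> insert w W" for v
    proof (cases "v = w")
      case True
      then show ?thesis using ubound_mono[OF a] by simp
    next
      case False
      then show ?thesis using that b ubound_mono[of L b _ "min a b"] by simp
    qed
    then show ?case by blast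
  qed simp
  from this[OF finite_words[where j = j]] show ?thesis unfolding net_bound_def by simp
qed

section \<open>Moderate and negligible nets: module operations, restriction, gluing\<close>

lemma Neg_imp_EM: "open \<Omega> \<Longrightarrow> f \<in> Neg \<Omega> \<Longrightarrow> f \<in> EM \<Omega>"
  unfolding EM_iff Neg_iff by simp

lemma EM_subset:
  assumes "open \<Omega>" "open V" "V \<subseteq> \<Omega>" "f \<in> EM \<Omega>"
  shows "f \<in> EM V"
proof -
  have "\<exists>b. ubound L b (\<lambda>\<epsilon>. iter_partial w (f \<epsilon>))" if "compact L \<and> L \<subseteq> V" for L w
    using assms(4) that order.trans[OF conjunct2[OF that] assms(3)] unfolding EM_iff[OF assms(1)] by simp
  moreover have "smooth_net V f"
    by (rule smooth_net_subset[OF EM_smooth[OF assms(4)] assms(3)])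
  ultimately show ?thesis unfolding EM_iff[OF assms(2)] by simp
qed

lemma Neg_subset:
  assumes "open \<Omega>" "open V" "V \<subseteq> \<Omega>" "f \<in> Neg \<Omega>"
  shows "f \<in> Neg V"
proof -
  have "ubound L b (\<lambda>\<epsilon>. iter_partial w (f \<epsilon>))" if "compact L \<and> L \<subseteq> V" for L w b
    using assms(4) that order.trans[OF conjunct2[OF that] assms(3)] unfolding Neg_iff[OF assms(1)] by simp
  moreover have "smooth_net V f"
    by (rule smooth_net_subset[OF Neg_smooth[OF assms(4)] assms(3)])
  ultimately show ?thesis unfolding Neg_iff[OF assms(2)] by simp
qed

lemma Neg_add:
  assumes "open \<Omega>" "f \<in> Neg \<Omega>" "g \<in> Neg \<Omega>"
  shows "(\<lambda>\<epsilon> x. f \<epsilon> x + g \<epsilon> x) \<in> Neg \<Omega>"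
proof -
  have "net_bound L j b (\<lambda>\<epsilon> x. f \<epsilon> x + g \<epsilon> x)" if "compact L \<and> L \<subseteq> \<Omega>" for L j b
    using assms(2,3) that unfolding Neg_iff_net_bound[OF assms(1)]
    by (intro net_bound_add[OF assms(1)]) simp_all
  moreover have "smooth_net \<Omega> (\<lambda>\<epsilon> x. f \<epsilon> x + g \<epsilon> x)"
    by (intro smooth_net_add Neg_smooth assms)
  ultimately show ?thesis unfolding Neg_iff_net_bound[OF assms(1)] by simp
qed

lemma EM_add:
  assumes "open \<Omega>" "f \<in> EM \<Omega>" "g \<in> EM \<Omega>"
  shows "(\<lambda>\<epsilon> x. f \<epsilon> x + g \<epsilon> x) \<in> EM \<Omega>"
  unfolding EM_iff[OF assms(1)]
proof (intro conjI allI impI)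
  show "smooth_net \<Omega> (\<lambda>\<epsilon> x. f \<epsilon> x + g \<epsilon> x)"
    by (intro smooth_net_add EM_smooth assms)
  fix L w assume L: "compact L \<and> L \<subseteq> \<Omega>"
  obtain a where a: "ubound L a (\<lambda>\<epsilon>. iter_partial w (f \<epsilon>))"
    using assms(2) L EM_iff[OF assms(1)] by blast
  obtain b where b: "ubound L b (\<lambda>\<epsilon>. iter_partial w (g \<epsilon>))"
    using assms(3) L EM_iff[OF assms(1)] by blast
  have "ubound L (min a b) (\<lambda>\<epsilon>. iter_partial w (\<lambda>x. f \<epsilon> x + g \<epsilon> x))"
    using L by (intro ubound_iter_partial_add[OF assms(1)] EM_smooth assms(2,3) ubound_mono[OF a] ubound_mono[OF b]) auto
  then show "\<exists>b. ubound L b (\<lambda>\<epsilon>. iter_partial w (\<lambda>x. f \<epsilon> x + g \<epsilon> x))" ..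
qed

lemma EM_cmult:
  assumes "open \<Omega>" "f \<in> EM \<Omega>" "moderate z"
  shows "(\<lambda>\<epsilon> x. z \<epsilon> * f \<epsilon> x) \<in> EM \<Omega>"
  unfolding EM_iff[OF assms(1)]
proof (intro conjI allI impI)
  show "smooth_net \<Omega> (\<lambda>\<epsilon> x. z \<epsilon> * f \<epsilon> x)"
    by (intro smooth_net_cmult EM_smooth assms)
  fix L w assume L: "compact L \<and> L \<subseteq> \<Omega>"
  obtain b where b: "ubound L b (\<lambda>\<epsilon>. iter_partial w (f \<epsilon>))"
    using assms(2) L EM_iff[OF assms(1)] by blast
  show "\<exists>b. ubound L b (\<lambda>\<epsilon>. iter_partial w (\<lambda>x. z \<epsilon> * f \<epsilon> x))"
    using assms(3) ubound_iter_partial_cmult[OF assms(1) conjunct2[OF L] EM_smooth[OF assms(2)] b]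
    unfolding moderate_def by blast
qed

lemma Neg_cmult:
  assumes "open \<Omega>" "f \<in> Neg \<Omega>" "moderate z"
  shows "(\<lambda>\<epsilon> x. z \<epsilon> * f \<epsilon> x) \<in> Neg \<Omega>"
  unfolding Neg_iff[OF assms(1)]
proof (intro conjI allI impI)
  show "smooth_net \<Omega> (\<lambda>\<epsilon> x. z \<epsilon> * f \<epsilon> x)"
    by (intro smooth_net_cmult Neg_smooth assms)
  fix L w b assume L: "compact L \<and> L \<subseteq> \<Omega>"
  obtain N where N: "(\<lambda>\<epsilon>. norm (z \<epsilon>)) \<in> O[at_right 0](\<lambda>\<epsilon>. \<epsilon> powr (- real N))"
    using assms(3) unfolding moderate_def by blast
  have "ubound L (b + real N) (\<lambda>\<epsilon>. iter_partial w (f \<epsilon>))"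
    using assms(2) L Neg_iff[OF assms(1)] by blast
  from ubound_iter_partial_cmult[OF assms(1) conjunct2[OF L] Neg_smooth[OF assms(2)] this N]
  show "ubound L b (\<lambda>\<epsilon>. iter_partial w (\<lambda>x. z \<epsilon> * f \<epsilon> x))" by simp
qed

lemma EM_uminus: "open \<Omega> \<Longrightarrow> f \<in> EM \<Omega> \<Longrightarrow> (\<lambda>\<epsilon> x. - f \<epsilon> x) \<in> EM \<Omega>"
  using EM_cmult[of \<Omega> f "\<lambda>_. -1"] by (simp add: moderate_const)

lemma Neg_uminus: "open \<Omega> \<Longrightarrow> f \<in> Neg \<Omega> \<Longrightarrow> (\<lambda>\<epsilon> x. - f \<epsilon> x) \<in> Neg \<Omega>"
  using Neg_cmult[of \<Omega> f "\<lambda>_. -1"] by (simp add: moderate_const)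

lemma EM_diff: "open \<Omega> \<Longrightarrow> f \<in> EM \<Omega> \<Longrightarrow> g \<in> EM \<Omega> \<Longrightarrow> (\<lambda>\<epsilon> x. f \<epsilon> x - g \<epsilon> x) \<in> EM \<Omega>"
  using EM_add[of \<Omega> f "\<lambda>\<epsilon> x. - g \<epsilon> x"] by (simp add: EM_uminus)

lemma Neg_diff: "open \<Omega> \<Longrightarrow> f \<in> Neg \<Omega> \<Longrightarrow> g \<in> Neg \<Omega> \<Longrightarrow> (\<lambda>\<epsilon> x. f \<epsilon> x - g \<epsilon> x) \<in> Neg \<Omega>"
  using Neg_add[of \<Omega> f "\<lambda>\<epsilon> x. - g \<epsilon> x"] by (simp add: Neg_uminus)

lemma Neg_mult:
  assumes "open \<Omega>" "f \<in> Neg \<Omega>" "smooth_on \<Omega> \<psi>"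
  shows "(\<lambda>\<epsilon> x. \<psi> x * f \<epsilon> x) \<in> Neg \<Omega>"
proof -
  have "net_bound L j b (\<lambda>\<epsilon> x. \<psi> x * f \<epsilon> x)" if "compact L \<and> L \<subseteq> \<Omega>" for L j b
    using assms(2) that unfolding Neg_iff_net_bound[OF assms(1)]
    by (intro net_bound_mult[OF assms(1) _ _ assms(3)]) simp_all
  moreover have "smooth_net \<Omega> (\<lambda>\<epsilon> x. \<psi> x * f \<epsilon> x)"
    by (intro smooth_net_mult Neg_smooth assms)
  ultimately show ?thesis unfolding Neg_iff_net_bound[OF assms(1)] by simp
qed

lemma EM_mult:
  assumes "open \<Omega>" "f \<in> EM \<Omega>" "smooth_on \<Omega> \<psi>"
  shows "(\<lambda>\<epsilon> x. \<psi> x * f \<epsilon> x) \<in> EM \<Omega>"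
  unfolding EM_iff[OF assms(1)]
proof (intro conjI allI impI)
  show "smooth_net \<Omega> (\<lambda>\<epsilon> x. \<psi> x * f \<epsilon> x)"
    by (intro smooth_net_mult EM_smooth assms)
  fix L and w :: "'a list" assume L: "compact L \<and> L \<subseteq> \<Omega>"
  obtain b where "net_bound L (length w) b f"
    using EM_net_bound[OF assms(1,2), of L "length w"] L by blast
  then have "net_bound L (length w) b (\<lambda>\<epsilon> x. \<psi> x * f \<epsilon> x)"
    using net_bound_mult[OF assms(1) _ _ assms(3) EM_smooth[OF assms(2)]] L by blast
  then show "\<exists>b. ubound L b (\<lambda>\<epsilon>. iter_partial w (\<lambda>x. \<psi> x * f \<epsilon> x))"
    using net_boundD by blast
qed

lemma Neg_zero: "open \<Omega> \<Longrightarrow> (\<lambda>\<epsilon> x. 0) \<in> Neg \<Omega>"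
  by (simp add: Neg_iff smooth_net_def smooth_on_const iter_partial_zero ubound_zero)

lemma Neg_vanishing:
  assumes "open W" "\<And>\<epsilon> x. \<epsilon> \<in> {0<..1} \<Longrightarrow> x \<in> W \<Longrightarrow> f \<epsilon> x = 0"
  shows "f \<in> Neg W"
  unfolding Neg_iff_net_bound[OF assms(1)]
proof (intro conjI allI impI)
  show "smooth_net W f"
    unfolding smooth_net_def
  proof
    fix \<epsilon> :: real assume "\<epsilon> \<in> {0<..1}"
    then show "smooth_on W (f \<epsilon>)"
      using smooth_on_cong[OF assms(1), of "f \<epsilon>" "\<lambda>x. 0"] assms by (simp add: smooth_on_const)
  qed
  show "net_bound L j b f" if "compact L \<and> L \<subseteq> W" for L j b
    by (rule net_bound_vanishing[OF assms(1) conjunct2[OF that] assms(2)])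
qed

text \<open>The gluing property that makes supports meaningful. A compact \<open>L\<close> is
  covered by finitely many balls whose closures lie in the given neighbourhoods, and finitely many
  estimates combine into one.\<close>

lemma Neg_local:
  assumes "open W" "\<And>x. x \<in> W \<Longrightarrow> \<exists>V. open V \<and> x \<in> V \<and> f \<in> Neg V"
  shows "f \<in> Neg W"
  unfolding Neg_iff[OF assms(1)]
proof (intro conjI allI impI)
  have "iter_partial w (f \<epsilon>) differentiable at x" if "\<epsilon> \<in> {0<..1}" "x \<in> W" for \<epsilon> w x
  proof -
    from assms(2)[OF that(2)] obtain V where V: "open V" "x \<in> V" "f \<in> Neg V" by blast
    show ?thesis
      by (rule smooth_on_differentiable[OF smooth_netD[OF Neg_smooth[OF V(3)] that(1)] V(1,2)])
  qed
  then show "smooth_net W f" by (simp add: smooth_net_iff[OF assms(1)])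
  fix L w b assume L: "compact L \<and> L \<subseteq> W"
  define D where "D = {U. open U \<and> ubound U b (\<lambda>\<epsilon>. iter_partial w (f \<epsilon>))}"
  have "L \<subseteq> \<Union>D"
  proof
    fix x assume "x \<in> L"
    then obtain V where V: "open V" "x \<in> V" "f \<in> Neg V" using assms(2) L by blast
    \<comment> \<open>The closed ball is compact and so carries the estimate, whereas the open ball
      serves for the covering.\<close>
    obtain r where r: "r > 0" "cball x r \<subseteq> V" using V open_contains_cball by blast
    have "ubound (cball x r) b (\<lambda>\<epsilon>. iter_partial w (f \<epsilon>))"
      using V r(2) Neg_iff[OF V(1)] by simp
    from ubound_subset[OF this ball_subset_cball] have "ball x r \<in> D" unfolding D_def by simp
    then show "x \<in> \<Union>D" using r(1) by (intro UnionI[of "ball x r"]) simp_all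
  qed
  then obtain F where F: "F \<subseteq> D" "finite F" "L \<subseteq> \<Union>F"
    by (rule compactE[OF conjunct1[OF L]]) (simp add: D_def, rule that)
  have "ubound (\<Union>F) b (\<lambda>\<epsilon>. iter_partial w (f \<epsilon>))"
    by (rule ubound_Union[OF F(2)]) (use F(1) D_def in auto)
  then show "ubound L b (\<lambda>\<epsilon>. iter_partial w (f \<epsilon>))"
    by (rule ubound_subset[OF _ F(3)])
qed

section \<open>Generalized functions\<close>

lemma Gclass_iff: "g \<in> Gclass \<Omega> f \<longleftrightarrow> f \<in> EM \<Omega> \<and> g \<in> EM \<Omega> \<and> (\<lambda>\<epsilon> x. f \<epsilon> x - g \<epsilon> x) \<in> Neg \<Omega>"
  by (simp add: Gclass_def Grel_def)

lemma Gclass_self: "open \<Omega> \<Longrightarrow> f \<in> EM \<Omega> \<Longrightarrow> f \<in> Gclass \<Omega> f"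
  by (simp add: Gclass_iff Neg_zero)

lemma Gclass_eq_iff:
  assumes "open \<Omega>" "f \<in> EM \<Omega>" "g \<in> EM \<Omega>"
  shows "Gclass \<Omega> f = Gclass \<Omega> g \<longleftrightarrow> (\<lambda>\<epsilon> x. f \<epsilon> x - g \<epsilon> x) \<in> Neg \<Omega>"
proof
  assume "Gclass \<Omega> f = Gclass \<Omega> g"
  then have "g \<in> Gclass \<Omega> f" using Gclass_self[OF assms(1,3)] by simp
  then show "(\<lambda>\<epsilon> x. f \<epsilon> x - g \<epsilon> x) \<in> Neg \<Omega>" by (simp add: Gclass_iff)
next
  assume fg: "(\<lambda>\<epsilon> x. f \<epsilon> x - g \<epsilon> x) \<in> Neg \<Omega>"
  have "h \<in> Gclass \<Omega> f \<longleftrightarrow> h \<in> Gclass \<Omega> g" for h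
    using Neg_diff[OF assms(1) _ fg, of "\<lambda>\<epsilon> x. f \<epsilon> x - h \<epsilon> x"]
      Neg_add[OF assms(1) fg, of "\<lambda>\<epsilon> x. g \<epsilon> x - h \<epsilon> x"] assms(2,3)
    by (auto simp: Gclass_iff)
  then show "Gclass \<Omega> f = Gclass \<Omega> g" by blast
qed

lemma G_iff: "u \<in> G \<Omega> \<longleftrightarrow> (\<exists>f\<in>EM \<Omega>. u = Gclass \<Omega> f)"
  unfolding G_def Gclass_def quotient_def by blast

lemma Gclass_in_G: "f \<in> EM \<Omega> \<Longrightarrow> Gclass \<Omega> f \<in> G \<Omega>"
  unfolding G_iff by blast

lemma UN_Gclass_eq:
  assumes "open \<Omega>" "f \<in> EM \<Omega>" "\<And>f'. f' \<in> Gclass \<Omega> f \<Longrightarrow> F f' = F f"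
  shows "(\<Union>f'\<in>Gclass \<Omega> f. F f') = F f"
  using Gclass_self[OF assms(1,2)] assms(3) by blast

lemma Gadd_Gclass:
  assumes "open \<Omega>" "f \<in> EM \<Omega>" "g \<in> EM \<Omega>"
  shows "Gadd \<Omega> (Gclass \<Omega> f) (Gclass \<Omega> g) = Gclass \<Omega> (\<lambda>\<epsilon> x. f \<epsilon> x + g \<epsilon> x)"
proof -
  have *: "Gclass \<Omega> (\<lambda>\<epsilon> x. f' \<epsilon> x + g' \<epsilon> x) = Gclass \<Omega> (\<lambda>\<epsilon> x. f \<epsilon> x + g \<epsilon> x)"
    if "f' \<in> Gclass \<Omega> f" "g' \<in> Gclass \<Omega> g" for f' g'
  proof -
    have "(\<lambda>\<epsilon> x. (f \<epsilon> x - f' \<epsilon> x) + (g \<epsilon> x - g' \<epsilon> x)) \<in> Neg \<Omega>"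
      using that by (intro Neg_add assms(1)) (simp_all add: Gclass_iff)
    then have "(\<lambda>\<epsilon> x. (f \<epsilon> x + g \<epsilon> x) - (f' \<epsilon> x + g' \<epsilon> x)) \<in> Neg \<Omega>"
      by (simp add: algebra_simps)
    moreover have "(\<lambda>\<epsilon> x. f' \<epsilon> x + g' \<epsilon> x) \<in> EM \<Omega>"
      using that by (intro EM_add assms(1)) (simp_all add: Gclass_iff)
    ultimately show ?thesis
      by (intro Gclass_eq_iff[OF assms(1) EM_add[OF assms], THEN iffD2, symmetric])
  qed
  have "(\<Union>g'\<in>Gclass \<Omega> g. Gclass \<Omega> (\<lambda>\<epsilon> x. f' \<epsilon> x + g' \<epsilon> x)) = Gclass \<Omega> (\<lambda>\<epsilon> x. f \<epsilon> x + g \<epsilon> x)"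
    if "f' \<in> Gclass \<Omega> f" for f'
    using *[OF that] Gclass_self[OF assms(1,3)] by blast
  then show ?thesis
    unfolding Gadd_def using Gclass_self[OF assms(1,2)] by blast
qed

lemma Gdiff_Gclass:
  assumes "open \<Omega>" "f \<in> EM \<Omega>" "g \<in> EM \<Omega>"
  shows "Gdiff \<Omega> (Gclass \<Omega> f) (Gclass \<Omega> g) = Gclass \<Omega> (\<lambda>\<epsilon> x. f \<epsilon> x - g \<epsilon> x)"
proof -
  have *: "Gclass \<Omega> (\<lambda>\<epsilon> x. f' \<epsilon> x - g' \<epsilon> x) = Gclass \<Omega> (\<lambda>\<epsilon> x. f \<epsilon> x - g \<epsilon> x)"
    if "f' \<in> Gclass \<Omega> f" "g' \<in> Gclass \<Omega> g" for f' g'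
  proof -
    have "(\<lambda>\<epsilon> x. (f \<epsilon> x - f' \<epsilon> x) - (g \<epsilon> x - g' \<epsilon> x)) \<in> Neg \<Omega>"
      using that by (intro Neg_diff[OF assms(1), of "\<lambda>\<epsilon> x. f \<epsilon> x - f' \<epsilon> x" "\<lambda>\<epsilon> x. g \<epsilon> x - g' \<epsilon> x"])
        (simp_all add: Gclass_iff)
    then have "(\<lambda>\<epsilon> x. (f \<epsilon> x - g \<epsilon> x) - (f' \<epsilon> x - g' \<epsilon> x)) \<in> Neg \<Omega>"
      by (simp add: algebra_simps)
    moreover have "(\<lambda>\<epsilon> x. f' \<epsilon> x - g' \<epsilon> x) \<in> EM \<Omega>"
      using that by (intro EM_diff assms(1)) (simp_all add: Gclass_iff)
    ultimately show ?thesis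
      by (intro Gclass_eq_iff[OF assms(1) EM_diff[OF assms], THEN iffD2, symmetric])
  qed
  have "(\<Union>g'\<in>Gclass \<Omega> g. Gclass \<Omega> (\<lambda>\<epsilon> x. f' \<epsilon> x - g' \<epsilon> x)) = Gclass \<Omega> (\<lambda>\<epsilon> x. f \<epsilon> x - g \<epsilon> x)"
    if "f' \<in> Gclass \<Omega> f" for f'
    using *[OF that] Gclass_self[OF assms(1,3)] by blast
  then show ?thesis
    unfolding Gdiff_def using Gclass_self[OF assms(1,2)] by blast
qed

lemma moderate_rep: "moderate (rep_gcomplex c)"
  using Quotient3_rep_reflp[OF Quotient3_gcomplex] by (rule gcrel_moderate)

lemma Gscale_Gclass:
  assumes "open \<Omega>" "f \<in> EM \<Omega>"
  shows "Gscale \<Omega> c (Gclass \<Omega> f) = Gclass \<Omega> (\<lambda>\<epsilon> x. rep_gcomplex c \<epsilon> * f \<epsilon> x)"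
  unfolding Gscale_def
proof (rule UN_Gclass_eq[OF assms])
  fix f' assume f': "f' \<in> Gclass \<Omega> f"
  have "(\<lambda>\<epsilon> x. rep_gcomplex c \<epsilon> * (f \<epsilon> x - f' \<epsilon> x)) \<in> Neg \<Omega>"
    by (rule Neg_cmult[OF assms(1) _ moderate_rep]) (use f' in \<open>simp add: Gclass_iff\<close>)
  then have "(\<lambda>\<epsilon> x. rep_gcomplex c \<epsilon> * f \<epsilon> x - rep_gcomplex c \<epsilon> * f' \<epsilon> x) \<in> Neg \<Omega>"
    by (simp add: algebra_simps)
  moreover have em: "f' \<in> EM \<Omega>" using f' by (simp add: Gclass_iff)
  ultimately show "Gclass \<Omega> (\<lambda>\<epsilon> x. rep_gcomplex c \<epsilon> * f' \<epsilon> x) = Gclass \<Omega> (\<lambda>\<epsilon> x. rep_gcomplex c \<epsilon> * f \<epsilon> x)"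
    by (intro Gclass_eq_iff[OF assms(1) EM_cmult[OF assms moderate_rep] EM_cmult[OF assms(1) em moderate_rep],
          THEN iffD2, symmetric])
qed

text \<open>Multiplication by a fixed smooth function, written as a union over representatives like
  the other operations. As \<open>\<psi>\<close> does not depend on \<open>\<epsilon>\<close>, no
  seminorm grows under it, see \<open>Gseminorm_Gmult_le\<close>.\<close>

definition Gmult :: "(real^'n::finite) set \<Rightarrow> (real^'n \<Rightarrow> complex) \<Rightarrow> 'n net set \<Rightarrow> 'n net set" where
  "Gmult \<Omega> \<psi> u = (\<Union>f\<in>u. Gclass \<Omega> (\<lambda>\<epsilon> x. \<psi> x * f \<epsilon> x))"

lemma Gmult_Gclass:
  assumes "open \<Omega>" "f \<in> EM \<Omega>" "smooth_on \<Omega> \<psi>"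
  shows "Gmult \<Omega> \<psi> (Gclass \<Omega> f) = Gclass \<Omega> (\<lambda>\<epsilon> x. \<psi> x * f \<epsilon> x)"
  unfolding Gmult_def
proof (rule UN_Gclass_eq[OF assms(1,2)])
  fix f' assume f': "f' \<in> Gclass \<Omega> f"
  have "(\<lambda>\<epsilon> x. \<psi> x * (f \<epsilon> x - f' \<epsilon> x)) \<in> Neg \<Omega>"
    by (rule Neg_mult[OF assms(1) _ assms(3)]) (use f' in \<open>simp add: Gclass_iff\<close>)
  then have "(\<lambda>\<epsilon> x. \<psi> x * f \<epsilon> x - \<psi> x * f' \<epsilon> x) \<in> Neg \<Omega>"
    by (simp add: algebra_simps)
  moreover have em: "f' \<in> EM \<Omega>" using f' by (simp add: Gclass_iff)
  ultimately show "Gclass \<Omega> (\<lambda>\<epsilon> x. \<psi> x * f' \<epsilon> x) = Gclass \<Omega> (\<lambda>\<epsilon> x. \<psi> x * f \<epsilon> x)"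
    by (intro Gclass_eq_iff[OF assms(1) EM_mult[OF assms] EM_mult[OF assms(1) em assms(3)], THEN iffD2, symmetric])
qed

lemma Grestrict_Gclass:
  assumes "open \<Omega>" "open V" "V \<subseteq> \<Omega>" "f \<in> EM \<Omega>"
  shows "Grestrict V (Gclass \<Omega> f) = Gclass V f"
  unfolding Grestrict_def
proof (rule UN_Gclass_eq[OF assms(1,4)])
  fix f' assume "f' \<in> Gclass \<Omega> f"
  then have "f' \<in> EM \<Omega>" "(\<lambda>\<epsilon> x. f \<epsilon> x - f' \<epsilon> x) \<in> Neg \<Omega>" by (simp_all add: Gclass_iff)
  then have "f' \<in> EM V" "(\<lambda>\<epsilon> x. f \<epsilon> x - f' \<epsilon> x) \<in> Neg V"
    using EM_subset[OF assms(1-3)] Neg_subset[OF assms(1-3)] by simp_all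
  then show "Gclass V f' = Gclass V f"
    by (intro Gclass_eq_iff[OF assms(2) EM_subset[OF assms], THEN iffD2, symmetric])
qed

lemma EM_zero: "open \<Omega> \<Longrightarrow> (\<lambda>\<epsilon> x. 0) \<in> EM \<Omega>"
  by (simp add: Neg_imp_EM Neg_zero)

lemma Gclass_eq_Gzero_iff:
  assumes "open \<Omega>" "f \<in> EM \<Omega>"
  shows "Gclass \<Omega> f = Gzero \<Omega> \<longleftrightarrow> f \<in> Neg \<Omega>"
  unfolding Gzero_def Gclass_eq_iff[OF assms EM_zero[OF assms(1)]] by simp

section \<open>Supports and compactly supported elements\<close>

lemma Gsupp_Gclass:
  assumes "open \<Omega>" "f \<in> EM \<Omega>"
  shows "Gsupp \<Omega> (Gclass \<Omega> f) = \<Omega> - \<Union>{V. open V \<and> V \<subseteq> \<Omega> \<and> f \<in> Neg V}"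
proof -
  have "Grestrict V (Gclass \<Omega> f) = Gzero V \<longleftrightarrow> f \<in> Neg V" if "open V" "V \<subseteq> \<Omega>" for V
    using Grestrict_Gclass[OF assms(1) that assms(2)] Gclass_eq_Gzero_iff[OF that(1) EM_subset[OF assms(1) that assms(2)]]
    by simp
  then have "{V. open V \<and> V \<subseteq> \<Omega> \<and> Grestrict V (Gclass \<Omega> f) = Gzero V} = {V. open V \<and> V \<subseteq> \<Omega> \<and> f \<in> Neg V}"
    by auto
  then show ?thesis unfolding Gsupp_def by simp
qed

text \<open>The forward direction is gluing: every point off \<open>A\<close> has a neighbourhood on
  which \<open>f\<close> is negligible, and \<open>Neg_local\<close> assembles these. It allows
  supports to be handled through one representative.\<close>

lemma Gsupp_subset_iff:
  assumes "open \<Omega>" "f \<in> EM \<Omega>" "open (\<Omega> - A)"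
  shows "Gsupp \<Omega> (Gclass \<Omega> f) \<subseteq> A \<longleftrightarrow> f \<in> Neg (\<Omega> - A)"
proof
  assume sub: "Gsupp \<Omega> (Gclass \<Omega> f) \<subseteq> A"
  show "f \<in> Neg (\<Omega> - A)"
  proof (rule Neg_local[OF assms(3)])
    fix x assume "x \<in> \<Omega> - A"
    then have "x \<in> \<Union>{V. open V \<and> V \<subseteq> \<Omega> \<and> f \<in> Neg V}"
      using sub unfolding Gsupp_Gclass[OF assms(1,2)] by blast
    then show "\<exists>V. open V \<and> x \<in> V \<and> f \<in> Neg V" by blast
  qed
next
  assume "f \<in> Neg (\<Omega> - A)"
  with assms(3) have "\<Omega> - A \<in> {V. open V \<and> V \<subseteq> \<Omega> \<and> f \<in> Neg V}" by simp
  then show "Gsupp \<Omega> (Gclass \<Omega> f) \<subseteq> A"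
    unfolding Gsupp_Gclass[OF assms(1,2)] by blast
qed

lemma open_diff_compact: "open \<Omega> \<Longrightarrow> compact K \<Longrightarrow> open (\<Omega> - K :: 'a::t2_space set)"
  by (simp add: open_Diff compact_imp_closed)

lemma GK_iff:
  assumes "open \<Omega>" "f \<in> EM \<Omega>" "compact K"
  shows "Gclass \<Omega> f \<in> GK \<Omega> K \<longleftrightarrow> f \<in> Neg (\<Omega> - K)"
  using Gsupp_subset_iff[OF assms(1,2) open_diff_compact[OF assms(1,3)]] Gclass_in_G[OF assms(2)]
  by (simp add: GK_def)

lemma Gsupp_subset_domain: "Gsupp \<Omega> u \<subseteq> \<Omega>"
  by (auto simp: Gsupp_def)

lemma Gc_iff:
  assumes "open \<Omega>" "f \<in> EM \<Omega>"
  shows "Gclass \<Omega> f \<in> Gc \<Omega> \<longleftrightarrow> (\<exists>A. compact A \<and> A \<subseteq> \<Omega> \<and> f \<in> Neg (\<Omega> - A))"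
proof
  assume "Gclass \<Omega> f \<in> Gc \<Omega>"
  then have "compact (Gsupp \<Omega> (Gclass \<Omega> f))" by (simp add: Gc_def)
  with Gsupp_subset_iff[OF assms open_diff_compact[OF assms(1) this]] Gsupp_subset_domain
  show "\<exists>A. compact A \<and> A \<subseteq> \<Omega> \<and> f \<in> Neg (\<Omega> - A)" by blast
next
  assume "\<exists>A. compact A \<and> A \<subseteq> \<Omega> \<and> f \<in> Neg (\<Omega> - A)"
  then obtain A where A: "compact A" "A \<subseteq> \<Omega>" "f \<in> Neg (\<Omega> - A)" by blast
  then have "Gsupp \<Omega> (Gclass \<Omega> f) \<subseteq> A"
    using Gsupp_subset_iff[OF assms open_diff_compact[OF assms(1) A(1)]] by simp
  from compact_Gsupp[OF this A(1,2)] show "Gclass \<Omega> f \<in> Gc \<Omega>"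
    using Gclass_in_G[OF assms(2)] by (simp add: Gc_def)
qed

lemma Gc_subset_G: "Gc \<Omega> \<subseteq> G \<Omega>"
  and GK_subset_G: "GK \<Omega> K \<subseteq> G \<Omega>"
  by (auto simp: Gc_def GK_def)

lemma GK_subset_Gc: "compact K \<Longrightarrow> K \<subseteq> \<Omega> \<Longrightarrow> GK \<Omega> K \<subseteq> Gc \<Omega>"
  by (auto simp: Gc_def GK_def compact_Gsupp)

lemma Gzero_in_Gc: "open \<Omega> \<Longrightarrow> Gzero \<Omega> \<in> Gc \<Omega>"
  unfolding Gzero_def by (subst Gc_iff) (auto simp: EM_zero Neg_zero intro!: exI[of _ "{}"])

lemma Gadd_in_G: "open \<Omega> \<Longrightarrow> u \<in> G \<Omega> \<Longrightarrow> v \<in> G \<Omega> \<Longrightarrow> Gadd \<Omega> u v \<in> G \<Omega>"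
  and Gdiff_in_G: "open \<Omega> \<Longrightarrow> u \<in> G \<Omega> \<Longrightarrow> v \<in> G \<Omega> \<Longrightarrow> Gdiff \<Omega> u v \<in> G \<Omega>"
  and Gscale_in_G: "open \<Omega> \<Longrightarrow> u \<in> G \<Omega> \<Longrightarrow> Gscale \<Omega> c u \<in> G \<Omega>"
  by (auto simp: G_iff Gadd_Gclass Gdiff_Gclass Gscale_Gclass intro!: EM_add EM_diff EM_cmult moderate_rep)

lemma Gc_imp_Gclass: "u \<in> Gc \<Omega> \<Longrightarrow> \<exists>f\<in>EM \<Omega>. u = Gclass \<Omega> f"
  unfolding G_iff[symmetric] using Gc_subset_G by blast

lemma Gc_cases:
  assumes "open \<Omega>" "u \<in> Gc \<Omega>"
  obtains f A where "f \<in> EM \<Omega>" "u = Gclass \<Omega> f" "compact A" "A \<subseteq> \<Omega>" "f \<in> Neg (\<Omega> - A)"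
proof -
  have "u \<in> G \<Omega>" using assms(2) Gc_subset_G by blast
  then obtain f where f: "f \<in> EM \<Omega>" "u = Gclass \<Omega> f" unfolding G_iff by blast
  with assms(2) obtain A where "compact A" "A \<subseteq> \<Omega>" "f \<in> Neg (\<Omega> - A)"
    using Gc_iff[OF assms(1) f(1)] by blast
  with f show ?thesis by (rule that)
qed

lemma Gadd_in_Gc:
  assumes "open \<Omega>" "u \<in> Gc \<Omega>" "v \<in> Gc \<Omega>"
  shows "Gadd \<Omega> u v \<in> Gc \<Omega>"
proof -
  obtain f A where f: "f \<in> EM \<Omega>" "u = Gclass \<Omega> f" "compact A" "A \<subseteq> \<Omega>" "f \<in> Neg (\<Omega> - A)"
    using Gc_cases[OF assms(1,2)] .
  obtain g B where g: "g \<in> EM \<Omega>" "v = Gclass \<Omega> g" "compact B" "B \<subseteq> \<Omega>" "g \<in> Neg (\<Omega> - B)"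
    using Gc_cases[OF assms(1,3)] .
  have o: "open (\<Omega> - (A \<union> B))" by (intro open_diff_compact assms(1) compact_Un f g)
  have "(\<lambda>\<epsilon> x. f \<epsilon> x + g \<epsilon> x) \<in> Neg (\<Omega> - (A \<union> B))"
    by (intro Neg_add[OF o] Neg_subset[OF open_diff_compact[OF assms(1) f(3)] o _ f(5)]
        Neg_subset[OF open_diff_compact[OF assms(1) g(3)] o _ g(5)]) auto
  moreover have "compact (A \<union> B)" "A \<union> B \<subseteq> \<Omega>" using f g by auto
  ultimately show ?thesis
    unfolding f(2) g(2) Gadd_Gclass[OF assms(1) f(1) g(1)] Gc_iff[OF assms(1) EM_add[OF assms(1) f(1) g(1)]]
    by blast
qed

lemma Gscale_in_Gc:
  assumes "open \<Omega>" "u \<in> Gc \<Omega>"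
  shows "Gscale \<Omega> c u \<in> Gc \<Omega>"
proof -
  obtain f A where f: "f \<in> EM \<Omega>" "u = Gclass \<Omega> f" "compact A" "A \<subseteq> \<Omega>" "f \<in> Neg (\<Omega> - A)"
    using Gc_cases[OF assms(1,2)] .
  have "(\<lambda>\<epsilon> x. rep_gcomplex c \<epsilon> * f \<epsilon> x) \<in> Neg (\<Omega> - A)"
    by (rule Neg_cmult[OF open_diff_compact[OF assms(1) f(3)] f(5) moderate_rep])
  with f(3,4) show ?thesis
    unfolding f(2) Gscale_Gclass[OF assms(1) f(1)] Gc_iff[OF assms(1) EM_cmult[OF assms(1) f(1) moderate_rep]]
    by blast
qed

lemma Gadd_Gdiff_cancel:
  assumes "open \<Omega>" "u \<in> G \<Omega>" "v \<in> G \<Omega>"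
  shows "Gadd \<Omega> (Gdiff \<Omega> u v) v = u"
  using assms by (auto simp: G_iff Gdiff_Gclass Gadd_Gclass EM_diff)

lemma Gdiff_in_Gc:
  assumes "open \<Omega>" "u \<in> Gc \<Omega>" "v \<in> Gc \<Omega>"
  shows "Gdiff \<Omega> u v \<in> Gc \<Omega>"
proof -
  obtain f A where f: "f \<in> EM \<Omega>" "u = Gclass \<Omega> f" "compact A" "A \<subseteq> \<Omega>" "f \<in> Neg (\<Omega> - A)"
    using Gc_cases[OF assms(1,2)] .
  obtain g B where g: "g \<in> EM \<Omega>" "v = Gclass \<Omega> g" "compact B" "B \<subseteq> \<Omega>" "g \<in> Neg (\<Omega> - B)"
    using Gc_cases[OF assms(1,3)] .
  have "(\<lambda>\<epsilon> x. - g \<epsilon> x) \<in> Neg (\<Omega> - B)"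
    by (rule Neg_uminus[OF open_diff_compact[OF assms(1) g(3)] g(5)])
  with g have "Gclass \<Omega> (\<lambda>\<epsilon> x. - g \<epsilon> x) \<in> Gc \<Omega>"
    using Gc_iff[OF assms(1) EM_uminus[OF assms(1) g(1)]] by blast
  from Gadd_in_Gc[OF assms(1,2) this] show ?thesis
    by (simp add: f(2) g(2) Gadd_Gclass Gdiff_Gclass assms(1) f(1) g(1) EM_uminus)
qed

lemma Gmult_in_GK:
  assumes "open \<Omega>" "u \<in> G \<Omega>" "smooth_on \<Omega> \<psi>" "compact C" "\<And>x. x \<notin> C \<Longrightarrow> \<psi> x = 0"
  shows "Gmult \<Omega> \<psi> u \<in> GK \<Omega> C"
proof -
  obtain f where f: "f \<in> EM \<Omega>" "u = Gclass \<Omega> f" using assms(2) G_iff by blast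
  have "(\<lambda>\<epsilon> x. \<psi> x * f \<epsilon> x) \<in> Neg (\<Omega> - C)"
    by (rule Neg_vanishing[OF open_diff_compact[OF assms(1,4)]]) (simp add: assms(5))
  then show ?thesis
    unfolding f(2) Gmult_Gclass[OF assms(1) f(1) assms(3)] GK_iff[OF assms(1) EM_mult[OF assms(1) f(1) assms(3)] assms(4)] .
qed

section \<open>The ultra-pseudo-seminorms\<close>

text \<open>The exponential of minus the optimal exponent, isolated from \<open>Gseminorm\<close> so
  that inequalities between seminorms become inclusions between sets of admissible
  exponents.\<close>

definition growth :: "real set \<Rightarrow> real" where
  "growth B = exp_neg (Sup (ereal ` B))"

text \<open>For exponents \<open>a\<close> of \<open>A\<close> and \<open>b\<close> of
  \<open>B\<close>, downward closedness puts \<open>min a b\<close> into both sets and hence into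
  \<open>C\<close>. Nonemptiness keeps the suprema away from \<open>-\<infinity>\<close>, where
  \<open>exp_neg\<close> has a junk value.\<close>

lemma growth_le_max:
  assumes "A \<noteq> {}" "B \<noteq> {}" "A \<inter> B \<subseteq> C"
    and down: "\<And>a b. a \<in> A \<Longrightarrow> b \<le> a \<Longrightarrow> b \<in> A" "\<And>a b. a \<in> B \<Longrightarrow> b \<le> a \<Longrightarrow> b \<in> B"
  shows "growth C \<le> max (growth A) (growth B)"
proof -
  let ?S = "\<lambda>A. Sup (ereal ` A)"
  have le: "min (?S A) (?S B) \<le> ?S C"
  proof (rule dense_le)
    fix y assume "y < min (?S A) (?S B)"
    then obtain a b where ab: "a \<in> A" "b \<in> B" "y < ereal a" "y < ereal b"
      by (auto simp: less_Sup_iff)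
    then have "min a b \<in> C"
      using down(1)[of a "min a b"] down(2)[of b "min a b"] assms(3) by auto
    then have "ereal (min a b) \<le> ?S C" by (intro Sup_upper imageI)
    moreover have "y \<le> ereal (min a b)" using ab(3,4) by (simp add: min_def less_imp_le)
    ultimately show "y \<le> ?S C" by (rule order.trans[rotated])
  qed
  have "?S A \<noteq> -\<infinity>" "?S B \<noteq> -\<infinity>"
    using assms(1,2) by (auto simp: Sup_eq_MInfty)
  then have "exp_neg (?S C) \<le> exp_neg (min (?S A) (?S B))"
    by (intro exp_neg_antimono[OF _ le]) (simp add: min_def)
  then show ?thesis by (auto simp: growth_def min_def split: if_splits)
qed

lemma growth_antimono:
  assumes "A \<noteq> {}" "A \<subseteq> C" shows "growth C \<le> growth A"
proof -
  have "Sup (ereal ` A) \<noteq> -\<infinity>" using assms(1) by (auto simp: Sup_eq_MInfty)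
  then show ?thesis
    unfolding growth_def by (rule exp_neg_antimono) (rule Sup_subset_mono, use assms(2) in blast)
qed

lemma growth_UNIV: "growth UNIV = 0"
proof -
  have "Sup (range ereal) = \<infinity>"
    by (rule ereal_top) (simp add: Sup_upper)
  then show ?thesis by (simp add: growth_def exp_neg_def)
qed

text \<open>The representative chosen by \<open>SOME\<close> differs from \<open>f\<close> by a
  negligible net, which satisfies the bounds for every exponent. Both nets thus have the same
  admissible exponents.\<close>

lemma Gseminorm_Gclass:
  assumes "open \<Omega>" "f \<in> EM \<Omega>" "compact L" "L \<subseteq> \<Omega>"
  shows "Gseminorm L j (Gclass \<Omega> f) = growth {b. net_bound L j b f}"
proof -
  define g where "g = (SOME g. g \<in> Gclass \<Omega> f)"
  have "g \<in> Gclass \<Omega> f" unfolding g_def by (rule someI[of "\<lambda>g. g \<in> Gclass \<Omega> f", OF Gclass_self[OF assms(1,2)]])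
  then have g: "g \<in> EM \<Omega>" "(\<lambda>\<epsilon> x. f \<epsilon> x - g \<epsilon> x) \<in> Neg \<Omega>" by (simp_all add: Gclass_iff)
  note sm = EM_smooth[OF assms(2)] EM_smooth[OF g(1)]
  have d: "net_bound L j b (\<lambda>\<epsilon> x. f \<epsilon> x - g \<epsilon> x)" "net_bound L j b (\<lambda>\<epsilon> x. - (f \<epsilon> x - g \<epsilon> x))" for b
    using g(2) Neg_uminus[OF assms(1) g(2)] assms(3,4) Neg_iff_net_bound[OF assms(1)] by simp_all
  have "net_bound L j b f" if "net_bound L j b g" for b
    using net_bound_add[OF assms(1,4) sm(2) smooth_net_diff[OF assms(1) sm] that d(1)] by simp
  moreover have "net_bound L j b g" if "net_bound L j b f" for b
    using net_bound_add[OF assms(1,4) sm(1) Neg_smooth[OF Neg_uminus[OF assms(1) g(2)]] that d(2)] by simp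
  ultimately have "{b. net_bound L j b g} = {b. net_bound L j b f}" by blast
  then show ?thesis
    unfolding Gseminorm_def Let_def g_def[symmetric] growth_def
      net_bound_iff_supnorm_upto[OF assms(1,3,4) sm(2)] by simp
qed

text \<open>Phrased for differences, since the topologies are generated by balls in
  \<open>Gdiff\<close>. It comes from \<open>(f - g) + (g - h) = f - h\<close> on
  representatives.\<close>

lemma Gseminorm_triangle:
  assumes "open \<Omega>" "compact L" "L \<subseteq> \<Omega>" "u \<in> G \<Omega>" "v \<in> G \<Omega>" "w \<in> G \<Omega>"
  shows "Gseminorm L j (Gdiff \<Omega> u w) \<le> max (Gseminorm L j (Gdiff \<Omega> u v)) (Gseminorm L j (Gdiff \<Omega> v w))"
proof -
  obtain f g h where f: "f \<in> EM \<Omega>" "u = Gclass \<Omega> f" and g: "g \<in> EM \<Omega>" "v = Gclass \<Omega> g"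
    and h: "h \<in> EM \<Omega>" "w = Gclass \<Omega> h"
    using assms(4-6) G_iff by metis
  let ?d = "\<lambda>f g \<epsilon> x. f \<epsilon> x - g \<epsilon> x :: complex"
  have em: "?d f g \<in> EM \<Omega>" "?d g h \<in> EM \<Omega>" "?d f h \<in> EM \<Omega>"
    by (intro EM_diff assms(1) f g h)+
  note nm = Gseminorm_Gclass[OF assms(1) _ assms(2,3)]
  show ?thesis
    unfolding f(2) g(2) h(2) Gdiff_Gclass[OF assms(1) f(1) g(1)] Gdiff_Gclass[OF assms(1) g(1) h(1)]
      Gdiff_Gclass[OF assms(1) f(1) h(1)] nm[OF em(1)] nm[OF em(2)] nm[OF em(3)]
  proof (rule growth_le_max)
    show "{b. net_bound L j b (?d f g)} \<noteq> {}" "{b. net_bound L j b (?d g h)} \<noteq> {}"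
      using EM_net_bound[OF assms(1) em(1) assms(2,3)] EM_net_bound[OF assms(1) em(2) assms(2,3)] by auto
    have "net_bound L j b (?d f h)" if "net_bound L j b (?d f g)" "net_bound L j b (?d g h)" for b
      using net_bound_add[OF assms(1,3) EM_smooth[OF em(1)] EM_smooth[OF em(2)] that] by simp
    then show "{b. net_bound L j b (?d f g)} \<inter> {b. net_bound L j b (?d g h)} \<subseteq> {b. net_bound L j b (?d f h)}"
      by blast
  qed (auto intro: net_bound_mono)
qed

lemma Gseminorm_mono:
  assumes "open \<Omega>" "compact L" "L \<subseteq> \<Omega>" "M \<subseteq> L" "compact M" "i \<le> j" "u \<in> G \<Omega>"
  shows "Gseminorm M i u \<le> Gseminorm L j u"
proof -
  obtain f where f: "f \<in> EM \<Omega>" "u = Gclass \<Omega> f" using assms(7) G_iff by blast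
  have "M \<subseteq> \<Omega>" using assms(3,4) by blast
  show ?thesis
    unfolding f(2) Gseminorm_Gclass[OF assms(1) f(1) assms(2,3)] Gseminorm_Gclass[OF assms(1) f(1) assms(5) \<open>M \<subseteq> \<Omega>\<close>]
  proof (rule growth_antimono)
    show "{b. net_bound L j b f} \<noteq> {}" using EM_net_bound[OF assms(1) f(1) assms(2,3)] by auto
    show "{b. net_bound L j b f} \<subseteq> {b. net_bound M i b f}"
      using net_bound_subset[OF _ assms(4,6)] by blast
  qed
qed

text \<open>Every exponent is admissible for a net that is negligible around \<open>L\<close>, so
  the supremum is \<open>\<infinity>\<close> and \<open>exp_neg\<close> returns
  \<open>0\<close>.\<close>

lemma Gseminorm_vanishing:
  assumes "open \<Omega>" "compact L" "L \<subseteq> \<Omega>" "f \<in> EM \<Omega>" "open W" "L \<subseteq> W" "f \<in> Neg W"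
  shows "Gseminorm L j (Gclass \<Omega> f) = 0"
proof -
  have "net_bound L j b f" for b using assms Neg_iff_net_bound[OF assms(5)] by simp
  then have "{b. net_bound L j b f} = UNIV" by simp
  then show ?thesis using Gseminorm_Gclass[OF assms(1,4,2,3)] growth_UNIV by simp
qed

lemma Gseminorm_Gdiff_self:
  assumes "open \<Omega>" "compact L" "L \<subseteq> \<Omega>" "u \<in> G \<Omega>"
  shows "Gseminorm L j (Gdiff \<Omega> u u) = 0"
proof -
  obtain f where f: "f \<in> EM \<Omega>" "u = Gclass \<Omega> f" using assms(4) G_iff by blast
  show ?thesis unfolding f(2) Gdiff_Gclass[OF assms(1) f(1) f(1)]
    by (rule Gseminorm_vanishing[OF assms(1-3) EM_diff[OF assms(1) f(1) f(1)] assms(1,3)]) (simp add: Neg_zero assms(1))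
qed

text \<open>The compact set \<open>C\<close> carrying a cutoff function for \<open>K\<close> is the
  witness: it contains the open set \<open>W\<close>, because the function is \<open>1\<close> there
  and \<open>0\<close> off \<open>C\<close>.\<close>

lemma compact_neighbourhood:
  fixes K :: "(real^'n::finite) set"
  assumes "open \<Omega>" "compact K" "K \<subseteq> \<Omega>"
  shows "\<exists>K'. compact K' \<and> K' \<subseteq> \<Omega> \<and> K \<subseteq> interior K'"
proof -
  obtain \<psi> W C where c: "open W" "K \<subseteq> W" "\<And>y. y \<in> W \<Longrightarrow> \<psi> y = (1::complex)"
    "compact C" "C \<subseteq> \<Omega>" "\<And>y. y \<notin> C \<Longrightarrow> \<psi> y = 0"
    using smooth_cutoff[OF assms(2,1,3)] by metis
  have "W \<subseteq> C" using c(3,6) by force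
  then have "W \<subseteq> interior C" using c(1) by (rule interior_maximal)
  with c show ?thesis by blast
qed

lemma GK_seminorm_eq:
  fixes K :: "(real^'n::finite) set"
  assumes "open \<Omega>" "compact K" "K \<subseteq> \<Omega>"
  obtains K' where "compact K'" "K' \<subseteq> \<Omega>" "K \<subseteq> interior K'" "\<And>j. GK_seminorm \<Omega> K j = Gseminorm K' j"
proof -
  define K' where "K' = (SOME K'. compact K' \<and> K' \<subseteq> \<Omega> \<and> K \<subseteq> interior K')"
  have "compact K' \<and> K' \<subseteq> \<Omega> \<and> K \<subseteq> interior K'"
    unfolding K'_def by (rule someI_ex[OF compact_neighbourhood[OF assms]])
  moreover have "GK_seminorm \<Omega> K j = Gseminorm K' j" for j
    by (rule ext) (simp add: GK_seminorm_def K'_def)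
  ultimately show ?thesis by (intro that) simp_all
qed

text \<open>Off \<open>K\<close>, an element of \<open>GK \<Omega> K\<close> is negligible, so a neighbourhood of \<open>K\<close> controls all its seminorms.\<close>

lemma Gseminorm_le_neighbourhood:
  assumes "open \<Omega>" "compact K" "compact K'" "K' \<subseteq> \<Omega>" "K \<subseteq> interior K'"
    and "compact L" "L \<subseteq> \<Omega>" "u \<in> GK \<Omega> K"
  shows "Gseminorm L j u \<le> Gseminorm K' j u"
proof -
  obtain f where f: "f \<in> EM \<Omega>" "u = Gclass \<Omega> f" using assms(8) GK_subset_G G_iff by blast
  then have N: "f \<in> Neg (\<Omega> - K)" using assms(8) GK_iff[OF assms(1) f(1) assms(2)] by simp
  have c: "compact (L - interior K')" using assms(6) by (rule compact_diff) simp
  have s: "L - interior K' \<subseteq> \<Omega> - K" using assms(5,7) by blast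
  have "net_bound (L - interior K') j b f" for b
    using N c s Neg_iff_net_bound[OF open_diff_compact[OF assms(1,2)]] by blast
  then have nb: "net_bound L j b f" if "net_bound K' j b f" for b
    using net_bound_subset[OF net_bound_Un[OF that], of "L - interior K'" L j] interior_subset[of K'] by blast
  show ?thesis
    unfolding f(2) Gseminorm_Gclass[OF assms(1) f(1) assms(3,4)] Gseminorm_Gclass[OF assms(1) f(1) assms(6,7)]
  proof (rule growth_antimono)
    show "{b. net_bound K' j b f} \<noteq> {}" using EM_net_bound[OF assms(1) f(1) assms(3,4)] by auto
    show "{b. net_bound K' j b f} \<subseteq> {b. net_bound L j b f}" using nb by blast
  qed
qed

lemma Gseminorm_Gmult_le:
  assumes "open \<Omega>" "compact L" "L \<subseteq> \<Omega>" "smooth_on \<Omega> \<psi>" "u \<in> G \<Omega>"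
  shows "Gseminorm L j (Gmult \<Omega> \<psi> u) \<le> Gseminorm L j u"
proof -
  obtain f where f: "f \<in> EM \<Omega>" "u = Gclass \<Omega> f" using assms(5) G_iff by blast
  show ?thesis
    unfolding f(2) Gmult_Gclass[OF assms(1) f(1) assms(4)] Gseminorm_Gclass[OF assms(1) f(1) assms(2,3)]
      Gseminorm_Gclass[OF assms(1) EM_mult[OF assms(1) f(1) assms(4)] assms(2,3)]
  proof (rule growth_antimono)
    show "{b. net_bound L j b f} \<noteq> {}" using EM_net_bound[OF assms(1) f(1) assms(2,3)] by auto
    show "{b. net_bound L j b f} \<subseteq> {b. net_bound L j b (\<lambda>\<epsilon> x. \<psi> x * f \<epsilon> x)}"
      using net_bound_mult[OF assms(1-4) EM_smooth[OF f(1)]] by blast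
  qed
qed

section \<open>Multiplicative estimates for generalized numbers\<close>

lemma valuation_mult: "valuation z + valuation w \<le> valuation (z * w)"
proof (cases "z = 0 \<or> w = 0")
  case True
  then have "valuation (z * w) = \<infinity>" by (auto simp: valuation_eq_PInf_iff)
  then show ?thesis by simp
next
  case False
  then obtain p q where pq: "valuation z = ereal p" "valuation w = ereal q"
    using valuation_not_MInf[of z] valuation_not_MInf[of w] valuation_eq_PInf_iff[of z] valuation_eq_PInf_iff[of w]
    by (cases "valuation z"; cases "valuation w") auto
  have *: "ereal (a + b) \<le> valuation (z * w)" if "ereal a < valuation z" "ereal b < valuation w" for a b
    using that
  proof (transfer fixing: a b)
    fix z w :: "real \<Rightarrow> complex"
    let ?B = "\<lambda>z. {b. (\<lambda>\<epsilon>. norm (z \<epsilon>)) \<in> O[at_right 0](\<lambda>\<epsilon>. \<epsilon> powr b)}"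
    assume "ereal a < Sup (ereal ` ?B z)" "ereal b < Sup (ereal ` ?B w)"
    then obtain a' b' where ab: "a' \<in> ?B z" "b' \<in> ?B w" "a < a'" "b < b'"
      by (auto simp: less_Sup_iff)
    then have "a' + b' \<in> ?B (\<lambda>\<epsilon>. z \<epsilon> * w \<epsilon>)"
      using landau_o.big_mult[of "\<lambda>\<epsilon>. norm (z \<epsilon>)" "at_right 0" "\<lambda>\<epsilon>. \<epsilon> powr a'" "\<lambda>\<epsilon>. norm (w \<epsilon>)" "\<lambda>\<epsilon>. \<epsilon> powr b'"]
      by (simp add: norm_mult powr_add)
    then have "ereal (a' + b') \<le> Sup (ereal ` ?B (\<lambda>\<epsilon>. z \<epsilon> * w \<epsilon>))" by (intro Sup_upper imageI)
    moreover have "ereal (a + b) \<le> ereal (a' + b')" using ab(3,4) by simp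
    ultimately show "ereal (a + b) \<le> Sup (ereal ` ?B (\<lambda>\<epsilon>. z \<epsilon> * w \<epsilon>))" by (rule order.trans[rotated])
  qed
  \<comment> \<open>The suprema \<open>p\<close> and \<open>q\<close> need not be attained, so each
    is lowered by \<open>e / 2\<close>.\<close>
  have "ereal (p + q) \<le> valuation (z * w) + ereal e" if "e > 0" for e
  proof -
    have "ereal ((p - e / 2) + (q - e / 2)) \<le> valuation (z * w)"
      by (rule *) (use pq that in simp_all)
    then have "ereal ((p - e / 2) + (q - e / 2)) + ereal e \<le> valuation (z * w) + ereal e"
      by (rule add_right_mono)
    then show ?thesis by simp
  qed
  then have "ereal (p + q) \<le> valuation (z * w)" by (rule ereal_le_epsilon2)
  then show ?thesis by (simp add: pq)
qed

lemma gnorm_mult: "gnorm (z * w) \<le> gnorm z * gnorm w"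
proof (cases "z = 0 \<or> w = 0")
  case True
  then have "gnorm (z * w) = 0" by (auto simp: gnorm_eq_0_iff)
  then show ?thesis by (simp add: gnorm_nonneg)
next
  case False
  then obtain p q where pq: "valuation z = ereal p" "valuation w = ereal q"
    using valuation_not_MInf[of z] valuation_not_MInf[of w] valuation_eq_PInf_iff[of z] valuation_eq_PInf_iff[of w]
    by (cases "valuation z"; cases "valuation w") auto
  have "exp_neg (valuation (z * w)) \<le> exp_neg (ereal (p + q))"
    by (rule exp_neg_antimono) (use valuation_mult[of z w] pq in simp_all)
  then show ?thesis unfolding gnorm_def pq by (simp add: exp_neg_def mult_exp_exp)
qed

lemma gnorm_gcpow_le: "gnorm (gcpow c a) \<le> exp (- a)"
proof -
  have "ereal a \<le> valuation (gcpow c a)"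
  proof (transfer fixing: c a)
    have "(\<lambda>\<epsilon>. norm (c * complex_of_real (\<epsilon> powr a))) \<in> O[at_right 0](\<lambda>\<epsilon>. \<epsilon> powr a)"
      by (rule bigoI[where c = "norm c"]) (simp add: norm_mult)
    then show "ereal a \<le> Sup (ereal ` {b. (\<lambda>\<epsilon>. norm (c * complex_of_real (\<epsilon> powr a))) \<in> O[at_right 0](\<lambda>\<epsilon>. \<epsilon> powr b)})"
      by (intro Sup_upper imageI) simp
  qed
  then have "exp_neg (valuation (gcpow c a)) \<le> exp_neg (ereal a)"
    by (rule exp_neg_antimono[rotated]) simp
  then show ?thesis by (simp add: gnorm_def exp_neg_def)
qed

text \<open>An equality of classes rather than of nets: since \<open>0 powr a = 0\<close>, the
  product net is not \<open>1\<close> at index \<open>0\<close>, but it is \<open>1\<close> on the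
  whole of \<open>(0,1]\<close>.\<close>

lemma gcpow_inverse:
  assumes "c \<noteq> 0" shows "gcpow (inverse c) (- a) * gcpow c a = 1"
proof (transfer fixing: c a)
  have "negligible_net (\<lambda>\<epsilon>. inverse c * complex_of_real (\<epsilon> powr - a) * (c * complex_of_real (\<epsilon> powr a)) - 1)"
    unfolding negligible_net_def
  proof
    fix q :: nat
    have "\<forall>\<^sub>F \<epsilon>::real in at_right 0. norm (norm (inverse c * complex_of_real (\<epsilon> powr - a) * (c * complex_of_real (\<epsilon> powr a)) - 1))
        \<le> 0 * norm (\<epsilon> powr real q)"
      using eventually_at_right_0_1
    proof eventually_elim
      case (elim \<epsilon>)
      have "complex_of_real (\<epsilon> powr - a) * complex_of_real (\<epsilon> powr a) = 1"
        unfolding of_real_mult[symmetric] powr_add[symmetric] using elim by simp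
      then show ?case using assms by (simp add: field_simps)
    qed
    then show "(\<lambda>\<epsilon>. norm (inverse c * complex_of_real (\<epsilon> powr - a) * (c * complex_of_real (\<epsilon> powr a)) - 1))
        \<in> O[at_right 0](\<lambda>\<epsilon>. \<epsilon> powr real q)"
      by (rule bigoI)
  qed
  then show "gcrel (\<lambda>\<epsilon>. inverse c * complex_of_real (\<epsilon> powr - a) * (c * complex_of_real (\<epsilon> powr a))) (\<lambda>_. 1)"
    by (simp add: gcrel_def moderate_const moderate_mult moderate_powr)
qed

text \<open>One inequality is submultiplicativity. For the other, multiply back with the inverse
  \<open>gcpow (inverse c) (- a)\<close>, of norm at most \<open>exp a\<close>. This supplies the
  equality clause of \<open>ultra_pseudo_seminorm\<close> for the seminorm
  \<open>gnorm (S u)\<close>.\<close>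

lemma gnorm_gcpow_mult:
  assumes "c \<noteq> 0"
  shows "gnorm (gcpow c a * z) = gnorm (gcpow c a) * gnorm z"
proof (rule antisym[OF gnorm_mult])
  have "z = gcpow (inverse c) (- a) * (gcpow c a * z)"
    using gcpow_inverse[OF assms, of a] by (simp add: mult.assoc[symmetric])
  then have "gnorm z \<le> exp a * gnorm (gcpow c a * z)"
    using order.trans[OF gnorm_mult mult_right_mono[OF gnorm_gcpow_le gnorm_nonneg], of "inverse c" "- a" "gcpow c a * z"]
    by simp
  then have "exp (- a) * gnorm z \<le> exp (- a) * (exp a * gnorm (gcpow c a * z))"
    by (intro mult_left_mono) simp_all
  moreover have "exp (- a) * (exp a * gnorm (gcpow c a * z)) = gnorm (gcpow c a * z)"
    by (simp add: mult.assoc[symmetric] mult_exp_exp)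
  moreover have "gnorm (gcpow c a) * gnorm z \<le> exp (- a) * gnorm z"
    by (rule mult_right_mono[OF gnorm_gcpow_le gnorm_nonneg])
  ultimately show "gnorm (gcpow c a) * gnorm z \<le> gnorm (gcpow c a * z)" by simp
qed

lemma gcomplex_eq_0_if_scaled_bounded:
  assumes "\<And>a. gnorm (gcpow 1 a * z) < 1"
  shows "z = 0"
proof (rule ccontr)
  assume "z \<noteq> 0"
  then have pos: "gnorm z > 0" using gnorm_eq_0_iff[of z] gnorm_nonneg[of z] by linarith
  \<comment> \<open>The scaling that would bring the norm of a nonzero \<open>z\<close> to at least
    \<open>1\<close>: scaling by \<open>gcpow 1 a\<close> costs at most the factor
    \<open>exp (- a)\<close>, and \<open>exp a\<close> is the norm of \<open>z\<close>.\<close>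
  define a where "a = ln (gnorm z)"
  have "z = gcpow 1 (- a) * (gcpow 1 a * z)"
    using gcpow_inverse[of 1 a] by (simp add: mult.assoc[symmetric])
  then have "gnorm z \<le> exp a * gnorm (gcpow 1 a * z)"
    using order.trans[OF gnorm_mult mult_right_mono[OF gnorm_gcpow_le gnorm_nonneg], of 1 "- a" "gcpow 1 a * z"]
    by simp
  also have "\<dots> < exp a * 1" by (rule mult_strict_left_mono[OF assms]) simp
  finally show False using pos by (simp add: a_def)
qed

section \<open>Topologies and functionals\<close>

lemma topspace_G_topology: "topspace (G_topology \<Omega>) = G \<Omega>"
  and topspace_GK_topology: "topspace (GK_topology \<Omega> K) = GK \<Omega> K"
  by (simp_all add: G_topology_def GK_topology_def topspace_seminorm_topology)

lemma topspace_Gc_topology: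
  assumes "exhausting \<Omega> K" shows "topspace (Gc_topology \<Omega> K) = Gc \<Omega>"
proof -
  from Gc_topology_finest(1)[OF assms] obtain Ps where "Gc_topology \<Omega> K = seminorm_topology \<Omega> (Gc \<Omega>) Ps"
    unfolding Gc_admissible_def locally_convex_topology_def by (elim conjE exE)
  then show ?thesis by (simp add: topspace_seminorm_topology)
qed

lemma openin_seminorm_ball:
  "P \<in> Ps \<Longrightarrow> u \<in> M \<Longrightarrow> r > 0 \<Longrightarrow> openin (seminorm_topology \<Omega> M Ps) {v \<in> M. P (Gdiff \<Omega> v u) < r}"
  unfolding seminorm_topology_def
  by (rule topology_generated_by_Basis, rule insertI2, rule CollectI) (intro exI conjI, rule refl)

text \<open>Balls are only a subbase of the topology. Intersections are handled by directedness: a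
  larger compact set and a higher order dominate both seminorms.\<close>

lemma openin_G_contains_ball:
  assumes \<Omega>: "open \<Omega>" and "openin (G_topology \<Omega>) U" "u \<in> U"
  shows "\<exists>L j r. compact L \<and> L \<subseteq> \<Omega> \<and> r > 0 \<and> {v \<in> G \<Omega>. Gseminorm L j (Gdiff \<Omega> v u) < r} \<subseteq> U"
proof -
  have "u \<in> G \<Omega>"
    using openin_subset[OF assms(2)] assms(3) by (auto simp: topspace_G_topology)
  have "generate_topology_on (insert (G \<Omega>) {{v \<in> G \<Omega>. P (Gdiff \<Omega> v u) < r} | P u r.
      P \<in> {Gseminorm K j | K j. compact K \<and> K \<subseteq> \<Omega>} \<and> u \<in> G \<Omega> \<and> r > 0}) U"
    using assms(2) unfolding G_topology_def seminorm_topology_def by (rule openin_topology_generated_by)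
  then show ?thesis using assms(3)
  proof induction
    case (Int a b)
    from Int.IH(1) Int.prems obtain L j r where
      1: "compact L" "L \<subseteq> \<Omega>" "r > 0" "{v \<in> G \<Omega>. Gseminorm L j (Gdiff \<Omega> v u) < r} \<subseteq> a"
      by blast
    from Int.IH(2) Int.prems obtain M i s where
      2: "compact M" "M \<subseteq> \<Omega>" "s > 0" "{v \<in> G \<Omega>. Gseminorm M i (Gdiff \<Omega> v u) < s} \<subseteq> b"
      by blast
    let ?N = "L \<union> M" and ?k = "max i j"
    have N: "compact ?N" "?N \<subseteq> \<Omega>" using 1 2 by auto
    have "{v \<in> G \<Omega>. Gseminorm ?N ?k (Gdiff \<Omega> v u) < min r s} \<subseteq> a \<inter> b"
    proof
      fix v assume "v \<in> {v \<in> G \<Omega>. Gseminorm ?N ?k (Gdiff \<Omega> v u) < min r s}"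
      then have v: "v \<in> G \<Omega>" "Gseminorm ?N ?k (Gdiff \<Omega> v u) < min r s" by auto
      note d = Gdiff_in_G[OF \<Omega> v(1) \<open>u \<in> G \<Omega>\<close>]
      have "Gseminorm L j (Gdiff \<Omega> v u) < r" "Gseminorm M i (Gdiff \<Omega> v u) < s"
        using Gseminorm_mono[OF \<Omega> N, of L j ?k] Gseminorm_mono[OF \<Omega> N, of M i ?k] 1(1) 2(1) d v(2) by fastforce+
      with 1(4) 2(4) v(1) show "v \<in> a \<inter> b" by blast
    qed
    with N 1(3) 2(3) show ?case by (intro exI[of _ ?N] exI[of _ ?k] exI[of _ "min r s"]) simp
  next
    case (UN T)
    then obtain k where k: "k \<in> T" "u \<in> k" by blast
    from UN.IH[OF this] k(1) show ?case by (meson Union_upper order.trans)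
  next
    case (Basis s)
    then consider "s = G \<Omega>" | L j u' r where "compact L" "L \<subseteq> \<Omega>" "u' \<in> G \<Omega>" "r > 0"
      "s = {v \<in> G \<Omega>. Gseminorm L j (Gdiff \<Omega> v u') < r}" by auto
    then show ?case
    proof cases
      case 1
      then show ?thesis by (intro exI[of _ "{}"] exI[of _ 0] exI[of _ 1]) auto
    next
      case (2 L j u' r)
      \<comment> \<open>In an ultrametric ball every point is a centre, so the ball around
        \<open>u'\<close> is recentred at \<open>u\<close> with the same radius.\<close>
      have "{v \<in> G \<Omega>. Gseminorm L j (Gdiff \<Omega> v u) < r} \<subseteq> s"
      proof
        fix v assume "v \<in> {v \<in> G \<Omega>. Gseminorm L j (Gdiff \<Omega> v u) < r}"
        moreover have "Gseminorm L j (Gdiff \<Omega> u u') < r" using Basis(2) 2(5) by simp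
        ultimately show "v \<in> s"
          using Gseminorm_triangle[OF \<Omega> 2(1,2) _ \<open>u \<in> G \<Omega>\<close> 2(3), of v j] unfolding 2(5) by auto
      qed
      with 2 show ?thesis by blast
    qed
  qed simp
qed

section \<open>Continuity of inclusion and of multiplication by a cutoff function\<close>

text \<open>The topology of \<open>G \<Omega>\<close> tests on all compact sets, that of
  \<open>GK \<Omega> K\<close> only on one neighbourhood \<open>K'\<close> of \<open>K\<close>. For
  differences of elements of \<open>GK \<Omega> K\<close>, \<open>Gseminorm_le_neighbourhood\<close>
  shows that \<open>K'\<close> controls every other compact set.\<close>

lemma continuous_map_GK_G:
  fixes \<Omega> :: "(real^'n::finite) set"
  assumes \<Omega>: "open \<Omega>" and K: "compact K" "K \<subseteq> \<Omega>"
  shows "continuous_map (GK_topology \<Omega> K) (G_topology \<Omega>) (\<lambda>u. u)"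
  unfolding continuous_map_alt topspace_G_topology topspace_GK_topology
proof (intro conjI allI impI)
  show "(\<lambda>u. u) \<in> GK \<Omega> K \<rightarrow> G \<Omega>" using GK_subset_G by blast
  fix U assume U: "openin (G_topology \<Omega>) U"
  obtain K' where K': "compact K'" "K' \<subseteq> \<Omega>" "K \<subseteq> interior K'" "\<And>j. GK_seminorm \<Omega> K j = Gseminorm K' j"
    by (rule GK_seminorm_eq[OF \<Omega> K]) (rule that)
  have "\<exists>T. openin (GK_topology \<Omega> K) T \<and> u \<in> T \<and> T \<subseteq> U \<inter> GK \<Omega> K" if u: "u \<in> U \<inter> GK \<Omega> K" for u
  proof -
    from u have uU: "u \<in> U" and uK: "u \<in> GK \<Omega> K" and uG: "u \<in> G \<Omega>" using GK_subset_G by blast+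
    obtain L j r where L: "compact L" "L \<subseteq> \<Omega>" "r > 0" "{v \<in> G \<Omega>. Gseminorm L j (Gdiff \<Omega> v u) < r} \<subseteq> U"
      using openin_G_contains_ball[OF \<Omega> U uU] by blast
    let ?T = "{v \<in> GK \<Omega> K. Gseminorm K' j (Gdiff \<Omega> v u) < r}"
    have "GK_seminorm \<Omega> K j \<in> range (GK_seminorm \<Omega> K)" by simp
    from openin_seminorm_ball[OF this uK L(3)] have "openin (GK_topology \<Omega> K) ?T"
      unfolding GK_topology_def K'(4) .
    moreover have "u \<in> ?T" using Gseminorm_Gdiff_self[OF \<Omega> K'(1,2) uG] uK L(3) by simp
    moreover have "?T \<subseteq> U \<inter> GK \<Omega> K"
    proof
      fix v assume v: "v \<in> ?T"
      then have vG: "v \<in> G \<Omega>" using GK_subset_G by blast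
      have "Gdiff \<Omega> v u \<in> GK \<Omega> K"
      proof -
        obtain f g where f: "f \<in> EM \<Omega>" "v = Gclass \<Omega> f" and g: "g \<in> EM \<Omega>" "u = Gclass \<Omega> g"
          using vG uG unfolding G_iff by blast
        have "f \<in> Neg (\<Omega> - K)" "g \<in> Neg (\<Omega> - K)"
          using v uK f g GK_iff[OF \<Omega> _ K(1)] by auto
        then have "(\<lambda>\<epsilon> x. f \<epsilon> x - g \<epsilon> x) \<in> Neg (\<Omega> - K)"
          by (rule Neg_diff[OF open_diff_compact[OF \<Omega> K(1)]])
        then show ?thesis
          unfolding f(2) g(2) Gdiff_Gclass[OF \<Omega> f(1) g(1)] GK_iff[OF \<Omega> EM_diff[OF \<Omega> f(1) g(1)] K(1)] .
      qed
      from Gseminorm_le_neighbourhood[OF \<Omega> K(1) K'(1-3) L(1,2) this, of j] v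
      have "Gseminorm L j (Gdiff \<Omega> v u) < r" by simp
      with L(4) vG v show "v \<in> U \<inter> GK \<Omega> K" by blast
    qed
    ultimately show ?thesis by blast
  qed
  then have "openin (GK_topology \<Omega> K) (U \<inter> GK \<Omega> K)"
    by (subst openin_subopen) blast
  then show "openin (GK_topology \<Omega> K) ((\<lambda>u. u) -` U \<inter> GK \<Omega> K)" by simp
qed

text \<open>Multiplication by \<open>\<psi>\<close> does not increase \<open>Gseminorm K' j\<close>,
  so a ball of the same radius in \<open>G \<Omega>\<close> is mapped into the given one. The centre
  \<open>w\<close> of that ball need not be a multiple of \<open>\<psi>\<close>; the ultrametric
  inequality moves it to the image of a point already inside.\<close>

lemma continuous_map_Gmult:
  fixes \<Omega> :: "(real^'n::finite) set"
  assumes \<Omega>: "open \<Omega>" and K: "compact K" "K \<subseteq> \<Omega>"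
    and \<psi>: "smooth_on \<Omega> \<psi>" "compact C" "C \<subseteq> K" "\<And>x. x \<notin> C \<Longrightarrow> \<psi> x = 0"
  shows "continuous_map (G_topology \<Omega>) (GK_topology \<Omega> K) (Gmult \<Omega> \<psi>)"
proof -
  obtain K' where K': "compact K'" "K' \<subseteq> \<Omega>" "K \<subseteq> interior K'" "\<And>j. GK_seminorm \<Omega> K j = Gseminorm K' j"
    by (rule GK_seminorm_eq[OF \<Omega> K]) (rule that)
  have mem: "Gmult \<Omega> \<psi> u \<in> GK \<Omega> K" if "u \<in> G \<Omega>" for u
    using Gmult_in_GK[OF \<Omega> that \<psi>(1,2,4)] \<psi>(3) unfolding GK_def by blast
  have "openin (G_topology \<Omega>) {u \<in> G \<Omega>. Gseminorm K' j (Gdiff \<Omega> (Gmult \<Omega> \<psi> u) w) < r}"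
    if w: "w \<in> GK \<Omega> K" and r: "r > 0" for w j r
  proof -
    let ?U = "{u \<in> G \<Omega>. Gseminorm K' j (Gdiff \<Omega> (Gmult \<Omega> \<psi> u) w) < r}"
    have "\<exists>T. openin (G_topology \<Omega>) T \<and> u \<in> T \<and> T \<subseteq> ?U" if u: "u \<in> ?U" for u
    proof -
      from u have uG: "u \<in> G \<Omega>" by simp
      let ?T = "{v \<in> G \<Omega>. Gseminorm K' j (Gdiff \<Omega> v u) < r}"
      have "Gseminorm K' j \<in> {Gseminorm K j | K j. compact K \<and> K \<subseteq> \<Omega>}" using K' by blast
      from openin_seminorm_ball[OF this uG r] have "openin (G_topology \<Omega>) ?T"
        unfolding G_topology_def .
      moreover have "u \<in> ?T" using Gseminorm_Gdiff_self[OF \<Omega> K'(1,2) uG] uG r by simp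
      moreover have "?T \<subseteq> ?U"
      proof
        fix v assume v: "v \<in> ?T"
        obtain f g where f: "f \<in> EM \<Omega>" "v = Gclass \<Omega> f" and g: "g \<in> EM \<Omega>" "u = Gclass \<Omega> g"
          using v uG unfolding G_iff by blast
        have "Gdiff \<Omega> (Gmult \<Omega> \<psi> v) (Gmult \<Omega> \<psi> u) = Gmult \<Omega> \<psi> (Gdiff \<Omega> v u)"
          by (simp add: f g Gmult_Gclass Gdiff_Gclass \<Omega> \<psi>(1) EM_diff EM_mult right_diff_distrib)
        then have "Gseminorm K' j (Gdiff \<Omega> (Gmult \<Omega> \<psi> v) (Gmult \<Omega> \<psi> u)) < r"
          using Gseminorm_Gmult_le[OF \<Omega> K'(1,2) \<psi>(1) Gdiff_in_G[OF \<Omega> _ uG], of v j] v by simp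
        moreover have "Gmult \<Omega> \<psi> v \<in> G \<Omega>" "Gmult \<Omega> \<psi> u \<in> G \<Omega>" "w \<in> G \<Omega>"
          using mem v uG w GK_subset_G by blast+
        ultimately show "v \<in> ?U"
          using Gseminorm_triangle[OF \<Omega> K'(1,2), of "Gmult \<Omega> \<psi> v" "Gmult \<Omega> \<psi> u" w j] u v by auto
      qed
      ultimately show ?thesis by blast
    qed
    then show ?thesis by (subst openin_subopen) blast
  qed
  note ball = this
  show ?thesis
    unfolding GK_topology_def seminorm_topology_def continuous_on_generated_topo_iff topspace_G_topology
  proof (intro conjI allI impI)
    fix V assume "V \<in> insert (GK \<Omega> K) {{v \<in> GK \<Omega> K. P (Gdiff \<Omega> v u) < r} | P u r.
        P \<in> range (GK_seminorm \<Omega> K) \<and> u \<in> GK \<Omega> K \<and> r > 0}"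
    then consider "V = GK \<Omega> K" | j u r where "u \<in> GK \<Omega> K" "r > 0"
        "V = {v \<in> GK \<Omega> K. Gseminorm K' j (Gdiff \<Omega> v u) < r}"
      using K'(4) by auto
    then show "openin (G_topology \<Omega>) (Gmult \<Omega> \<psi> -` V \<inter> G \<Omega>)"
    proof cases
      case 1
      then have "Gmult \<Omega> \<psi> -` V \<inter> G \<Omega> = topspace (G_topology \<Omega>)"
        using mem by (auto simp: topspace_G_topology)
      then show ?thesis by simp
    next
      case (2 j u r)
      then have "Gmult \<Omega> \<psi> -` V \<inter> G \<Omega> = {v \<in> G \<Omega>. Gseminorm K' j (Gdiff \<Omega> (Gmult \<Omega> \<psi> v) u) < r}"
        using mem by auto
      then show ?thesis using ball[OF 2(1,2)] by simp
    qed
  next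
    show "Gmult \<Omega> \<psi> ` G \<Omega> \<subseteq> \<Union> (insert (GK \<Omega> K) {{v \<in> GK \<Omega> K. P (Gdiff \<Omega> v u) < r} | P u r.
        P \<in> range (GK_seminorm \<Omega> K) \<and> u \<in> GK \<Omega> K \<and> r > 0})"
      using mem by blast
  qed
qed

lemma mem_ball_gcomplex: "w \<in> ball z r \<longleftrightarrow> gnorm (w - z) < r"
  by (simp add: dist_commute[of z] dist_gcomplex_def[symmetric])

section \<open>Functionals: restriction, carriers, supports and extension\<close>

text \<open>Additivity is applied to \<open>u = (u - v) + v\<close>. The submodule \<open>M\<close>
  is left general, so that the fact serves functionals on \<open>G \<Omega>\<close> as well as on
  \<open>Gc \<Omega>\<close>.\<close>

lemma functional_Gdiff:
  assumes \<Omega>: "open \<Omega>" and T: "T \<in> cont_functionals \<Omega> M X"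
    and "M \<subseteq> G \<Omega>" "u \<in> M" "v \<in> M" "Gdiff \<Omega> u v \<in> M"
  shows "T (Gdiff \<Omega> u v) = T u - T v"
proof -
  have "u \<in> G \<Omega>" "v \<in> G \<Omega>" using assms(3-5) by blast+
  then have "T u = T (Gadd \<Omega> (Gdiff \<Omega> u v) v)" by (simp add: Gadd_Gdiff_cancel[OF \<Omega>])
  also have "\<dots> = T (Gdiff \<Omega> u v) + T v"
    using T assms(5,6) by (simp add: cont_functionals_def)
  finally show ?thesis by simp
qed

lemma functional_Gzero:
  assumes \<Omega>: "open \<Omega>" and T: "T \<in> cont_functionals \<Omega> M X" and "Gzero \<Omega> \<in> M"
  shows "T (Gzero \<Omega>) = 0"
proof -
  have "Gadd \<Omega> (Gzero \<Omega>) (Gzero \<Omega>) = Gzero \<Omega>"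
    by (simp add: Gzero_def Gadd_Gclass \<Omega> EM_zero)
  moreover have "T (Gadd \<Omega> (Gzero \<Omega>) (Gzero \<Omega>)) = T (Gzero \<Omega>) + T (Gzero \<Omega>)"
    using T assms(3) by (simp add: cont_functionals_def)
  ultimately show ?thesis by simp
qed

lemma restrict_in_dual_Gc:
  fixes \<Omega> :: "(real^'n::finite) set"
  assumes \<Omega>: "open \<Omega>" and K: "exhausting \<Omega> K" and S: "S \<in> dual_G \<Omega>"
  shows "restrict S (Gc \<Omega>) \<in> dual_Gc \<Omega> K"
proof -
  note S' = S[unfolded dual_G_def]
  have add: "S (Gadd \<Omega> u v) = S u + S v" if "u \<in> G \<Omega>" "v \<in> G \<Omega>" for u v
    using S' that by (simp add: cont_functionals_def)
  have scale: "S (Gscale \<Omega> c u) = c * S u" if "u \<in> G \<Omega>" for c u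
    using S' that by (simp add: cont_functionals_def)
  have cont: "continuous_map (G_topology \<Omega>) euclidean S"
    using S' by (simp add: cont_functionals_def)
  have G: "u \<in> G \<Omega>" if "u \<in> Gc \<Omega>" for u using that Gc_subset_G by blast
  have diff: "S (Gdiff \<Omega> u v) = S u - S v" if "u \<in> Gc \<Omega>" "v \<in> Gc \<Omega>" for u v
    using functional_Gdiff[OF \<Omega> S' order.refl G[OF that(1)] G[OF that(2)]] Gdiff_in_G[OF \<Omega>] G that by simp
  define P where "P = (\<lambda>u. gnorm (S u))"
  \<comment> \<open>The topology of the single seminorm \<open>P\<close> makes \<open>S\<close>
    continuous by construction; it remains to see that it is among those over which the limit
    topology is the supremum.\<close>
  define X where "X = seminorm_topology \<Omega> (Gc \<Omega>) {P}"
  have "S (Gzero \<Omega>) = 0"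
    by (rule functional_Gzero[OF \<Omega> S' G[OF Gzero_in_Gc[OF \<Omega>]]])
  then have "ultra_pseudo_seminorm \<Omega> (Gc \<Omega>) P"
    unfolding ultra_pseudo_seminorm_def P_def
    by (simp add: gnorm_nonneg gnorm_eq_0_iff add scale G gnorm_mult gnorm_gcpow_mult gnorm_add)
  then have lc: "locally_convex_topology \<Omega> (Gc \<Omega>) X"
    unfolding locally_convex_topology_def X_def by (intro exI[of _ "{P}"]) simp
  have "continuous_map (GK_topology \<Omega> (K n)) X (\<lambda>u. u)" for n
  proof -
    have Kn: "compact (K n)" "K n \<subseteq> \<Omega>" using K unfolding exhausting_def by blast+
    note sub = GK_subset_Gc[OF Kn]
    have contK: "continuous_map (GK_topology \<Omega> (K n)) euclidean S"
      using continuous_map_compose[OF continuous_map_GK_G[OF \<Omega> Kn] cont] by (simp add: o_def)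
    show ?thesis
      unfolding X_def seminorm_topology_def continuous_on_generated_topo_iff topspace_GK_topology
    proof (intro conjI allI impI)
      fix V assume "V \<in> insert (Gc \<Omega>) {{v \<in> Gc \<Omega>. p (Gdiff \<Omega> v u) < r} | p u r. p \<in> {P} \<and> u \<in> Gc \<Omega> \<and> r > 0}"
      then consider "V = Gc \<Omega>" | u r where "u \<in> Gc \<Omega>" "V = {v \<in> Gc \<Omega>. P (Gdiff \<Omega> v u) < r}" by auto
      then show "openin (GK_topology \<Omega> (K n)) ((\<lambda>u. u) -` V \<inter> GK \<Omega> (K n))"
      proof cases
        case 1
        then have "(\<lambda>u. u) -` V \<inter> GK \<Omega> (K n) = topspace (GK_topology \<Omega> (K n))"
          using sub by (auto simp: topspace_GK_topology)
        then show ?thesis by simp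
      next
        case (2 u r)
        \<comment> \<open>By additivity \<open>P (Gdiff \<Omega> v u)\<close> is the distance of
          \<open>S v\<close> and \<open>S u\<close>, so a \<open>P\<close>-ball is the preimage of a
          metric ball under \<open>S\<close>.\<close>
        have "(\<lambda>u. u) -` V \<inter> GK \<Omega> (K n) = {v \<in> topspace (GK_topology \<Omega> (K n)). S v \<in> ball (S u) r}"
          using sub 2 diff by (auto simp: topspace_GK_topology P_def mem_ball_gcomplex simp del: mem_ball)
        then show ?thesis
          using openin_continuous_map_preimage[OF contK, of "ball (S u) r"] by simp
      qed
    qed (use sub in blast)
  qed
  with lc have adm: "Gc_admissible \<Omega> K X" unfolding Gc_admissible_def by blast
  have "openin X {u \<in> Gc \<Omega>. S u \<in> U}" if U: "open U" for U
  proof -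
    have "\<exists>T. openin X T \<and> u \<in> T \<and> T \<subseteq> {u \<in> Gc \<Omega>. S u \<in> U}" if u: "u \<in> {u \<in> Gc \<Omega>. S u \<in> U}" for u
    proof -
      from u have uc: "u \<in> Gc \<Omega>" and "S u \<in> U" by auto
      then obtain e where e: "e > 0" "ball (S u) e \<subseteq> U" using U open_contains_ball by blast
      let ?T = "{v \<in> Gc \<Omega>. P (Gdiff \<Omega> v u) < e}"
      have "openin X ?T" unfolding X_def by (rule openin_seminorm_ball[OF _ uc e(1)]) simp
      moreover have T: "?T = {v \<in> Gc \<Omega>. S v \<in> ball (S u) e}"
        using uc diff by (auto simp: P_def mem_ball_gcomplex simp del: mem_ball)
      moreover have "u \<in> ?T" unfolding T using uc e(1) by simp
      moreover have "?T \<subseteq> {u \<in> Gc \<Omega>. S u \<in> U}" unfolding T using e(2) by blast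
      ultimately show ?thesis by blast
    qed
    then show ?thesis by (subst openin_subopen) blast
  qed
  then have "openin (Gc_topology \<Omega> K) {u \<in> Gc \<Omega>. S u \<in> U}" if "open U" for U
    using Gc_topology_finest(2)[OF K adm] that by simp
  moreover have "{u \<in> Gc \<Omega>. restrict S (Gc \<Omega>) u \<in> U} = {u \<in> Gc \<Omega>. S u \<in> U}" for U by auto
  ultimately have "continuous_map (Gc_topology \<Omega> K) euclidean (restrict S (Gc \<Omega>))"
    unfolding continuous_map_def topspace_Gc_topology[OF K] by (simp add: open_openin[symmetric])
  then show ?thesis
    unfolding dual_Gc_def cont_functionals_def
    by (simp add: Gadd_in_Gc[OF \<Omega>] Gscale_in_Gc[OF \<Omega>] add scale G)
qed

text \<open>
  Continuity bounds \<open>S\<close> on a ball of one seminorm on a compact set \<open>L\<close>. This ball contains all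
  multiples of the elements vanishing near \<open>L\<close>.
\<close>

lemma dual_G_carrier:
  fixes \<Omega> :: "(real^'n::finite) set"
  assumes \<Omega>: "open \<Omega>" and S: "S \<in> dual_G \<Omega>"
  obtains L where "compact L" "L \<subseteq> \<Omega>"
    "\<And>f W. f \<in> EM \<Omega> \<Longrightarrow> open W \<Longrightarrow> L \<subseteq> W \<Longrightarrow> f \<in> Neg W \<Longrightarrow> S (Gclass \<Omega> f) = 0"
proof -
  note S' = S[unfolded dual_G_def]
  have z: "Gzero \<Omega> \<in> G \<Omega>" using Gzero_in_Gc[OF \<Omega>] Gc_subset_G by blast
  have cont: "continuous_map (G_topology \<Omega>) euclidean S"
    using S' by (simp add: cont_functionals_def)
  \<comment> \<open>Radius \<open>1\<close> is the bound expected by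
    \<open>gcomplex_eq_0_if_scaled_bounded\<close>.\<close>
  let ?U = "{v \<in> topspace (G_topology \<Omega>). S v \<in> ball 0 1}"
  have "openin (G_topology \<Omega>) ?U"
    by (rule openin_continuous_map_preimage[OF cont]) simp
  moreover have "Gzero \<Omega> \<in> ?U"
    using functional_Gzero[OF \<Omega> S' z] z by (simp add: topspace_G_topology)
  ultimately obtain L j r where L: "compact L" "L \<subseteq> \<Omega>" "r > 0"
    "{v \<in> G \<Omega>. Gseminorm L j (Gdiff \<Omega> v (Gzero \<Omega>)) < r} \<subseteq> ?U"
    using openin_G_contains_ball[OF \<Omega>, of ?U "Gzero \<Omega>"] by blast
  have "S (Gclass \<Omega> f) = 0" if f: "f \<in> EM \<Omega>" and W: "open W" "L \<subseteq> W" "f \<in> Neg W" for f W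
  proof (rule gcomplex_eq_0_if_scaled_bounded)
    fix a
    let ?g = "\<lambda>\<epsilon> x. rep_gcomplex (gcpow 1 a) \<epsilon> * f \<epsilon> x"
    have g: "?g \<in> EM \<Omega>" by (rule EM_cmult[OF \<Omega> f moderate_rep])
    have "Gdiff \<Omega> (Gclass \<Omega> ?g) (Gzero \<Omega>) = Gclass \<Omega> ?g"
      unfolding Gzero_def Gdiff_Gclass[OF \<Omega> g EM_zero[OF \<Omega>]] by simp
    moreover have "Gseminorm L j (Gclass \<Omega> ?g) = 0"
      by (rule Gseminorm_vanishing[OF \<Omega> L(1,2) g W(1,2) Neg_cmult[OF W(1,3) moderate_rep]])
    ultimately have "Gclass \<Omega> ?g \<in> {v \<in> G \<Omega>. Gseminorm L j (Gdiff \<Omega> v (Gzero \<Omega>)) < r}"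
      using L(3) Gclass_in_G[OF g] by simp
    with L(4) have "Gclass \<Omega> ?g \<in> ?U" by blast
    then have "gnorm (S (Gclass \<Omega> ?g)) < 1"
      by (simp add: mem_ball_gcomplex del: mem_ball)
    moreover have "S (Gclass \<Omega> ?g) = gcpow 1 a * S (Gclass \<Omega> f)"
      unfolding Gscale_Gclass[OF \<Omega> f, symmetric]
      using S' Gclass_in_G[OF f] by (simp add: cont_functionals_def)
    ultimately show "gnorm (gcpow 1 a * S (Gclass \<Omega> f)) < 1" by simp
  qed
  with L(1,2) show ?thesis by (rule that)
qed

text \<open>Smoothness on all sets at once, because the cutoff function multiplies nets on
  \<open>\<Omega>\<close> as well as on complements of supports.\<close>

lemma smooth_cutoff_on:
  fixes H :: "(real^'n::finite) set"
  assumes "compact H" "open V" "H \<subseteq> V"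
  obtains \<psi> W C where "\<And>\<Omega>. smooth_on \<Omega> \<psi>" "open W" "H \<subseteq> W" "\<And>y. y \<in> W \<Longrightarrow> \<psi> y = 1"
    "compact C" "C \<subseteq> V" "\<And>y. y \<notin> C \<Longrightarrow> \<psi> y = 0"
proof (rule smooth_cutoff[OF assms])
  fix \<psi> :: "real^'n \<Rightarrow> complex" and W C
  assume "smooth_on UNIV \<psi>" and a: "open W" "H \<subseteq> W" "\<And>y. y \<in> W \<Longrightarrow> \<psi> y = 1"
    "compact C" "C \<subseteq> V" "\<And>y. y \<notin> C \<Longrightarrow> \<psi> y = 0"
  then have "smooth_on \<Omega> \<psi>" for \<Omega> using smooth_on_subset[of UNIV] by simp
  then show thesis using a by (rule that)
qed

lemma Gmult_in_Gc:
  assumes "open \<Omega>" "u \<in> G \<Omega>" "smooth_on \<Omega> \<psi>" "compact C" "C \<subseteq> \<Omega>" "\<And>x. x \<notin> C \<Longrightarrow> \<psi> x = 0"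
  shows "Gmult \<Omega> \<psi> u \<in> Gc \<Omega>"
  using Gmult_in_GK[OF assms(1-4,6)] GK_subset_Gc[OF assms(4,5)] by blast

lemma inj_on_restrict_dual_G:
  fixes \<Omega> :: "(real^'n::finite) set"
  assumes \<Omega>: "open \<Omega>"
  shows "inj_on (\<lambda>S. restrict S (Gc \<Omega>)) (dual_G \<Omega>)"
proof (rule inj_onI)
  fix S R assume S: "S \<in> dual_G \<Omega>" and R: "R \<in> dual_G \<Omega>" and eq: "restrict S (Gc \<Omega>) = restrict R (Gc \<Omega>)"
  obtain L where L: "compact L" "L \<subseteq> \<Omega>"
      "\<And>f W. f \<in> EM \<Omega> \<Longrightarrow> open W \<Longrightarrow> L \<subseteq> W \<Longrightarrow> f \<in> Neg W \<Longrightarrow> S (Gclass \<Omega> f) = 0"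
    by (rule dual_G_carrier[OF \<Omega> S]) (rule that)
  obtain M where M: "compact M" "M \<subseteq> \<Omega>"
      "\<And>f W. f \<in> EM \<Omega> \<Longrightarrow> open W \<Longrightarrow> M \<subseteq> W \<Longrightarrow> f \<in> Neg W \<Longrightarrow> R (Gclass \<Omega> f) = 0"
    by (rule dual_G_carrier[OF \<Omega> R]) (rule that)
  \<comment> \<open>One cutoff function for both carriers, so that \<open>u - \<psi> u\<close> is
    killed by \<open>S\<close> and \<open>R\<close> alike and only the compactly supported part
    \<open>\<psi> u\<close> is left to compare.\<close>
  have LM: "compact (L \<union> M)" "L \<union> M \<subseteq> \<Omega>" using L M by auto
  obtain \<psi> W C where c: "\<And>\<Omega>. smooth_on \<Omega> \<psi>" "open W" "L \<union> M \<subseteq> W" "\<And>y. y \<in> W \<Longrightarrow> \<psi> y = 1"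
    "compact C" "C \<subseteq> \<Omega>" "\<And>y. y \<notin> C \<Longrightarrow> \<psi> y = 0"
    by (rule smooth_cutoff_on[OF LM(1) \<Omega> LM(2)]) (rule that)
  have "S u = R u" if u: "u \<in> G \<Omega>" for u
  proof -
    obtain f where f: "f \<in> EM \<Omega>" "u = Gclass \<Omega> f" using u unfolding G_iff by blast
    let ?v = "Gmult \<Omega> \<psi> u" and ?g = "\<lambda>\<epsilon> x. f \<epsilon> x - \<psi> x * f \<epsilon> x"
    have v: "?v \<in> Gc \<Omega>" by (rule Gmult_in_Gc[OF \<Omega> u c(1,5,6,7)])
    then have vG: "?v \<in> G \<Omega>" using Gc_subset_G by blast
    have em: "(\<lambda>\<epsilon> x. \<psi> x * f \<epsilon> x) \<in> EM \<Omega>" by (rule EM_mult[OF \<Omega> f(1) c(1)])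
    have d: "Gdiff \<Omega> u ?v = Gclass \<Omega> ?g"
      unfolding f(2) Gmult_Gclass[OF \<Omega> f(1) c(1)] Gdiff_Gclass[OF \<Omega> f(1) em] ..
    have g: "?g \<in> EM \<Omega>" "?g \<in> Neg W"
      using EM_diff[OF \<Omega> f(1) em] Neg_vanishing[OF c(2), of ?g] c(4) by simp_all
    have "S (Gdiff \<Omega> u ?v) = 0" "R (Gdiff \<Omega> u ?v) = 0"
      unfolding d using L(3)[OF g(1) c(2) _ g(2)] M(3)[OF g(1) c(2) _ g(2)] c(3) by simp_all
    moreover have "S (Gdiff \<Omega> u ?v) = S u - S ?v" "R (Gdiff \<Omega> u ?v) = R u - R ?v"
      by (rule functional_Gdiff[OF \<Omega> S[unfolded dual_G_def] order.refl u vG Gdiff_in_G[OF \<Omega> u vG]],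
          rule functional_Gdiff[OF \<Omega> R[unfolded dual_G_def] order.refl u vG Gdiff_in_G[OF \<Omega> u vG]])
    moreover have "S ?v = R ?v" using fun_cong[OF eq, of ?v] v by simp
    ultimately show ?thesis by simp
  qed
  then show "S = R"
    using S R unfolding dual_G_def cont_functionals_def by (auto intro: extensionalityI)
qed

lemma compact_functional_supp:
  fixes \<Omega> :: "(real^'n::finite) set"
  assumes \<Omega>: "open \<Omega>" and S: "S \<in> dual_G \<Omega>"
  shows "compact (functional_supp \<Omega> (restrict S (Gc \<Omega>)))"
proof -
  obtain L where L: "compact L" "L \<subseteq> \<Omega>"
      "\<And>f W. f \<in> EM \<Omega> \<Longrightarrow> open W \<Longrightarrow> L \<subseteq> W \<Longrightarrow> f \<in> Neg W \<Longrightarrow> S (Gclass \<Omega> f) = 0"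
    by (rule dual_G_carrier[OF \<Omega> S]) (rule that)
  define D where "D = {V. open V \<and> V \<subseteq> \<Omega> \<and> (\<forall>u\<in>Gc_sub \<Omega> V. restrict S (Gc \<Omega>) u = 0)}"
  have "restrict S (Gc \<Omega>) u = 0" if u: "u \<in> Gc_sub \<Omega> (\<Omega> - L)" for u
  proof -
    from u have uc: "u \<in> Gc \<Omega>" and s: "Gsupp \<Omega> u \<subseteq> \<Omega> - L" by (simp_all add: Gc_sub_def)
    then have cs: "compact (Gsupp \<Omega> u)" by (simp add: Gc_def)
    note o = open_diff_compact[OF \<Omega> cs]
    obtain f where f: "f \<in> EM \<Omega>" "u = Gclass \<Omega> f" using Gc_imp_Gclass[OF uc] by blast
    \<comment> \<open>The complement of the support is an open set that contains \<open>L\<close>,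
      as the carrier property demands.\<close>
    have "f \<in> Neg (\<Omega> - Gsupp \<Omega> u)" using Gsupp_subset_iff[OF \<Omega> f(1) o] f(2) by simp
    then have "S u = 0" unfolding f(2) using L(3)[OF f(1) o] L(2) s f(2) by blast
    then show ?thesis using uc by simp
  qed
  then have "\<Omega> - L \<in> D" unfolding D_def using open_diff_compact[OF \<Omega> L(1)] by simp
  \<comment> \<open>Removing an open set from the compact \<open>L\<close> gives compactness; being
    closed relative to \<open>\<Omega>\<close> would not suffice.\<close>
  then have "functional_supp \<Omega> (restrict S (Gc \<Omega>)) = L - \<Union>D"
    unfolding functional_supp_def D_def[symmetric] using L(2) by blast
  moreover have "open (\<Union>D)" unfolding D_def by blast
  ultimately show ?thesis using compact_diff[OF L(1)] by simp
qed

text \<open>The net \<open>f - \<psi> f\<close> is negligible off the support of \<open>u\<close>,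
  because \<open>f\<close> is, and it vanishes on \<open>W\<close>. Gluing makes it negligible on
  the union of both regions.\<close>

lemma Gsupp_Gdiff_Gmult:
  assumes \<Omega>: "open \<Omega>" and u: "u \<in> Gc \<Omega>" and \<psi>: "\<And>\<Omega>. smooth_on \<Omega> \<psi>"
    and W: "open W" "\<And>y. y \<in> W \<Longrightarrow> \<psi> y = 1"
  shows "Gsupp \<Omega> (Gdiff \<Omega> u (Gmult \<Omega> \<psi> u)) \<subseteq> Gsupp \<Omega> u - W"
proof -
  obtain f where f: "f \<in> EM \<Omega>" "u = Gclass \<Omega> f" using Gc_imp_Gclass[OF u] by blast
  let ?A = "Gsupp \<Omega> u" and ?g = "\<lambda>\<epsilon> x. f \<epsilon> x - \<psi> x * f \<epsilon> x"
  have cA: "compact ?A" using u by (simp add: Gc_def)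
  note o = open_diff_compact[OF \<Omega> cA]
  have N: "f \<in> Neg (\<Omega> - ?A)" using Gsupp_subset_iff[OF \<Omega> f(1) o] f(2) by simp
  have em: "(\<lambda>\<epsilon> x. \<psi> x * f \<epsilon> x) \<in> EM \<Omega>" by (rule EM_mult[OF \<Omega> f(1) \<psi>])
  have g1: "?g \<in> Neg (\<Omega> - ?A)" by (rule Neg_diff[OF o N Neg_mult[OF o N \<psi>]])
  have g2: "?g \<in> Neg W" by (rule Neg_vanishing[OF W(1)]) (simp add: W(2))
  have o': "open (\<Omega> - (?A - W))" by (rule open_diff_compact[OF \<Omega> compact_diff[OF cA W(1)]])
  have "?g \<in> Neg (\<Omega> - (?A - W))"
  proof (rule Neg_local[OF o'])
    fix x assume "x \<in> \<Omega> - (?A - W)"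
    then have "x \<in> W \<or> x \<in> \<Omega> - ?A" by blast
    then show "\<exists>V. open V \<and> x \<in> V \<and> ?g \<in> Neg V" using g1 g2 o W(1) by blast
  qed
  then have "Gsupp \<Omega> (Gclass \<Omega> ?g) \<subseteq> ?A - W"
    using Gsupp_subset_iff[OF \<Omega> EM_diff[OF \<Omega> f(1) em] o'] by simp
  moreover have "Gdiff \<Omega> u (Gmult \<Omega> \<psi> u) = Gclass \<Omega> ?g"
    unfolding f(2) Gmult_Gclass[OF \<Omega> f(1) \<psi>] Gdiff_Gclass[OF \<Omega> f(1) em] ..
  ultimately show ?thesis by simp
qed

text \<open>A partition of unity built one set at a time: a cutoff function inside \<open>V\<close>
  splits off a part of \<open>u\<close> that \<open>T\<close> kills, and the remainder is supported
  in the union of the smaller family.\<close>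

lemma functional_zero_on_cover:
  fixes \<Omega> :: "(real^'n::finite) set"
  assumes \<Omega>: "open \<Omega>" and T: "T \<in> cont_functionals \<Omega> (Gc \<Omega>) X"
    and F: "finite F" "\<And>V. V \<in> F \<Longrightarrow> open V \<and> V \<subseteq> \<Omega> \<and> (\<forall>u\<in>Gc_sub \<Omega> V. T u = 0)"
    and u: "u \<in> Gc \<Omega>" "Gsupp \<Omega> u \<subseteq> \<Union>F"
  shows "T u = 0"
  using F u
proof (induction F arbitrary: u)
  case empty
  obtain f where f: "f \<in> EM \<Omega>" "u = Gclass \<Omega> f" using Gc_imp_Gclass[OF empty(2)] by blast
  have "f \<in> Neg \<Omega>" using Gsupp_subset_iff[OF \<Omega> f(1), of "{}"] empty(3) f(2) \<Omega> by simp
  then have "u = Gzero \<Omega>" using Gclass_eq_Gzero_iff[OF \<Omega> f(1)] f(2) by simp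
  then show ?case using functional_Gzero[OF \<Omega> T Gzero_in_Gc[OF \<Omega>]] by simp
next
  case (insert V F)
  have V: "open V" "V \<subseteq> \<Omega>" "\<forall>u\<in>Gc_sub \<Omega> V. T u = 0" using insert.prems(1)[of V] by simp_all
  have "open (\<Union>F)" using insert.prems(1) by (intro open_Union) simp
  moreover have "compact (Gsupp \<Omega> u)" using insert.prems(2) by (simp add: Gc_def)
  ultimately have A: "compact (Gsupp \<Omega> u - \<Union>F)" by (intro compact_diff)
  have AV: "Gsupp \<Omega> u - \<Union>F \<subseteq> V" using insert.prems(3) by blast
  \<comment> \<open>The function must be \<open>1\<close> only near the part of the support that the
    other sets miss. That part is compact and contained in \<open>V\<close>, and removing
    \<open>W\<close> leaves support in \<open>\<Union>F\<close> alone.\<close>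
  obtain \<psi> W C where c: "\<And>\<Omega>. smooth_on \<Omega> \<psi>" "open W" "Gsupp \<Omega> u - \<Union>F \<subseteq> W" "\<And>y. y \<in> W \<Longrightarrow> \<psi> y = 1"
    "compact C" "C \<subseteq> V" "\<And>y. y \<notin> C \<Longrightarrow> \<psi> y = 0"
    by (rule smooth_cutoff_on[OF A V(1) AV]) (rule that)
  let ?v = "Gmult \<Omega> \<psi> u"
  have uG: "u \<in> G \<Omega>" using insert.prems(2) Gc_subset_G by blast
  have C\<Omega>: "C \<subseteq> \<Omega>" using c(6) V(2) by blast
  have vc: "?v \<in> Gc \<Omega>" by (rule Gmult_in_Gc[OF \<Omega> uG c(1,5) C\<Omega> c(7)])
  have "?v \<in> GK \<Omega> C" by (rule Gmult_in_GK[OF \<Omega> uG c(1,5,7)])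
  with vc c(6) have "?v \<in> Gc_sub \<Omega> V" by (auto simp: GK_def Gc_sub_def)
  with V(3) have v0: "T ?v = 0" by blast
  have w: "Gdiff \<Omega> u ?v \<in> Gc \<Omega>" by (rule Gdiff_in_Gc[OF \<Omega> insert.prems(2) vc])
  have sw: "Gsupp \<Omega> (Gdiff \<Omega> u ?v) \<subseteq> \<Union>F"
    using Gsupp_Gdiff_Gmult[OF \<Omega> insert.prems(2) c(1,2,4)] c(3) by blast
  have "T (Gdiff \<Omega> u ?v) = 0"
    by (rule insert.IH[OF insert.prems(1)[OF insertI2] w sw])
  then show ?case
    using functional_Gdiff[OF \<Omega> T Gc_subset_G insert.prems(2) vc w] v0 by simp
qed

text \<open>Off its support \<open>T\<close> is zero only locally, on each open set of a cover;
  compactness of the support of \<open>u\<close> makes the cover finite.\<close>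

lemma functional_zero_off_supp:
  fixes \<Omega> :: "(real^'n::finite) set"
  assumes \<Omega>: "open \<Omega>" and T: "T \<in> cont_functionals \<Omega> (Gc \<Omega>) X"
    and u: "u \<in> Gc \<Omega>" "Gsupp \<Omega> u \<inter> functional_supp \<Omega> T = {}"
  shows "T u = 0"
proof -
  define D where "D = {V. open V \<and> V \<subseteq> \<Omega> \<and> (\<forall>u\<in>Gc_sub \<Omega> V. T u = 0)}"
  have sub: "Gsupp \<Omega> u \<subseteq> \<Union>D"
    using u(2) Gsupp_subset_domain[of \<Omega> u] unfolding functional_supp_def D_def[symmetric] by blast
  have c: "compact (Gsupp \<Omega> u)" using u(1) by (simp add: Gc_def)
  obtain F where F: "F \<subseteq> D" "finite F" "Gsupp \<Omega> u \<subseteq> \<Union>F"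
    by (rule compactE[OF c sub]) (simp add: D_def, rule that)
  show ?thesis
    by (rule functional_zero_on_cover[OF \<Omega> T F(2) _ u(1) F(3)]) (use F(1) D_def in blast)
qed

text \<open>Since \<open>K n\<close> lies in the interior of \<open>K (Suc n)\<close>, the interiors
  form an open cover of \<open>\<Omega>\<close>, to which compactness of \<open>C\<close> applies;
  the sequence is increasing, so one member suffices.\<close>

lemma exhausting_absorbs:
  assumes "exhausting \<Omega> K" "compact C" "C \<subseteq> \<Omega>"
  shows "\<exists>n. C \<subseteq> K n"
proof -
  have K: "\<And>n. K n \<subseteq> interior (K (Suc n))" "(\<Union>n. K n) = \<Omega>"
    using assms(1) unfolding exhausting_def by blast+
  have mono: "K m \<subseteq> K n" if "m \<le> n" for m n
    by (rule lift_Suc_mono_le[of K, OF order.trans[OF K(1) interior_subset] that])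
  have cov: "C \<subseteq> (\<Union>n\<in>UNIV. interior (K (Suc n)))" using K assms(3) by blast
  obtain N where N: "finite N" "C \<subseteq> (\<Union>n\<in>N. interior (K (Suc n)))"
    by (rule compactE_image[OF assms(2) _ cov]) (simp, rule that)
  \<comment> \<open>The successor matches the shifted cover. If \<open>N\<close> is empty,
    \<open>Max N\<close> is unspecified, but then \<open>C\<close> is empty as well.\<close>
  have "interior (K (Suc n)) \<subseteq> K (Suc (Max N))" if "n \<in> N" for n
    by (rule order.trans[OF interior_subset mono]) (simp add: Max_ge[OF N(1) that])
  with N(2) show ?thesis by blast
qed

lemma dual_Gc_extends:
  fixes \<Omega> :: "(real^'n::finite) set"
  assumes \<Omega>: "open \<Omega>" and K: "exhausting \<Omega> K" and T: "T \<in> dual_Gc \<Omega> K"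
    and supp: "compact (functional_supp \<Omega> T)"
  shows "\<exists>S\<in>dual_G \<Omega>. T = restrict S (Gc \<Omega>)"
proof -
  note T' = T[unfolded dual_Gc_def]
  have H: "functional_supp \<Omega> T \<subseteq> \<Omega>" by (auto simp: functional_supp_def)
  obtain \<psi> W C where c: "\<And>\<Omega>. smooth_on \<Omega> \<psi>" "open W" "functional_supp \<Omega> T \<subseteq> W" "\<And>y. y \<in> W \<Longrightarrow> \<psi> y = 1"
    "compact C" "C \<subseteq> \<Omega>" "\<And>y. y \<notin> C \<Longrightarrow> \<psi> y = 0"
    by (rule smooth_cutoff_on[OF supp \<Omega> H]) (rule that)
  \<comment> \<open>All products with \<open>\<psi>\<close> lie in this one step, so continuity of
    \<open>T\<close> is used only on \<open>GK \<Omega> (K n)\<close>.\<close>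
  obtain n where n: "C \<subseteq> K n" using exhausting_absorbs[OF K c(5,6)] by blast
  have Kn: "compact (K n)" "K n \<subseteq> \<Omega>" using K unfolding exhausting_def by blast+
  define S where "S = restrict (\<lambda>u. T (Gmult \<Omega> \<psi> u)) (G \<Omega>)"
  have mem: "Gmult \<Omega> \<psi> u \<in> Gc \<Omega>" if "u \<in> G \<Omega>" for u
    by (rule Gmult_in_Gc[OF \<Omega> that c(1,5,6,7)])
  have add: "S (Gadd \<Omega> u v) = S u + S v" if "u \<in> G \<Omega>" "v \<in> G \<Omega>" for u v
  proof -
    obtain f g where f: "f \<in> EM \<Omega>" "u = Gclass \<Omega> f" and g: "g \<in> EM \<Omega>" "v = Gclass \<Omega> g"
      using \<open>u \<in> G \<Omega>\<close> \<open>v \<in> G \<Omega>\<close> unfolding G_iff by blast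
    have "Gmult \<Omega> \<psi> (Gadd \<Omega> u v) = Gadd \<Omega> (Gmult \<Omega> \<psi> u) (Gmult \<Omega> \<psi> v)"
      by (simp add: f g Gmult_Gclass Gadd_Gclass \<Omega> c(1) EM_add EM_mult distrib_left)
    then show ?thesis
      using T' mem that Gadd_in_G[OF \<Omega> that] by (simp add: S_def cont_functionals_def)
  qed
  have scale: "S (Gscale \<Omega> a u) = a * S u" if "u \<in> G \<Omega>" for a u
  proof -
    obtain f where f: "f \<in> EM \<Omega>" "u = Gclass \<Omega> f" using \<open>u \<in> G \<Omega>\<close> unfolding G_iff by blast
    have "Gmult \<Omega> \<psi> (Gscale \<Omega> a u) = Gscale \<Omega> a (Gmult \<Omega> \<psi> u)"
      by (simp add: f Gmult_Gclass Gscale_Gclass \<Omega> c(1) EM_cmult moderate_rep EM_mult mult.left_commute)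
    then show ?thesis
      using T' mem that Gscale_in_G[OF \<Omega> that] by (simp add: S_def cont_functionals_def)
  qed
  have "continuous_map (GK_topology \<Omega> (K n)) (Gc_topology \<Omega> K) (\<lambda>u. u)"
    using Gc_topology_finest(1)[OF K] unfolding Gc_admissible_def by blast
  moreover have "continuous_map (Gc_topology \<Omega> K) euclidean T"
    using T' by (simp add: cont_functionals_def)
  ultimately have "continuous_map (GK_topology \<Omega> (K n)) euclidean (T \<circ> (\<lambda>u. u))"
    by (rule continuous_map_compose)
  from continuous_map_compose[OF continuous_map_Gmult[OF \<Omega> Kn c(1,5) n c(7)] this]
  have "continuous_map (G_topology \<Omega>) euclidean (\<lambda>u. T (Gmult \<Omega> \<psi> u))"
    by (simp add: o_def)
  then have "continuous_map (G_topology \<Omega>) euclidean S"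
    by (rule continuous_map_eq) (simp add: S_def topspace_G_topology)
  with add scale have "S \<in> dual_G \<Omega>"
    unfolding dual_G_def cont_functionals_def by (simp add: S_def)
  moreover have "T = restrict S (Gc \<Omega>)"
  proof (rule extensionalityI)
    show "T \<in> extensional (Gc \<Omega>)" using T' by (simp add: cont_functionals_def)
    fix u assume u: "u \<in> Gc \<Omega>"
    then have uG: "u \<in> G \<Omega>" using Gc_subset_G by blast
    have w: "Gdiff \<Omega> u (Gmult \<Omega> \<psi> u) \<in> Gc \<Omega>" by (rule Gdiff_in_Gc[OF \<Omega> u mem[OF uG]])
    \<comment> \<open>The support of \<open>u - \<psi> u\<close> avoids \<open>W\<close>, which
      contains the support of \<open>T\<close>.\<close>
    have "T (Gdiff \<Omega> u (Gmult \<Omega> \<psi> u)) = 0"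
      using Gsupp_Gdiff_Gmult[OF \<Omega> u c(1,2,4)] c(3) by (intro functional_zero_off_supp[OF \<Omega> T' w]) blast
    then have "T u = T (Gmult \<Omega> \<psi> u)"
      using functional_Gdiff[OF \<Omega> T' Gc_subset_G u mem[OF uG] w] by simp
    then show "T u = restrict S (Gc \<Omega>) u" using u uG by (simp add: S_def)
  qed simp
  ultimately show ?thesis by blast
qed

text \<open>Compactness alone expresses being a compact subset of \<open>\<Omega>\<close>, since
  \<open>functional_supp \<Omega> T\<close> is contained in \<open>\<Omega>\<close> by definition.
  The first conjunct is what gives the identification of functionals a meaning: restrictions are
  again continuous for the inductive limit topology.\<close>

theorem theorem1p2:
  fixes \<Omega> :: "(real^'n::finite) set" and K :: "nat \<Rightarrow> (real^'n) set"
  assumes "open \<Omega>" and "exhausting \<Omega> K"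
  shows "(\<lambda>S. restrict S (Gc \<Omega>)) \<in> dual_G \<Omega> \<rightarrow> dual_Gc \<Omega> K
    \<and> inj_on (\<lambda>S. restrict S (Gc \<Omega>)) (dual_G \<Omega>)
    \<and> (\<forall>T\<in>dual_Gc \<Omega> K.
         T \<in> (\<lambda>S. restrict S (Gc \<Omega>)) ` dual_G \<Omega> \<longleftrightarrow> compact (functional_supp \<Omega> T))"
proof (intro conjI ballI iffI)
  show "(\<lambda>S. restrict S (Gc \<Omega>)) \<in> dual_G \<Omega> \<rightarrow> dual_Gc \<Omega> K"
    using restrict_in_dual_Gc[OF assms] by blast
  show "inj_on (\<lambda>S. restrict S (Gc \<Omega>)) (dual_G \<Omega>)"
    by (rule inj_on_restrict_dual_G[OF assms(1)])
  fix T assume T: "T \<in> dual_Gc \<Omega> K"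
  show "compact (functional_supp \<Omega> T)" if "T \<in> (\<lambda>S. restrict S (Gc \<Omega>)) ` dual_G \<Omega>"
    using that compact_functional_supp[OF assms(1)] by blast
  show "T \<in> (\<lambda>S. restrict S (Gc \<Omega>)) ` dual_G \<Omega>" if "compact (functional_supp \<Omega> T)"
    using dual_Gc_extends[OF assms T that] by blast
qed

end
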